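(* Let $Y=\{Y(t),t\geqslant 0\}$ be a spectrally positive Lévy process, i.e., a real-valued Lévy process without downward jumps, whose paths are not almost surely non-decreasing. Let $\varphi(\alpha)=\log\mathbb{E}\,e^{-\alpha Y(1)}$, $\alpha\geqslant 0$, be its Laplace exponent and $\psi(q)=\sup\{\alpha\geqslant 0:\varphi(\alpha)=q\}$, $q\geqslant 0$, its right-inverse. Let $\omega>0$ and $\beta\geqslant 0$; if $\beta=0$, assume in addition that $\mathbb{E}\,Y(1)<0$. Let $Y_{\beta,\omega}$ be the running maximum of $Y$ at Poisson($\omega$) inspection epochs until the exponential($\beta$) killing time (as defined in the context). Then, for $\alpha\geqslant 0$, $$\mathbb{E}\,e^{-\alpha Y_{\beta,\omega}}=\frac{\alpha-\psi(\beta)}{\beta-\varphi(\alpha)}\,\frac{\beta}{\psi(\beta)}\,\frac{\beta+\omega-\varphi(\alpha)}{\alpha-\psi(\beta+\omega)}\,\frac{\psi(\beta+\omega)}{\beta+\omega},$$ where expressions of the form $0/0$ on the right-hand side (at $\alpha=\psi(\beta)$, at $\alpha=\psi(\beta+\omega)$, or $\beta/\psi(\beta)$ at $\beta=0$) are understood as the corresponding limits.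
   Context: $Y(0)=0$. The process $Y$ is inspected at the epochs $0=I_0<I_1<I_2<\dots$ of a Poisson process of intensity $\omega$, independent of $Y$, until an independent exponentially distributed killing time $T_\beta$ with parameter $\beta$. Let $N_{\beta,\omega}$ be the number of inspections before killing, so $\mathbb{P}(N_{\beta,\omega}=n)=\left(\frac{\omega}{\beta+\omega}\right)^n\frac{\beta}{\beta+\omega}$, $n=0,1,\dots$. Let $Z_1,Z_2,\dots$ be the increments of $Y$ between consecutive inspection epochs, conditioned on the process not having been killed; they are i.i.d., distributed as $Y(T_{\beta+\omega})$ with $T_{\beta+\omega}$ exponential with parameter $\beta+\omega$ and independent of $Y$, and they are independent of $N_{\beta,\omega}$. With $S_0=0$ and $S_n=\sum_{m=1}^n Z_m$, define $Y_{\beta,\omega}:=\max_{0\leqslant n\leqslant N_{\beta,\omega}}S_n$. (Equivalently, in law, $Y_{\beta,\omega}$ is the maximum of $Y(I_n)$ over all $n\geqslant 0$ with $I_n\leqslant T_\beta$.) For $\beta=0$ we use the convention $T_0=\infty$, $N_{0,\omega}=\infty$, so that $Y_{0,\omega}=\sup_{n\geqslant 0}S_n$. *)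

theory Defs
  imports "HOL-Probability.Probability"
begin

text \<open>
  Processes are indexed by \<^typ>\<open>real\<close>; only times in \<open>{0..}\<close> are constrained.
  The trajectory is the process as one random element of the product space.
\<close>

definition trajectory :: "(real \<Rightarrow> 'a \<Rightarrow> real) \<Rightarrow> 'a \<Rightarrow> real \<Rightarrow> real" where
  "trajectory Y x = (\<lambda>t\<in>{0..}. Y t x)"

abbreviation trajectory_space :: "(real \<Rightarrow> real) measure" where
  "trajectory_space \<equiv> PiM {0..} (\<lambda>_. borel)"

text \<open>
  The library's \<open>indep_var\<close> requires both random elements to have the same type; here the target
  spaces may differ.
\<close>

definition indep_elements ::
  "'a measure \<Rightarrow> 'b measure \<Rightarrow> ('a \<Rightarrow> 'b) \<Rightarrow> 'c measure \<Rightarrow> ('a \<Rightarrow> 'c) \<Rightarrow> bool" where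
  "indep_elements M S X S' X' \<longleftrightarrow>
     X \<in> measurable M S \<and> X' \<in> measurable M S' \<and>
     prob_space.indep_set M
       (sets (vimage_algebra (space M) X S)) (sets (vimage_algebra (space M) X' S'))"

definition cadlag :: "(real \<Rightarrow> real) \<Rightarrow> bool" where
  "cadlag f \<longleftrightarrow>
     (\<forall>t\<ge>0. continuous (at_right t) f) \<and> (\<forall>t>0. \<exists>l. (f \<longlongrightarrow> l) (at_left t))"

text \<open>
  Every path (not only almost every path) is cadlag, so that the process sampled at a random
  time is measurable without completing the probability space. Stochastic continuity follows
  from right-continuity at 0 and stationarity.
\<close>

definition levy_process :: "'a measure \<Rightarrow> (real \<Rightarrow> 'a \<Rightarrow> real) \<Rightarrow> bool" where
  "levy_process M Y \<longleftrightarrow>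
     prob_space M \<and>
     (\<forall>t\<ge>0. Y t \<in> borel_measurable M) \<and>
     (AE x in M. Y 0 x = 0) \<and>
     (\<forall>(n::nat) (t::nat \<Rightarrow> real). 0 \<le> t 0 \<longrightarrow> (\<forall>i<n. t i \<le> t (Suc i)) \<longrightarrow>
        prob_space.indep_vars M (\<lambda>_. borel) (\<lambda>i x. Y (t (Suc i)) x - Y (t i) x) {..<n}) \<and>
     (\<forall>s\<ge>0. \<forall>h\<ge>0. distr M borel (\<lambda>x. Y (s + h) x - Y s x) = distr M borel (Y h)) \<and>
     (\<forall>x\<in>space M. cadlag (\<lambda>t. Y t x))"

definition spectrally_positive :: "'a measure \<Rightarrow> (real \<Rightarrow> 'a \<Rightarrow> real) \<Rightarrow> bool" where
  "spectrally_positive M Y \<longleftrightarrow>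
     (AE x in M. \<forall>t>0. Lim (at_left t) (\<lambda>s. Y s x) \<le> Y t x)"

definition laplace_exponent :: "'a measure \<Rightarrow> (real \<Rightarrow> 'a \<Rightarrow> real) \<Rightarrow> real \<Rightarrow> real" where
  "laplace_exponent M Y \<alpha> = ln (\<integral>x. exp (- \<alpha> * Y 1 x) \<partial>M)"

definition right_inverse :: "(real \<Rightarrow> real) \<Rightarrow> real \<Rightarrow> real" where
  "right_inverse \<phi> q = Sup {\<alpha>. 0 \<le> \<alpha> \<and> \<phi> \<alpha> = q}"

text \<open>
  The random-walk description of the inspected process: \<open>Z\<close> are the increments between
  inspections given survival, \<open>N\<close> is the number of inspections before killing and
  \<open>\<tau>\<close> is an exponential time independent of \<open>Y\<close>. For \<open>\<beta> = 0\<close> the law prescribed for \<open>N\<close>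
  gives every finite value probability 0, that is, \<open>N = \<infinity>\<close> almost surely.
\<close>

definition inspection_walk ::
  "'a measure \<Rightarrow> (real \<Rightarrow> 'a \<Rightarrow> real) \<Rightarrow> real \<Rightarrow> real \<Rightarrow>
   ('a \<Rightarrow> real) \<Rightarrow> (nat \<Rightarrow> 'a \<Rightarrow> real) \<Rightarrow> ('a \<Rightarrow> enat) \<Rightarrow> bool" where
  "inspection_walk M Y \<beta> \<omega> \<tau> Z N \<longleftrightarrow>
     (\<forall>x\<in>space M. 0 \<le> \<tau> x) \<and>
     distributed M lborel \<tau> (exponential_density (\<beta> + \<omega>)) \<and>
     indep_elements M borel \<tau> trajectory_space (trajectory Y) \<and>
     prob_space.indep_vars M (\<lambda>_. borel) Z {1..} \<and>
     (\<forall>m\<ge>1. distr M borel (Z m) = distr M borel (\<lambda>x. Y (\<tau> x) x)) \<and>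
     N \<in> measurable M (count_space UNIV) \<and>
     (\<forall>n. measure M {x\<in>space M. N x = enat n} = (\<omega> / (\<beta> + \<omega>)) ^ n * (\<beta> / (\<beta> + \<omega>))) \<and>
     indep_elements M (count_space UNIV) N
       (PiM {1..} (\<lambda>_. borel)) (\<lambda>x. \<lambda>m\<in>{1..}. Z m x)"

text \<open>
  The supremum is a maximum when \<open>N x\<close> is finite; the \<open>n = 0\<close> term contributes the value 0.
\<close>

definition walk_max :: "(nat \<Rightarrow> 'a \<Rightarrow> real) \<Rightarrow> ('a \<Rightarrow> enat) \<Rightarrow> 'a \<Rightarrow> real" where
  "walk_max Z N x = (SUP n\<in>{n. enat n \<le> N x}. \<Sum>m=1..n. Z m x)"

text \<open>
  The pathwise description: \<open>I\<close> are the epochs of a Poisson process, given by its i.i.d.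
  exponential interarrival times, and \<open>T\<close> is the killing time; \<open>Y\<close>, \<open>I\<close>, \<open>T\<close> are mutually
  independent.
\<close>

definition poisson_epochs :: "'a measure \<Rightarrow> real \<Rightarrow> (nat \<Rightarrow> 'a \<Rightarrow> real) \<Rightarrow> bool" where
  "poisson_epochs M \<omega> I \<longleftrightarrow>
     (\<forall>x\<in>space M. I 0 x = 0 \<and> strict_mono (\<lambda>n. I n x)) \<and>
     prob_space.indep_vars M (\<lambda>_. borel) (\<lambda>n x. I (Suc n) x - I n x) UNIV \<and>
     (\<forall>n. distributed M lborel (\<lambda>x. I (Suc n) x - I n x) (exponential_density \<omega>))"

definition killing_time :: "'a measure \<Rightarrow> real \<Rightarrow> ('a \<Rightarrow> ereal) \<Rightarrow> bool" where
  "killing_time M \<beta> T \<longleftrightarrow>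
     (if \<beta> = 0 then \<forall>x\<in>space M. T x = \<infinity>
      else \<exists>E. distributed M lborel E (exponential_density \<beta>) \<and> (\<forall>x\<in>space M. T x = ereal (E x)))"

definition inspection_scheme ::
  "'a measure \<Rightarrow> (real \<Rightarrow> 'a \<Rightarrow> real) \<Rightarrow> real \<Rightarrow> real \<Rightarrow>
   (nat \<Rightarrow> 'a \<Rightarrow> real) \<Rightarrow> ('a \<Rightarrow> ereal) \<Rightarrow> bool" where
  "inspection_scheme M Y \<beta> \<omega> I T \<longleftrightarrow>
     poisson_epochs M \<omega> I \<and>
     killing_time M \<beta> T \<and>
     indep_elements M (PiM UNIV (\<lambda>_. borel)) (\<lambda>x n. I n x) borel T \<and>
     indep_elements M trajectory_space (trajectory Y)
       (PiM UNIV (\<lambda>_. borel) \<Otimes>\<^sub>M borel) (\<lambda>x. (\<lambda>n. I n x, T x))"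

definition inspected_max ::
  "(real \<Rightarrow> 'a \<Rightarrow> real) \<Rightarrow> (nat \<Rightarrow> 'a \<Rightarrow> real) \<Rightarrow> ('a \<Rightarrow> ereal) \<Rightarrow> 'a \<Rightarrow> real" where
  "inspected_max Y I T x = (SUP n\<in>{n. ereal (I n x) \<le> T x}. Y (I n x) x)"

text \<open>
  A quotient of functions on \<open>{0..}\<close> in which \<open>0/0\<close> stands for the limit; at the point 0 this
  is the limit from the right.
\<close>

definition quot_lim :: "(real \<Rightarrow> real) \<Rightarrow> (real \<Rightarrow> real) \<Rightarrow> real \<Rightarrow> real" where
  "quot_lim f g a =
     (if f a = 0 \<and> g a = 0 then Lim (at a within {0..}) (\<lambda>u. f u / g u) else f a / g a)"

end

theory Submission
  imports Defs
begin

text \<open>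
  Let \<open>Z\<close> have the law \<open>mu q\<close> of \<open>Y\<close> at an independent exponential time of rate
  \<open>q = \<beta> + \<omega>\<close>. Since \<open>Y\<close> has no downward jumps, it reaches each level below 0 without
  overshoot, and the lack of memory of the exponential time makes the lower tail of \<open>Z\<close> exactly
  exponential: \<open>P (Z < - x) = c * exp (- \<theta> * x)\<close> for \<open>x \<ge> 0\<close>. The rate \<open>\<theta>\<close> grows without
  bound in \<open>q\<close>, so all negative exponential moments of \<open>Y\<close> are finite; comparing the transforms
  then identifies \<open>\<theta>\<close> with \<open>\<psi> q\<close>.

  The maxima \<open>M\<^sub>n\<close> of the walk satisfy Lindley's recursion in law, \<open>M\<^sub>n\<^sub>+\<^sub>1 = max 0 (Z + M\<^sub>n)\<close>.
  With an exponential lower tail the transform \<open>F\<^sub>n \<alpha> = E (exp (- \<alpha> * M\<^sub>n))\<close> obeys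
  \<open>F\<^sub>n\<^sub>+\<^sub>1 \<alpha> = q / (q - \<phi> \<alpha>) * F\<^sub>n \<alpha> - c * \<alpha> / (\<theta> - \<alpha>) * F\<^sub>n \<theta>\<close>. Summing over a geometric \<open>n\<close>
  leaves a linear equation whose only unknown constant is determined by the zero
  \<open>\<alpha> = \<psi> \<beta>\<close> of \<open>\<beta> - \<phi> \<alpha>\<close>. For \<open>\<alpha> > \<theta>\<close>, where \<open>E (exp (- \<alpha> * Z))\<close> is infinite, the resolvent
  equation between \<open>mu q\<close> and \<open>mu r\<close> with large \<open>r\<close> replaces analytic continuation. The case
  \<open>\<beta> = 0\<close> is the limit of positive killing rates.
\<close>

text \<open>No exponential moment of \<open>Y\<close> is assumed, and where one is infinite the
  Bochner integral in \<open>laplace_exponent\<close> is 0 by default and its logarithm carries no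
  information. Hence probabilities come before transforms: the shape of the lower tail is settled
  first, and transforms stay in \<open>ennreal\<close> until \<open>mgf_finite\<close>. A tail of
  rate \<open>\<theta>\<close> makes \<open>exp (- a * z)\<close> integrable only for
  \<open>a < \<theta>\<close>; this is why the rate must be shown to be unbounded. The constant
  \<open>c\<close>, which is \<open>tail q 0\<close>, is never computed. It enters the recursion
  only as a factor of the values at \<open>\<theta>\<close>, and after summation this product is the
  single unknown to be eliminated. Beyond \<open>\<theta>\<close> the recursion keeps its meaning
  because a step \<open>z\<close> enters only through \<open>max 0 (z + m)\<close>, which cuts off
  the large negative steps. What is needed there is the transform of the nonnegative part of
  \<open>Z\<close>, finite for every nonnegative argument; its values beyond \<open>\<theta>\<close>
  are what the resolvent equation supplies.\<close>

section \<open>Freezing independent variables, the exponential functional equation, Laplace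
  transforms, Abel means\<close>

text \<open>The second coordinate is the point of \<open>M\<close> itself, equipped with the
  sigma-algebra generated by \<open>X'\<close>. So \<open>h\<close> may mention the process directly
  and need not be rewritten as a function of \<open>X'\<close>.\<close>

lemma (in prob_space) indep_elements_nn_integral:
  assumes ind: "indep_elements M S X S' X'"
    and h: "case_prod h \<in> borel_measurable (S \<Otimes>\<^sub>M vimage_algebra (space M) X' S')"
  shows "(\<integral>\<^sup>+x. h (X x) x \<partial>M) = (\<integral>\<^sup>+x. (\<integral>\<^sup>+y. h (X x) y \<partial>M) \<partial>M)"
proof -
  let ?F = "vimage_algebra (space M) X' S'"
  from ind have X: "X \<in> measurable M S" and X': "X' \<in> measurable M S'"
    and i: "indep_set (sets (vimage_algebra (space M) X S)) (sets ?F)"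
    by (auto simp: indep_elements_def)
  have idm: "(\<lambda>x. x) \<in> measurable M ?F"
    by (rule measurable_vimage_algebra2) (use X' in \<open>auto dest: measurable_space\<close>)
  interpret A: prob_space "distr M S X" by (rule prob_space_distr[OF X])
  interpret B: prob_space "distr M ?F (\<lambda>x. x)" by (rule prob_space_distr[OF idm])
  interpret AB: pair_prob_space "distr M S X" "distr M ?F (\<lambda>x. x)" ..
  have pm: "(\<lambda>x. (X x, x)) \<in> measurable M (S \<Otimes>\<^sub>M ?F)"
    using X idm by measurable
  have "distr M S X \<Otimes>\<^sub>M distr M ?F (\<lambda>x. x) = distr M (S \<Otimes>\<^sub>M ?F) (\<lambda>x. (X x, x))"
  proof (rule pair_measure_eqI)
    show "sigma_finite_measure (distr M S X)" ..
    show "sigma_finite_measure (distr M ?F (\<lambda>x. x))" ..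
    fix A B assume "A \<in> sets (distr M S X)" "B \<in> sets (distr M ?F (\<lambda>x. x))"
    then have A: "A \<in> sets S" and B: "B \<in> sets ?F" by auto
    have sub: "B \<subseteq> space M" using sets.sets_into_space[OF B] by simp
    have "(\<lambda>x. (X x, x)) -` (A \<times> B) \<inter> space M = (X -` A \<inter> space M) \<inter> B"
      using sub by auto
    moreover have "X -` A \<inter> space M \<in> sets (vimage_algebra (space M) X S)"
      using A by (rule in_vimage_algebra)
    then have "prob ((X -` A \<inter> space M) \<inter> B) = prob (X -` A \<inter> space M) * prob B"
      using indep_setD[OF i] B by auto
    moreover have "(\<lambda>x. x) -` B \<inter> space M = B" using sub by auto
    ultimately show "emeasure (distr M S X) A * emeasure (distr M ?F (\<lambda>x. x)) B =
        emeasure (distr M (S \<Otimes>\<^sub>M ?F) (\<lambda>x. (X x, x))) (A \<times> B)"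
      using A B X idm pm
      by (simp add: emeasure_distr emeasure_eq_measure ennreal_mult)
  qed simp
  note eq = this
  have "(\<integral>\<^sup>+x. h (X x) x \<partial>M) = (\<integral>\<^sup>+z. case_prod h z \<partial>distr M (S \<Otimes>\<^sub>M ?F) (\<lambda>x. (X x, x)))"
    using h pm by (simp add: nn_integral_distr)
  also have "\<dots> = (\<integral>\<^sup>+u. (\<integral>\<^sup>+y. case_prod h (u, y) \<partial>distr M ?F (\<lambda>x. x)) \<partial>distr M S X)"
    unfolding eq[symmetric] using h
    by (intro B.nn_integral_fst[symmetric]) (simp cong: measurable_cong_sets)
  also have "\<dots> = (\<integral>\<^sup>+x. (\<integral>\<^sup>+y. case_prod h (X x, y) \<partial>distr M ?F (\<lambda>x. x)) \<partial>M)"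
  proof (rule nn_integral_distr[OF X])
    have "case_prod h \<in> borel_measurable (S \<Otimes>\<^sub>M distr M ?F (\<lambda>x. x))"
      using h by (simp cong: measurable_cong_sets)
    from B.borel_measurable_nn_integral_fst[OF this]
    show "(\<lambda>u. \<integral>\<^sup>+y. case_prod h (u, y) \<partial>distr M ?F (\<lambda>x. x)) \<in> borel_measurable (distr M S X)"
      by simp
  qed
  also have "\<dots> = (\<integral>\<^sup>+x. (\<integral>\<^sup>+y. h (X x) y \<partial>M) \<partial>M)"
  proof (rule nn_integral_cong)
    fix x assume x: "x \<in> space M"
    have "(\<lambda>y. case_prod h (X x, y)) \<in> borel_measurable ?F"
      using h measurable_space[OF X x] by (rule measurable_Pair2)
    then show "(\<integral>\<^sup>+y. case_prod h (X x, y) \<partial>distr M ?F (\<lambda>x. x)) = (\<integral>\<^sup>+y. h (X x) y \<partial>M)"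
      using idm by (simp add: nn_integral_distr)
  qed
  finally show ?thesis .
qed

text \<open>Integrating \<open>h (t + s) = h t * h s\<close> over \<open>s\<close> in
  \<open>{0..1}\<close> expresses \<open>h\<close> through its own integral. Thus local
  integrability alone yields continuity, and then differentiability.\<close>

lemma multiplicative_imp_exp:
  fixes h :: "real \<Rightarrow> real"
  assumes pos: "\<And>t. 0 \<le> t \<Longrightarrow> 0 < h t"
    and mult: "\<And>s t. 0 \<le> s \<Longrightarrow> 0 \<le> t \<Longrightarrow> h (s + t) = h s * h t"
    and int: "\<And>b. set_integrable lborel {0..b} h"
  obtains k where "\<And>t. 0 \<le> t \<Longrightarrow> h t = exp (k * t)"
proof -
  define C where "C = integral {0..1} h"
  define H where "H t = integral {0..t} h" for t
  have ion: "h integrable_on {0..b}" for b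
    using set_borel_integral_eq_integral(1)[OF int] .
  have ion2: "h integrable_on {a..b}" if "0 \<le> a" for a b
    using integrable_on_subinterval[OF ion[of b]] that by auto
  have C_eq: "C = (LINT s:{0..1}|lborel. h s)"
    unfolding C_def using set_borel_integral_eq_integral(2)[OF int] by simp
  have C0: "0 \<le> C" unfolding C_eq set_lebesgue_integral_def
    by (rule Bochner_Integration.integral_nonneg) (auto simp: indicator_def pos less_imp_le)
  have Cp: "0 < C"
  proof (rule ccontr)
    assume "\<not> 0 < C"
    with C0 have "(LINT s|lborel. indicator {0..1} s *\<^sub>R h s) = 0"
      by (simp add: C_eq set_lebesgue_integral_def)
    then have "AE s in lborel. indicator {0..1} s *\<^sub>R h s = 0"
      using int[of 1] by (subst (asm) integral_nonneg_eq_0_iff_AE)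
        (auto simp: set_integrable_def indicator_def pos less_imp_le)
    then have "AE s in lborel. s \<notin> {0..1::real}"
      by eventually_elim (use pos in \<open>force simp: indicator_def\<close>)
    then have "emeasure lborel {0..1::real} = 0"
      by (subst (asm) AE_iff_measurable[where N="{0..1}"]) auto
    then show False by simp
  qed
  have shift: "H (t + 1) - H t = h t * C" if t: "0 \<le> t" for t
  proof -
    have "H (t + 1) = H t + integral {t..t+1} h"
      unfolding H_def using t ion[of "t+1"]
      by (intro Henstock_Kurzweil_Integration.integral_combine[symmetric]) auto
    moreover have "integral {t..t+1} h = (LINT s:{t..t+1}|lborel. h s)"
      by (rule set_borel_integral_eq_integral(2)[symmetric])
         (rule set_integrable_subset[OF int[of "t+1"]], use t in auto)
    moreover have "\<dots> = (LINT s|lborel. indicator {t..t+1} (t + 1 * s) *\<^sub>R h (t + 1 * s))"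
      unfolding set_lebesgue_integral_def
      using lborel_integral_real_affine[of 1 "\<lambda>s. indicator {t..t+1} s *\<^sub>R h s" t] by simp
    moreover have "\<dots> = (LINT s|lborel. h t * (indicator {0..1} s *\<^sub>R h s))"
      by (rule Bochner_Integration.integral_cong) (use t mult in \<open>auto simp: indicator_def\<close>)
    moreover have "\<dots> = h t * C"
      by (simp add: C_eq set_lebesgue_integral_def)
    ultimately show ?thesis by simp
  qed
  have contH: "continuous_on {0..b} H" for b
    unfolding H_def by (rule indefinite_integral_continuous_1[OF ion])
  have h_eq: "h t = (H (t + 1) - H t) / C" if "0 \<le> t" for t
    using shift[OF that] Cp by simp
  have conth: "continuous_on {0..b} h" for b
  proof -
    have "continuous_on {0..b} (\<lambda>t. (H (t + 1) - H t) / C)"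
      by (intro continuous_intros continuous_on_compose2[OF contH[of "b+1"], of _ "\<lambda>t. t + 1"] contH)
         (use Cp in auto)
    then show ?thesis by (rule continuous_on_cong[THEN iffD1, rotated 2]) (auto simp: h_eq)
  qed
  have dH: "(H has_real_derivative h t) (at t within {0..b})" if "0 \<le> t" "t \<le> b" for t b
    unfolding H_def using integral_has_real_derivative[OF conth[of b], of t] that by auto
  \<comment> \<open>Differentiating \<open>h t = (H (t + 1) - H t) / C\<close> gives
    \<open>(h (t + 1) - h t) / C\<close>, which is this constant times \<open>h t\<close>.\<close>
  define k where "k = (h 1 - 1) / C"
  have dh: "(h has_real_derivative k * h t) (at t within {0..b})" if t: "0 \<le> t" "t \<le> b" for t b
  proof -
    have "((\<lambda>t. H (t + 1)) has_real_derivative h (t + 1) * 1) (at t within {0..b})"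
    proof (rule DERIV_image_chain[of H _ "\<lambda>t. t + 1" t "{0..b}" 1, unfolded comp_def])
      show "(H has_real_derivative h (t + 1)) (at (t + 1) within (\<lambda>t. t + 1) ` {0..b})"
        by (rule DERIV_subset[OF dH[of "t+1" "b+1"]]) (use t in auto)
    qed (auto intro!: derivative_eq_intros)
    then have "((\<lambda>t. (H (t + 1) - H t) / C) has_real_derivative (h (t + 1) - h t) / C) (at t within {0..b})"
      using dH[OF t] Cp by (auto intro!: derivative_eq_intros)
    moreover have "(h (t + 1) - h t) / C = k * h t"
      using t mult[of t 1] by (simp add: k_def field_simps)
    ultimately have "((\<lambda>t. (H (t + 1) - H t) / C) has_real_derivative k * h t) (at t within {0..b})"
      by simp
    then show ?thesis
      by (rule has_field_derivative_transform_within[where d=1]) (use t in \<open>auto simp: h_eq\<close>)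
  qed
  have h0: "h 0 = 1" using mult[of 0 0] pos[of 0] by simp
  have "h t = exp (k * t)" if t: "0 \<le> t" for t
  proof -
    have "\<exists>c. \<forall>s\<in>{0..t}. h s * exp (- (k * s)) = c"
    proof (rule has_field_derivative_zero_constant)
      fix s assume "s \<in> {0..t}"
      then show "((\<lambda>s. h s * exp (- (k * s))) has_real_derivative 0) (at s within {0..t})"
        using dh[of s t] by (auto intro!: derivative_eq_intros)
    qed simp
    then obtain c where c: "\<forall>s\<in>{0..t}. h s * exp (- (k * s)) = c" by auto
    have "h t * exp (- (k * t)) = c" "h 0 * exp (- (k * 0)) = c"
      using c[THEN bspec, of t] c[THEN bspec, of 0] t by simp_all
    then show ?thesis by (simp add: h0 exp_minus field_simps)
  qed
  then show ?thesis by (rule that)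
qed

lemma continuous_on_laplace_transform:
  fixes X :: "'a \<Rightarrow> real"
  assumes [measurable]: "X \<in> borel_measurable M" and fin: "finite_measure M"
    and int: "integrable M (\<lambda>x. exp (- (b * X x)))"
  shows "continuous_on {0..b} (\<lambda>a. \<integral>x. exp (- (a * X x)) \<partial>M)"
proof (rule continuous_on_sequentiallyI)
  interpret finite_measure M by fact
  fix u a assume u: "\<forall>n. u n \<in> {0..b}" and "a \<in> {0..b}" and lim: "u \<longlonglongrightarrow> a"
  show "(\<lambda>n. \<integral>x. exp (- (u n * X x)) \<partial>M) \<longlonglongrightarrow> (\<integral>x. exp (- (a * X x)) \<partial>M)"
  \<comment> \<open>The bound covers both signs: the integrand is at most 1 where \<open>X x\<close>
    is nonnegative and at most \<open>exp (- (b * X x))\<close> elsewhere.\<close>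
  proof (rule integral_dominated_convergence[where w="\<lambda>x. 1 + exp (- (b * X x))"])
    show "AE x in M. (\<lambda>n. exp (- (u n * X x))) \<longlonglongrightarrow> exp (- (a * X x))"
      using lim by (intro AE_I2 tendsto_intros)
    show "AE x in M. norm (exp (- (u n * X x))) \<le> 1 + exp (- (b * X x))" for n
    proof (rule AE_I2)
      fix x
      have u': "0 \<le> u n" "u n \<le> b" using u by auto
      show "norm (exp (- (u n * X x))) \<le> 1 + exp (- (b * X x))"
      proof (cases "0 \<le> X x")
        case True
        then show ?thesis using u' mult_nonneg_nonneg[OF u'(1) True] by (simp add: add_increasing2)
      next
        case False
        then have "b * X x \<le> u n * X x" using u' by (intro mult_right_mono_neg) auto
        then show ?thesis by (simp add: add_increasing)
      qed
    qed
  qed (use int in auto)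
qed

lemma continuous_on_laplace_transform_Ici:
  fixes X :: "'a \<Rightarrow> real"
  assumes "X \<in> borel_measurable M" and "finite_measure M"
    and int: "\<And>b. 0 \<le> b \<Longrightarrow> integrable M (\<lambda>x. exp (- b * X x))"
  shows "continuous_on {0..} (\<lambda>a. \<integral>x. exp (- a * X x) \<partial>M)"
  unfolding continuous_on_eq_continuous_within
proof
  fix a :: real assume a: "a \<in> {0..}"
  have "continuous_on {0..a + 1} (\<lambda>a. \<integral>x. exp (- (a * X x)) \<partial>M)"
    by (rule continuous_on_laplace_transform[OF assms(1,2)], rule int[of "a + 1", unfolded mult_minus_left])
       (use a in simp)
  moreover have "at a within {0..} = at a within {0..a + 1}"
    by (rule at_within_nhd[of _ "{..<a + 1}"]) (use a in auto)
  ultimately show "continuous (at a within {0..}) (\<lambda>a. \<integral>x. exp (- a * X x) \<partial>M)"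
    using a by (auto simp: continuous_on_eq_continuous_within continuous_within)
qed

text \<open>The sets need not be monotone in \<open>m\<close>, hence dominated convergence of their
  indicators instead of continuity of the measure.\<close>

lemma (in finite_measure) measure_tendsto_0:
  assumes [measurable]: "\<And>m. B m \<in> sets M"
    and ev: "AE x in M. eventually (\<lambda>m. x \<notin> B m) sequentially"
  shows "(\<lambda>m. measure M (B m)) \<longlonglongrightarrow> 0"
proof -
  have "(\<lambda>m. \<integral>x. indicator (B m) x \<partial>M) \<longlonglongrightarrow> (\<integral>x. (0::real) \<partial>M)"
  proof (rule integral_dominated_convergence[where w="\<lambda>_. 1"])
    show "AE x in M. (\<lambda>m. indicator (B m) x) \<longlonglongrightarrow> (0::real)"
      using ev
    proof eventually_elim
      fix x assume "\<forall>\<^sub>F m in sequentially. x \<notin> B m"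
      then show "(\<lambda>m. indicator (B m) x) \<longlonglongrightarrow> (0::real)"
        by (intro tendsto_eventually) (auto elim: eventually_mono)
    qed
  qed auto
  then show ?thesis by simp
qed

text \<open>The weights \<open>e * (1 - e) ^ n\<close> sum to 1 and each is at most
  \<open>e\<close>, so every fixed initial segment loses its mass as \<open>e\<close> tends to
  0.\<close>

lemma abel_mean_tendsto:
  fixes a :: "nat \<Rightarrow> real"
  assumes lim: "a \<longlonglongrightarrow> L"
  shows "((\<lambda>e. \<Sum>n. e * (1 - e) ^ n * a n) \<longlongrightarrow> L) (at_right 0)"
proof -
  obtain B where B: "\<And>n. \<bar>a n - L\<bar> \<le> B" "0 < B"
  proof -
    have "Bseq (\<lambda>n. a n - L)"
      using lim by (intro convergent_imp_Bseq convergentI[of _ 0]) (simp add: LIM_zero)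
    then show ?thesis using that unfolding Bseq_def by auto
  qed
  have geo: "(\<lambda>n. e * (1 - e) ^ n) sums 1" if "0 < e" "e < 1" for e :: real
    using sums_mult[OF geometric_sums[of "1 - e"], of e] that by simp
  have summ: "summable (\<lambda>n. e * (1 - e) ^ n * \<bar>a n - L\<bar>)" if e: "0 < e" "e < 1" for e :: real
    by (rule summable_comparison_test[OF _ summable_mult[OF sums_summable[OF geo[OF e]], of B]])
       (use e B in \<open>auto simp: abs_mult power_abs intro!: exI[of _ 0] mult_mono\<close>)
  have diff: "\<bar>(\<Sum>n. e * (1 - e) ^ n * a n) - L\<bar> \<le> (\<Sum>n. e * (1 - e) ^ n * \<bar>a n - L\<bar>)"
    if e: "0 < e" "e < 1" for e :: real
  proof -
    have ab: "\<bar>e * (1 - e) ^ n * (a n - L)\<bar> = e * (1 - e) ^ n * \<bar>a n - L\<bar>" for n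
      using e by (simp add: abs_mult power_abs)
    have s1: "summable (\<lambda>n. e * (1 - e) ^ n * (a n - L))"
      by (rule summable_rabs_cancel) (use summ[OF e] ab in simp)
    have s2: "(\<lambda>n. e * (1 - e) ^ n * L) sums (1 * L)" by (rule sums_mult2[OF geo[OF e]])
    have "(\<lambda>n. e * (1 - e) ^ n * (a n - L) + e * (1 - e) ^ n * L) sums
            ((\<Sum>n. e * (1 - e) ^ n * (a n - L)) + 1 * L)"
      by (rule sums_add[OF summable_sums[OF s1] s2])
    then have "(\<Sum>n. e * (1 - e) ^ n * a n) - L = (\<Sum>n. e * (1 - e) ^ n * (a n - L))"
      by (simp add: algebra_simps sums_iff)
    then show ?thesis using summable_rabs[of "\<lambda>n. e * (1 - e) ^ n * (a n - L)"] summ[OF e] ab by simp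
  qed
  show ?thesis
  proof (rule tendstoI)
    fix d :: real assume d: "0 < d"
    obtain N where N: "\<And>n. N \<le> n \<Longrightarrow> \<bar>a n - L\<bar> < d / 2"
      using LIMSEQ_D[OF lim, of "d/2"] d by auto
    \<comment> \<open>The first \<open>N\<close> terms cost at most \<open>real N * (e * B)\<close>;
      the summand 1 keeps the quotient meaningful for \<open>N = 0\<close>.\<close>
    define e0 where "e0 = min (1/2) (d / (2 * B * (real N + 1)))"
    have e0: "0 < e0" using d B by (auto simp: e0_def)
    have "dist (\<Sum>n. e * (1 - e) ^ n * a n) L < d" if e: "0 < e" "e < e0" for e
    proof -
      have e1: "e < 1" "e < d / (2 * B * (real N + 1))" using e by (auto simp: e0_def)
      have "(\<Sum>n. e * (1 - e) ^ n * \<bar>a n - L\<bar>) =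
          (\<Sum>n. e * (1 - e) ^ (n + N) * \<bar>a (n + N) - L\<bar>) + (\<Sum>n<N. e * (1 - e) ^ n * \<bar>a n - L\<bar>)"
        by (rule suminf_split_initial_segment[OF summ]) (use e e1 in auto)
      also have "(\<Sum>n<N. e * (1 - e) ^ n * \<bar>a n - L\<bar>) \<le> (\<Sum>n<N. e * B)"
      proof (rule sum_mono)
        fix n
        have "e * (1 - e) ^ n \<le> e * 1" using e e1 by (intro mult_left_mono power_le_one) auto
        then show "e * (1 - e) ^ n * \<bar>a n - L\<bar> \<le> e * B"
          using B e by (intro mult_mono) auto
      qed
      also have "(\<Sum>n. e * (1 - e) ^ (n + N) * \<bar>a (n + N) - L\<bar>) \<le> (\<Sum>n. e * (1 - e) ^ n * (d / 2))"
      proof (rule suminf_le)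
        show "summable (\<lambda>n. e * (1 - e) ^ (n + N) * \<bar>a (n + N) - L\<bar>)"
          using summable_ignore_initial_segment[OF summ] e e1 by auto
        show "summable (\<lambda>n. e * (1 - e) ^ n * (d / 2))"
          using geo e e1 by (intro summable_mult2) (auto simp: sums_iff)
        fix n
        have "(1 - e) ^ (n + N) \<le> (1 - e) ^ n" using e e1 by (intro power_decreasing) auto
        then show "e * (1 - e) ^ (n + N) * \<bar>a (n + N) - L\<bar> \<le> e * (1 - e) ^ n * (d / 2)"
          using N[of "n+N"] e e1 by (intro mult_mono mult_left_mono) auto
      qed
      also have "(\<Sum>n. e * (1 - e) ^ n * (d / 2)) = d / 2"
        using sums_mult2[OF geo, of e "d/2"] e e1 by (simp add: sums_iff)
      finally have "(\<Sum>n. e * (1 - e) ^ n * \<bar>a n - L\<bar>) \<le> d / 2 + real N * (e * B)" by simp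
      also have "real N * (e * B) \<le> (real N + 1) * (e * B)" using e B by (intro mult_right_mono) auto
      also have "(real N + 1) * (e * B) < d / 2"
        using e1(2) B by (simp add: pos_less_divide_eq mult_ac add_pos_nonneg)
      finally show ?thesis using diff[of e] e e1 by (simp add: dist_real_def)
    qed
    then show "\<forall>\<^sub>F e in at_right 0. dist (\<Sum>n. e * (1 - e) ^ n * a n) L < d"
      using e0 unfolding eventually_at_right_field by (intro exI[of _ e0]) auto
  qed
qed

text \<open>The real \<open>SUP\<close> has default values on empty and on unbounded sets. The
  supremum is therefore formed in the extended reals, and \<open>g\<close> translates it back,
  sending the two infinite values to these defaults.\<close>

lemma borel_measurable_SUP_real:
  fixes f :: "nat \<Rightarrow> 'a \<Rightarrow> real" and A :: "'a \<Rightarrow> nat set"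
  assumes [measurable]: "\<And>n. f n \<in> borel_measurable M" "\<And>n. Measurable.pred M (\<lambda>x. n \<in> A x)"
  shows "(\<lambda>x. SUP n\<in>A x. f n x) \<in> borel_measurable M"
proof -
  define E where "E x = (SUP n. if n \<in> A x then ereal (f n x) else -\<infinity>)" for x
  define g where "g e = (if e = \<infinity> then Sup UNIV else if e = -\<infinity> then Sup {} else real_of_ereal e)" for e
  have [measurable]: "E \<in> borel_measurable M" unfolding E_def by measurable
  have "(SUP n\<in>A x. f n x) = g (E x)" for x
  proof (cases "A x = {}")
    case True
    then show ?thesis by (simp add: E_def g_def)
  next
    case False
    then obtain n0 where n0: "n0 \<in> A x" by auto
    have lb: "ereal (f n0 x) \<le> E x" unfolding E_def using n0 by (intro SUP_upper2[of n0]) auto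
    show ?thesis
    proof (cases "bdd_above ((\<lambda>n. f n x) ` A x)")
      case True
      then obtain C where C: "\<And>n. n \<in> A x \<Longrightarrow> f n x \<le> C" by (auto simp: bdd_above_def)
      have ub: "E x \<le> ereal C" unfolding E_def using C by (intro SUP_least) auto
      have "ereal (SUP n\<in>A x. f n x) = E x"
      proof (rule antisym)
        obtain r where r: "E x = ereal r" using lb ub by (cases "E x") auto
        have "f n x \<le> r" if "n \<in> A x" for n
        proof -
          have "ereal (f n x) \<le> E x" unfolding E_def using that by (intro SUP_upper2[of n]) auto
          then show ?thesis by (simp add: r)
        qed
        then have "(SUP n\<in>A x. f n x) \<le> r" using False by (intro cSUP_least) auto
        then show "ereal (SUP n\<in>A x. f n x) \<le> E x" by (simp add: r)
        show "E x \<le> ereal (SUP n\<in>A x. f n x)"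
          unfolding E_def using True by (intro SUP_least) (auto intro: cSUP_upper)
      qed
      then show ?thesis by (auto simp: g_def simp flip: \<open>_ = E x\<close>)
    next
      case nb: False
      have "E x = \<infinity>"
      proof (rule ccontr)
        assume "E x \<noteq> \<infinity>"
        then obtain r where r: "E x = ereal r" using lb by (cases "E x") auto
        have "f n x \<le> r" if "n \<in> A x" for n
        proof -
          have "ereal (f n x) \<le> E x" unfolding E_def using that by (intro SUP_upper2[of n]) auto
          then show ?thesis by (simp add: r)
        qed
        then show False using nb by (auto simp: bdd_above_def)
      qed
      \<comment> \<open>For an unbounded set the predicate that describes its upper bounds is
        identically false, so all unbounded sets share one default value.\<close>
      moreover have "Sup S = Sup UNIV" if "\<not> bdd_above S" for S :: "real set"
      proof -
        have "(\<lambda>z. \<forall>x\<in>S. x \<le> z) = (\<lambda>z. \<forall>x\<in>UNIV. x \<le> z)"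
          using that gt_ex by (fastforce simp: bdd_above_def fun_eq_iff not_le)
        then show ?thesis unfolding Sup_real_def by simp
      qed
      ultimately show ?thesis using nb by (simp add: g_def)
    qed
  qed
  then have eq: "(\<lambda>x. SUP n\<in>A x. f n x) = (\<lambda>x. g (E x))" by auto
  show ?thesis unfolding eq g_def by measurable
qed

section \<open>Exponential times\<close>

definition expo :: "real \<Rightarrow> real measure" where
  "expo q = density lborel (\<lambda>t. ennreal (exponential_density q t))"

lemma sets_expo [simp, measurable_cong]: "sets (expo q) = sets borel"
  and space_expo [simp]: "space (expo q) = UNIV"
  by (simp_all add: expo_def)

lemma prob_space_expo: "0 < q \<Longrightarrow> prob_space (expo q)"
  unfolding expo_def by (rule prob_space_exponential_density)

lemma nn_integral_expo:
  "h \<in> borel_measurable borel \<Longrightarrow>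
    (\<integral>\<^sup>+t. h t \<partial>expo q) = (\<integral>\<^sup>+t. ennreal (exponential_density q t) * h t \<partial>lborel)"
  unfolding expo_def by (subst nn_integral_density) auto

lemma AE_expo_iff:
  assumes "0 < q"
  shows "(AE t in expo q. P t) \<longleftrightarrow> (AE t in lborel. 0 \<le> t \<longrightarrow> P t)"
  unfolding expo_def using assms
  by (subst AE_density) (auto simp: exponential_density_def intro!: AE_cong)

lemma AE_expo_pos: "0 < q \<Longrightarrow> AE t in expo q. 0 < t"
  by (simp add: AE_expo_iff, rule AE_mp[OF AE_lborel_singleton[of 0]]) (auto intro!: AE_I2)

lemma exponential_density_tilt:
  assumes "a < q"
  shows "exponential_density q t * exp (a * t) = q / (q - a) * exponential_density (q - a) t"
proof -
  have "exp (- t * q) * exp (a * t) = exp (- t * (q - a))"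
    by (simp add: exp_add[symmetric] algebra_simps)
  then show ?thesis using assms by (simp add: exponential_density_def)
qed

text \<open>Exponential tilting moves the rate from \<open>q\<close> to \<open>q - a\<close>. A
  negative \<open>a\<close> is allowed and acts as additional killing.\<close>

lemma nn_integral_expo_tilt:
  assumes "0 < q" "a < q" and [measurable]: "h \<in> borel_measurable borel"
  shows "(\<integral>\<^sup>+t. ennreal (exp (a * t)) * h t \<partial>expo q) = ennreal (q / (q - a)) * (\<integral>\<^sup>+t. h t \<partial>expo (q - a))"
proof -
  have nn: "0 \<le> exponential_density q t" "0 \<le> exponential_density (q - a) t" for t
    using assms by (simp_all add: exponential_density_nonneg)
  have pw: "ennreal (exponential_density q t) * ennreal (exp (a * t)) =
      ennreal (q / (q - a)) * ennreal (exponential_density (q - a) t)" for t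
    using assms nn exponential_density_tilt[OF assms(2), of t]
    by (simp only: ennreal_mult[symmetric] exp_ge_zero divide_nonneg_nonneg less_imp_le diff_gt_0_iff_gt)
  have "(\<integral>\<^sup>+t. ennreal (exp (a * t)) * h t \<partial>expo q) =
      (\<integral>\<^sup>+t. ennreal (q / (q - a)) * (ennreal (exponential_density (q - a) t) * h t) \<partial>lborel)"
    by (subst nn_integral_expo, simp) (simp only: mult.assoc[symmetric] pw)
  also have "\<dots> = ennreal (q / (q - a)) * (\<integral>\<^sup>+t. h t \<partial>expo (q - a))"
    by (subst nn_integral_cmult, measurable) (simp add: nn_integral_expo)
  finally show ?thesis .
qed

lemma nn_integral_expo_exp:
  assumes "0 < q" "a < q"
  shows "(\<integral>\<^sup>+t. ennreal (exp (a * t)) \<partial>expo q) = ennreal (q / (q - a))"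
  using nn_integral_expo_tilt[OF assms, of "\<lambda>_. 1"] assms
    prob_space.emeasure_space_1[OF prob_space_expo[of "q - a"]] by simp

text \<open>On the positive half-line the density times \<open>exp (a * t)\<close> does not fall
  below \<open>q\<close>.\<close>

lemma nn_integral_expo_exp_infinite:
  assumes "0 < q" "q \<le> a"
  shows "(\<integral>\<^sup>+t. ennreal (exp (a * t)) \<partial>expo q) = \<infinity>"
proof -
  have e: "(\<integral>\<^sup>+t. ennreal (exp (a * t)) \<partial>expo q) =
      (\<integral>\<^sup>+t. ennreal (exponential_density q t) * ennreal (exp (a * t)) \<partial>lborel)"
    by (rule nn_integral_expo) simp
  have "(\<integral>\<^sup>+t. ennreal q * indicator {0::real..} t \<partial>lborel) \<le> (\<integral>\<^sup>+t. ennreal (exp (a * t)) \<partial>expo q)"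
  unfolding e proof (rule nn_integral_mono)
    fix t :: real
    show "ennreal q * indicator {0..} t \<le> ennreal (exponential_density q t) * ennreal (exp (a * t))"
    proof (cases "0 \<le> t")
      case True
      have "exp (t * q) \<le> exp (a * t)" using True assms by (simp add: mult.commute mult_right_mono)
      then have "q \<le> q * exp (- t * q) * exp (a * t)"
        using assms by (simp add: exp_minus field_simps)
      then show ?thesis using True assms
        by (simp add: exponential_density_def ennreal_mult[symmetric] ennreal_leI)
    qed simp
  qed
  moreover have "emeasure lborel {0::real..} = \<infinity>"
  proof (rule ccontr)
    assume "\<not> emeasure lborel {0::real..} = \<infinity>"
    then obtain r where r: "emeasure lborel {0::real..} = ennreal r" "0 \<le> r"
      by (cases "emeasure lborel {0::real..}") auto
    have "emeasure lborel {0..r + 1} \<le> emeasure lborel {0::real..}"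
      by (rule emeasure_mono) auto
    then show False using r by simp
  qed
  then have "(\<integral>\<^sup>+t. ennreal q * indicator {0::real..} t \<partial>lborel) = \<infinity>"
    using assms by (simp add: nn_integral_cmult_indicator ennreal_mult_top)
  ultimately show ?thesis by (simp add: top_unique)
qed

text \<open>This is the lack of memory of the exponential law.\<close>

lemma nn_integral_expo_shift:
  assumes "0 < q" "0 \<le> s" and [measurable]: "h \<in> borel_measurable borel"
  shows "(\<integral>\<^sup>+t. indicator {s..} t * h (t - s) \<partial>expo q) = ennreal (exp (- q * s)) * (\<integral>\<^sup>+t. h t \<partial>expo q)"
proof -
  have "(\<integral>\<^sup>+t. indicator {s..} t * h (t - s) \<partial>expo q) =
      (\<integral>\<^sup>+t. ennreal (exponential_density q t) * (indicator {s..} t * h (t - s)) \<partial>lborel)"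
    by (rule nn_integral_expo) simp
  also have "\<dots> = (\<integral>\<^sup>+t. ennreal (exponential_density q (s + t)) * (indicator {s..} (s + t) * h t) \<partial>lborel)"
    by (subst nn_integral_real_affine[where c=1 and t=s]) auto
  also have "\<dots> = (\<integral>\<^sup>+t. ennreal (exp (- q * s)) * (ennreal (exponential_density q t) * h t) \<partial>lborel)"
  proof (rule nn_integral_cong)
    fix t
    show "ennreal (exponential_density q (s + t)) * (indicator {s..} (s + t) * h t) =
        ennreal (exp (- q * s)) * (ennreal (exponential_density q t) * h t)"
    proof (cases "0 \<le> t")
      case True
      have "exp (- (s + t) * q) = exp (- q * s) * exp (- t * q)"
        by (simp add: exp_add[symmetric] algebra_simps)
      then have "exponential_density q (s + t) = exp (- q * s) * exponential_density q t"
        using True assms by (simp add: exponential_density_def)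
      then show ?thesis
        using True assms by (simp add: ennreal_mult exponential_density_nonneg mult.assoc)
    qed (simp add: exponential_density_def)
  qed
  also have "\<dots> = ennreal (exp (- q * s)) * (\<integral>\<^sup>+t. h t \<partial>expo q)"
    by (subst nn_integral_cmult, measurable) (simp add: nn_integral_expo)
  finally show ?thesis .
qed

section \<open>Levy processes\<close>

text \<open>Right continuity makes \<open>Y\<close> the limit of processes that take, on each grid
  cell, the value at its right end point. \<open>N\<close> is arbitrary because both
  \<open>M\<close> and the sigma-algebra generated by the trajectory are used.\<close>

lemma cadlag_jointly_measurable:
  fixes Y :: "real \<Rightarrow> 'a \<Rightarrow> real"
  assumes Y: "\<And>t. 0 \<le> t \<Longrightarrow> Y t \<in> borel_measurable N"
    and cad: "\<And>x. x \<in> space N \<Longrightarrow> cadlag (\<lambda>t. Y t x)"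
  shows "(\<lambda>(t, x). Y (max 0 t) x) \<in> borel_measurable (borel \<Otimes>\<^sub>M N)"
proof -
  \<comment> \<open>\<open>Suc\<close> in the numerator puts the grid point strictly to the right of
    \<open>max 0 t\<close>, as the filter \<open>at_right\<close> demands.\<close>
  define d where "d n t = real (Suc (nat \<lfloor>max 0 t * real (Suc n)\<rfloor>)) / real (Suc n)" for n and t :: real
  have d: "max 0 t < d n t" "d n t \<le> max 0 t + 1 / real (Suc n)" for n t
  proof -
    have ps: "0 < real (Suc n)" and nz: "real (Suc n) \<noteq> 0" by simp_all
    have "real (nat \<lfloor>max 0 t * real (Suc n)\<rfloor>) = of_int \<lfloor>max 0 t * real (Suc n)\<rfloor>"
      by (simp add: of_nat_nat)
    then have "real (Suc (nat \<lfloor>max 0 t * real (Suc n)\<rfloor>)) = of_int \<lfloor>max 0 t * real (Suc n)\<rfloor> + 1" by simp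
    then have "max 0 t * real (Suc n) < real (Suc (nat \<lfloor>max 0 t * real (Suc n)\<rfloor>))"
      "real (Suc (nat \<lfloor>max 0 t * real (Suc n)\<rfloor>)) \<le> max 0 t * real (Suc n) + 1" by linarith+
    then show "max 0 t < d n t" "d n t \<le> max 0 t + 1 / real (Suc n)"
      unfolding d_def add_divide_eq_iff[OF nz] by (simp_all only: pos_less_divide_eq[OF ps] divide_right_mono[OF _ less_imp_le[OF ps]])
  qed
  show ?thesis
  proof (rule borel_measurable_LIMSEQ_real)
    fix n
    have "(\<lambda>p. (\<lambda>i p. Y (real (Suc i) / real (Suc n)) (snd p)) ((\<lambda>p. nat \<lfloor>max 0 (fst p) * real (Suc n)\<rfloor>) p) p)
       \<in> borel_measurable (borel \<Otimes>\<^sub>M N)"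
      by (rule measurable_compose_countable) (auto intro!: measurable_compose[OF measurable_snd] Y)
    then show "(\<lambda>(t::real, x). Y (d n t) x) \<in> borel_measurable (borel \<Otimes>\<^sub>M N)"
      by (simp add: d_def case_prod_unfold)
  next
    fix p :: "real \<times> 'a" assume "p \<in> space (borel \<Otimes>\<^sub>M N)"
    then obtain t :: real and x where p: "p = (t, x)" and x: "x \<in> space N" by (auto simp: space_pair_measure)
    have "(\<lambda>n. max 0 t + 1 / real (Suc n)) \<longlonglongrightarrow> max 0 t + 0"
      by (intro tendsto_intros LIMSEQ_Suc[OF lim_1_over_n])
    then have up: "(\<lambda>n. max 0 t + 1 / real (Suc n)) \<longlonglongrightarrow> max 0 t" by simp
    have lim: "(\<lambda>n. d n t) \<longlonglongrightarrow> max 0 t"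
      by (rule real_tendsto_sandwich[OF _ _ tendsto_const up])
         (intro always_eventually allI less_imp_le[OF d(1)] d(2))+
    have "filterlim (\<lambda>n. d n t) (at_right (max 0 t)) sequentially"
      using lim d(1)[of t] by (intro filterlim_at_withinI) (auto intro!: always_eventually simp: less_imp_neq)
    moreover have "((\<lambda>s. Y s x) \<longlongrightarrow> Y (max 0 t) x) (at_right (max 0 t))"
      using cad[OF x] unfolding cadlag_def continuous_within by auto
    ultimately show "(\<lambda>n. case p of (t, x) \<Rightarrow> Y (d n t) x) \<longlonglongrightarrow> (case p of (t, x) \<Rightarrow> Y (max 0 t) x)"
      unfolding p by (auto elim: filterlim_compose)
  qed
qed

locale levy = prob_space M for M :: "'a measure" +
  fixes Y :: "real \<Rightarrow> 'a \<Rightarrow> real"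
  assumes levy: "levy_process M Y"
begin

lemma Y_measurable: "0 \<le> t \<Longrightarrow> Y t \<in> borel_measurable M"
  using levy by (auto simp: levy_process_def)

lemma Y_cadlag: "x \<in> space M \<Longrightarrow> cadlag (\<lambda>t. Y t x)"
  using levy by (auto simp: levy_process_def)

text \<open>
  \<open>Y 0\<close> vanishes only almost surely and \<open>Y t\<close> is unconstrained for \<open>t < 0\<close>; the version \<open>X\<close>
  starts at 0 everywhere and is jointly measurable on all of \<open>\<real> \<times> M\<close>.
\<close>

definition X :: "real \<Rightarrow> 'a \<Rightarrow> real" where
  "X t x = Y (max 0 t) x - Y 0 x"

lemma X_0 [simp]: "X 0 x = 0"
  by (simp add: X_def)

lemma X_pair_measurable: "(\<lambda>(t, x). X t x) \<in> borel_measurable (borel \<Otimes>\<^sub>M M)"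
proof -
  have [measurable]: "(\<lambda>p. Y (max 0 (fst p)) (snd p)) \<in> borel_measurable (borel \<Otimes>\<^sub>M M)"
    using cadlag_jointly_measurable[of Y M] Y_measurable Y_cadlag by (simp add: case_prod_unfold)
  have [measurable]: "Y 0 \<in> borel_measurable M" by (rule Y_measurable) simp
  show ?thesis unfolding X_def case_prod_unfold by measurable
qed

lemma X_measurable_pair [measurable (raw)]:
  assumes "f \<in> borel_measurable N" "g \<in> measurable N M"
  shows "(\<lambda>z. X (f z) (g z)) \<in> borel_measurable N"
  using measurable_compose[OF measurable_Pair[OF assms] X_pair_measurable] by simp

lemma X_right_continuous:
  assumes "x \<in> space M" "0 \<le> t"
  shows "((\<lambda>s. X s x) \<longlongrightarrow> X t x) (at_right t)"
proof -
  have "((\<lambda>s. Y s x) \<longlongrightarrow> Y t x) (at_right t)"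
    using Y_cadlag[OF assms(1)] assms(2) unfolding cadlag_def continuous_within by auto
  then have "((\<lambda>s. Y s x - Y 0 x) \<longlongrightarrow> Y t x - Y 0 x) (at_right t)" by (intro tendsto_intros)
  moreover have "eventually (\<lambda>s. Y s x - Y 0 x = X s x) (at_right t)"
    using eventually_at_right_less[of t] by eventually_elim (use assms in \<open>auto simp: X_def\<close>)
  ultimately have "((\<lambda>s. X s x) \<longlongrightarrow> Y t x - Y 0 x) (at_right t)"
    by (rule Lim_transform_eventually)
  then show ?thesis using assms by (simp add: X_def)
qed

lemma AE_X_eq: "AE x in M. \<forall>t\<ge>0. X t x = Y t x"
proof -
  have "AE x in M. Y 0 x = 0" using levy by (auto simp: levy_process_def)
  then show ?thesis by eventually_elim (auto simp: X_def)
qed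

lemma X_increments_indep:
  fixes t :: "nat \<Rightarrow> real"
  assumes "0 \<le> t 0" "\<And>i. i < n \<Longrightarrow> t i \<le> t (Suc i)"
  shows "indep_vars (\<lambda>_. borel) (\<lambda>i x. X (t (Suc i)) x - X (t i) x) {..<n}"
proof -
  have t: "0 \<le> t i" if "i \<le> n" for i
    using that by (induction i) (use assms in \<open>auto intro: order_trans\<close>)
  have "indep_vars (\<lambda>_. borel) (\<lambda>i x. Y (t (Suc i)) x - Y (t i) x) {..<n}"
    using levy assms unfolding levy_process_def by blast
  then show ?thesis
    by (rule indep_vars_cong[THEN iffD1, rotated 3]) (use t in \<open>auto simp: X_def fun_eq_iff\<close>)
qed

lemma X_increment_distr:
  assumes "0 \<le> s" "0 \<le> h"
  shows "distr M borel (\<lambda>x. X (s + h) x - X s x) = distr M borel (X h)"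
proof -
  have "distr M borel (\<lambda>x. X (s + h) x - X s x) = distr M borel (\<lambda>x. Y (s + h) x - Y s x)"
    using assms by (intro distr_cong) (auto simp: X_def)
  also have "\<dots> = distr M borel (Y h)" using levy assms by (auto simp: levy_process_def)
  also have "\<dots> = distr M borel (X h)"
    using AE_X_eq assms Y_measurable[of h] by (intro distr_cong_AE) auto
  finally show ?thesis .
qed

lemma nn_integral_X_increment:
  assumes "0 \<le> s" "0 \<le> h" and [measurable]: "f \<in> borel_measurable borel"
  shows "(\<integral>\<^sup>+x. f (X (s + h) x - X s x) \<partial>M) = (\<integral>\<^sup>+x. f (X h x) \<partial>M)"
  using arg_cong[OF X_increment_distr[OF assms(1,2)], of "\<lambda>N. \<integral>\<^sup>+z. f z \<partial>N"]
  by (simp add: nn_integral_distr)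

text \<open>The increment after time \<open>s\<close> is independent of \<open>X s\<close>; it is
  represented by a second integration variable over the same space \<open>M\<close>.\<close>

lemma nn_integral_X_semigroup:
  assumes st: "0 \<le> s" "0 \<le> t" and f[measurable]: "f \<in> borel_measurable borel"
  shows "(\<integral>\<^sup>+x. f (X (s + t) x) \<partial>M) = (\<integral>\<^sup>+x. (\<integral>\<^sup>+y. f (X s x + X t y) \<partial>M) \<partial>M)"
proof -
  define u :: "nat \<Rightarrow> real" where "u i = (if i = 0 then 0 else if i = 1 then s else s + t)" for i
  have "indep_vars (\<lambda>_. borel) (\<lambda>i x. X (u (Suc i)) x - X (u i) x) {..<2}"
    by (rule X_increments_indep) (use st in \<open>auto simp: u_def\<close>)
  then have "indep_var (PiM {0} (\<lambda>_. borel)) (\<lambda>x. \<lambda>i\<in>{0}. X (u (Suc i)) x - X (u i) x)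
      (PiM {1} (\<lambda>_. borel)) (\<lambda>x. \<lambda>i\<in>{1}. X (u (Suc i)) x - X (u i) x)"
    by (rule indep_var_restrict) auto
  from indep_var_compose[OF this, of "\<lambda>w. w 0" borel "\<lambda>w. w 1" borel]
  have "indep_var borel (\<lambda>x. X (u (Suc 0)) x - X (u 0) x) borel (\<lambda>x. X (u (Suc 1)) x - X (u 1) x)"
    by (simp add: comp_def)
  then have ind: "indep_var borel (X s) borel (\<lambda>x. X (s + t) x - X s x)"
    by (simp add: u_def)
  have eq: "distr M borel (X s) \<Otimes>\<^sub>M distr M borel (X t) =
      distr M (borel \<Otimes>\<^sub>M borel) (\<lambda>x. (X s x, X (s + t) x - X s x))"
    using ind unfolding indep_var_distribution_eq X_increment_distr[OF st] by blast
  interpret T: prob_space "distr M borel (X t)" by (rule prob_space_distr) simp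
  have "(\<integral>\<^sup>+x. f (X (s + t) x) \<partial>M) =
      (\<integral>\<^sup>+p. f (fst p + snd p) \<partial>(distr M borel (X s) \<Otimes>\<^sub>M distr M borel (X t)))"
    unfolding eq by (subst nn_integral_distr) (auto simp: case_prod_unfold)
  also have "\<dots> = (\<integral>\<^sup>+x. (\<integral>\<^sup>+y. f (x + y) \<partial>distr M borel (X t)) \<partial>distr M borel (X s))"
    by (subst T.nn_integral_fst[symmetric]) auto
  also have "\<dots> = (\<integral>\<^sup>+x. (\<integral>\<^sup>+y. f (X s x + X t y) \<partial>M) \<partial>M)"
    by (simp add: nn_integral_distr)
  finally show ?thesis .
qed

end

section \<open>First passage on dyadic grids\<close>

definition dyad :: "nat \<Rightarrow> nat \<Rightarrow> real" where
  "dyad m k = real k / 2 ^ m"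

lemma dyad_nonneg [simp]: "0 \<le> dyad m k"
  by (simp add: dyad_def)

lemma dyad_mono: "j \<le> k \<Longrightarrow> dyad m j \<le> dyad m k"
  by (simp add: dyad_def divide_right_mono)

lemma dyad_less_iff: "dyad m j < dyad m k \<longleftrightarrow> j < k"
  by (simp add: dyad_def divide_less_cancel)

lemma dyad_refine: "m \<le> n \<Longrightarrow> dyad n (k * 2 ^ (n - m)) = dyad m k"
  by (simp add: dyad_def field_simps flip: power_add)

lemma dyad_dense:
  assumes "0 \<le> a" "a < b"
  shows "\<exists>m k. a < dyad m k \<and> dyad m k < b"
proof -
  obtain m where m: "(1/2) ^ m < b - a"
    using real_arch_pow_inv[of "b - a" "1/2"] assms by auto
  define k where "k = Suc (nat \<lfloor>a * 2 ^ m\<rfloor>)"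
  have k: "a * 2 ^ m < real k" "real k \<le> a * 2 ^ m + 1"
    using assms unfolding k_def by (simp_all add: of_nat_nat) linarith+
  have "a < dyad m k" using k(1) by (simp add: dyad_def field_simps)
  moreover have "dyad m k \<le> a + (1/2) ^ m" using k(2) by (simp add: dyad_def field_simps power_divide)
  ultimately show ?thesis using m by (intro exI[of _ m] exI[of _ k]) auto
qed

context levy
begin

lemma measurable_prob_section [measurable]:
  assumes [measurable]: "Measurable.pred (borel \<Otimes>\<^sub>M M) (\<lambda>p. P (fst p) (snd p))"
  shows "(\<lambda>t::real. emeasure M {x\<in>space M. P t x}) \<in> borel_measurable borel"
proof -
  have [measurable]: "Measurable.pred (borel \<Otimes>\<^sub>M M) (\<lambda>(t, x). P t x)"
    using assms by (simp add: case_prod_unfold)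
  have "(\<lambda>t::real. \<integral>\<^sup>+x. (if P t x then 1 else 0) \<partial>M) \<in> borel_measurable borel"
    by measurable
  moreover have "emeasure M {x\<in>space M. P t x} = (\<integral>\<^sup>+x. (if P t x then 1 else 0) \<partial>M)" for t
  proof -
    have [measurable]: "Measurable.pred M (P t)"
      using measurable_compose[OF measurable_Pair1'[of t borel M] assms] by simp
    have "(\<integral>\<^sup>+x. (if P t x then 1 else 0) \<partial>M) = (\<integral>\<^sup>+x. indicator {x\<in>space M. P t x} x \<partial>M)"
      by (rule nn_integral_cong) (simp add: indicator_def)
    then show ?thesis by simp
  qed
  ultimately show ?thesis by simp
qed

text \<open>This is \<open>q\<close> times the resolvent (potential) measure of the process.\<close>

definition mu :: "real \<Rightarrow> real measure" where
  "mu q = distr (expo q \<Otimes>\<^sub>M M) borel (\<lambda>(t, x). X t x)"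

lemma sets_mu [simp, measurable_cong]: "sets (mu q) = sets borel"
  and space_mu [simp]: "space (mu q) = UNIV"
  by (simp_all add: mu_def)

lemma prob_space_mu: "0 < q \<Longrightarrow> prob_space (mu q)"
  unfolding mu_def
  by (intro prob_space.prob_space_distr prob_space_pair prob_space_expo prob_space_axioms)
     (auto simp: case_prod_unfold)

lemma nn_integral_mu:
  assumes [measurable]: "h \<in> borel_measurable borel"
  shows "(\<integral>\<^sup>+z. h z \<partial>mu q) = (\<integral>\<^sup>+t. (\<integral>\<^sup>+x. h (X t x) \<partial>M) \<partial>expo q)"
  unfolding mu_def
  by (subst nn_integral_distr) (auto simp: nn_integral_fst[symmetric] case_prod_unfold)

lemma emeasure_mu:
  assumes [measurable]: "A \<in> sets borel"
  shows "emeasure (mu q) A = (\<integral>\<^sup>+t. emeasure M {x\<in>space M. X t x \<in> A} \<partial>expo q)"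
proof -
  have "emeasure (mu q) A = (\<integral>\<^sup>+z. indicator A z \<partial>mu q)" by simp
  also have "\<dots> = (\<integral>\<^sup>+t. (\<integral>\<^sup>+x. indicator A (X t x) \<partial>M) \<partial>expo q)"
    by (rule nn_integral_mu) simp
  also have "\<dots> = (\<integral>\<^sup>+t. emeasure M {x\<in>space M. X t x \<in> A} \<partial>expo q)"
  proof (rule nn_integral_cong)
    fix t
    have "(\<integral>\<^sup>+x. indicator A (X t x) \<partial>M) = (\<integral>\<^sup>+x. indicator {x\<in>space M. X t x \<in> A} x \<partial>M)"
      by (rule nn_integral_cong) (simp add: indicator_def)
    then show "(\<integral>\<^sup>+x. indicator A (X t x) \<partial>M) = emeasure M {x\<in>space M. X t x \<in> A}" by simp
  qed
  finally show ?thesis .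
qed

text \<open>
  First passage times below \<open>- z\<close> are only used through their approximations on dyadic grids,
  so that independence of increments at deterministic times replaces the strong Markov property:
  on \<open>hit z m k\<close> the level is first crossed, on the grid of mesh \<open>1 / 2 ^ m\<close>, at the \<open>k\<close>-th point.
\<close>

definition hit :: "real \<Rightarrow> nat \<Rightarrow> nat \<Rightarrow> 'a set" where
  "hit z m k = {x\<in>space M. X (dyad m k) x < - z \<and> (\<forall>j<k. - z \<le> X (dyad m j) x)}"

lemma sets_hit [measurable]: "hit z m k \<in> sets M"
  unfolding hit_def by measurable

lemma disjoint_hit: "disjoint_family (hit z m)"
proof (unfold disjoint_family_on_def, intro ballI impI)
  fix i j :: nat assume "i \<noteq> j"
  then show "hit z m i \<inter> hit z m j = {}"
    by (cases i j rule: linorder_cases) (force simp: hit_def)+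
qed

lemma hit_exists:
  assumes "x \<in> space M" "X (dyad m k) x < - z"
  obtains j where "j \<le> k" "x \<in> hit z m j"
proof
  show "(LEAST j. X (dyad m j) x < - z) \<le> k" using assms(2) by (rule Least_le)
  have "X (dyad m (LEAST j. X (dyad m j) x < - z)) x < - z" using assms(2) by (rule LeastI)
  then show "x \<in> hit z m (LEAST j. X (dyad m j) x < - z)"
    using assms(1) by (auto simp: hit_def not_less dest: not_less_Least)
qed

lemma suminf_emeasure_hit: "(\<Sum>k. emeasure M (hit z m k \<inter> A)) \<le> emeasure M A" if [measurable]: "A \<in> sets M"
proof -
  have "(\<Sum>k. emeasure M (hit z m k \<inter> A)) = emeasure M (\<Union>k. hit z m k \<inter> A)"
    using disjoint_hit[of z m] by (intro suminf_emeasure) (auto simp: disjoint_family_on_def)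
  also have "\<dots> \<le> emeasure M A" by (rule emeasure_mono) auto
  finally show ?thesis .
qed

text \<open>Whether the first crossing is at point \<open>k\<close> is decided by the first
  \<open>k\<close> grid increments. The increment that follows is one more increment over the same
  deterministic partition, hence independent of them.\<close>

lemma hit_markov:
  assumes s: "0 \<le> s"
  shows "emeasure M {x\<in>hit z m k. X (dyad m k + s) x - X (dyad m k) x < u} =
    emeasure M (hit z m k) * emeasure M {x\<in>space M. X s x < u}"
proof -
  define t where "t i = (if i \<le> k then dyad m i else dyad m k + s)" for i
  define W where "W = (\<lambda>i x. X (t (Suc i)) x - X (t i) x)"
  define P where "P = {w\<in>space (PiM {..<k} (\<lambda>_. borel)). (\<Sum>i<k. w i) < - z \<and> (\<forall>j<k. - z \<le> (\<Sum>i<j. w i :: real))}"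
  have "indep_vars (\<lambda>_. borel) W {..<Suc k}"
    unfolding W_def
  proof (rule X_increments_indep)
    show "t i \<le> t (Suc i)" if "i < Suc k" for i
      using s that by (cases "i = k") (auto simp: t_def dyad_mono)
  qed (simp add: t_def)
  then have ind: "indep_var (PiM {..<k} (\<lambda>_. borel)) (\<lambda>x. \<lambda>i\<in>{..<k}. W i x) (PiM {k} (\<lambda>_. borel)) (\<lambda>x. \<lambda>i\<in>{k}. W i x)"
    by (rule indep_var_restrict) auto
  have [measurable]: "P \<in> sets (PiM {..<k} (\<lambda>_. borel))"
  proof -
    have m: "(\<lambda>w. \<Sum>i<j. w i :: real) \<in> borel_measurable (PiM {..<k} (\<lambda>_. borel))" if "j \<le> k" for j
      using that by (intro borel_measurable_sum) (auto intro!: measurable_component_singleton)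
    have "P = {w\<in>space (PiM {..<k} (\<lambda>_. borel)). (\<Sum>i<k. w i) < - z} \<inter>
      {w\<in>space (PiM {..<k} (\<lambda>_. borel)). \<forall>j\<in>{..<k}. - z \<le> (\<Sum>i<j. w i :: real)}" by (auto simp: P_def)
    also have "\<dots> \<in> sets (PiM {..<k} (\<lambda>_. borel))"
    proof (intro sets.Int sets.sets_Collect_finite_All finite_lessThan)
      show "{w\<in>space (PiM {..<k} (\<lambda>_. borel)). (\<Sum>i<k. w i) < - z} \<in> sets (PiM {..<k} (\<lambda>_. borel))"
        by (intro borel_measurable_less m) simp_all
      show "{w\<in>space (PiM {..<k} (\<lambda>_. borel)). - z \<le> (\<Sum>i<j. w i)} \<in> sets (PiM {..<k} (\<lambda>_. borel))"
        if "j \<in> {..<k}" for j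
        using that by (intro borel_measurable_le m) simp_all
    qed
    finally show ?thesis .
  qed
  let ?Q = "{w\<in>space (PiM {k} (\<lambda>_. borel)). (w k :: real) < u}"
  have tele: "(\<Sum>i<j. W i x) = X (dyad m j) x" if "j \<le> k" for j x
    using that
  proof (induction j)
    case 0 then show ?case by (simp add: dyad_def)
  next
    case (Suc j) then show ?case by (simp add: W_def t_def)
  qed
  have Wk: "W k x = X (dyad m k + s) x - X (dyad m k) x" for x
    by (simp add: W_def t_def)
  have tele': "(\<Sum>i<j. (\<lambda>i\<in>{..<k}. W i x) i) = X (dyad m j) x" if "j \<le> k" for j x
  proof -
    have "(\<Sum>i<j. (\<lambda>i\<in>{..<k}. W i x) i) = (\<Sum>i<j. W i x)"
      using that by (intro sum.cong) auto
    then show ?thesis using tele[OF that] by simp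
  qed
  have sp: "(\<lambda>i\<in>{..<k}. W i x) \<in> space (PiM {..<k} (\<lambda>_. borel))" for x
    unfolding space_PiM by (rule restrict_PiE_iff[THEN iffD2]) simp
  have 1: "(\<lambda>x. \<lambda>i\<in>{..<k}. W i x) -` P \<inter> space M = hit z m k"
  proof (rule set_eqI)
    fix x
    have "(\<forall>j<k. - z \<le> (\<Sum>i<j. (\<lambda>i\<in>{..<k}. W i x) i)) \<longleftrightarrow> (\<forall>j<k. - z \<le> X (dyad m j) x)"
      using tele'[OF less_imp_le] by (metis (no_types, lifting))
    then show "x \<in> (\<lambda>x. \<lambda>i\<in>{..<k}. W i x) -` P \<inter> space M \<longleftrightarrow> x \<in> hit z m k"
      unfolding P_def hit_def vimage_def Int_iff mem_Collect_eq tele'[OF order_refl] using sp by blast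
  qed
  have 2: "(\<lambda>x. \<lambda>i\<in>{k}. W i x) -` ?Q \<inter> space M = {x\<in>space M. X (dyad m k + s) x - X (dyad m k) x < u}"
    by (auto simp: space_PiM Wk)
  have "prob ((\<lambda>x. (\<lambda>i\<in>{..<k}. W i x, \<lambda>i\<in>{k}. W i x)) -` (P \<times> ?Q) \<inter> space M) =
      prob ((\<lambda>x. \<lambda>i\<in>{..<k}. W i x) -` P \<inter> space M) * prob ((\<lambda>x. \<lambda>i\<in>{k}. W i x) -` ?Q \<inter> space M)"
    by (rule indep_varD[OF ind]) measurable
  then have "prob ((\<lambda>x. (\<lambda>i\<in>{..<k}. W i x, \<lambda>i\<in>{k}. W i x)) -` (P \<times> ?Q) \<inter> space M) =
      prob (hit z m k) * prob {x\<in>space M. X (dyad m k + s) x - X (dyad m k) x < u}"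
    unfolding 1 2 .
  also have "(\<lambda>x. (\<lambda>i\<in>{..<k}. W i x, \<lambda>i\<in>{k}. W i x)) -` (P \<times> ?Q) \<inter> space M =
      ((\<lambda>x. \<lambda>i\<in>{..<k}. W i x) -` P \<inter> space M) \<inter> ((\<lambda>x. \<lambda>i\<in>{k}. W i x) -` ?Q \<inter> space M)"
    by auto
  also have "\<dots> = {x\<in>hit z m k. X (dyad m k + s) x - X (dyad m k) x < u}"
    unfolding 1 2 by (auto simp: hit_def)
  also have "prob {x\<in>space M. X (dyad m k + s) x - X (dyad m k) x < u} = prob {x\<in>space M. X s x < u}"
  proof -
    have "measure (distr M borel (\<lambda>x. X (dyad m k + s) x - X (dyad m k) x)) {..<u} =
        measure (distr M borel (X s)) {..<u}"
      by (simp add: X_increment_distr s)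
    then show ?thesis
      by (simp add: measure_distr vimage_def Int_def conj_commute)
  qed
  finally show ?thesis
    by (simp add: emeasure_eq_measure ennreal_mult)
qed

text \<open>The Laplace transform at \<open>q\<close> of the first passage time below
  \<open>- z\<close> on the grid, paths without a crossing counting 0. Equivalently, the probability
  that the crossing precedes an independent exponential time of rate \<open>q\<close>.\<close>

definition R :: "real \<Rightarrow> real \<Rightarrow> nat \<Rightarrow> ennreal" where
  "R q z m = (\<Sum>k. ennreal (exp (- q * dyad m k)) * emeasure M (hit z m k))"

text \<open>After the crossing the remaining exponential time is exponential again, and by
  \<open>hit_markov\<close> the further increment is independent of the past. So the product is the
  probability of crossing before the exponential time and being displaced by less than
  \<open>u\<close> from there on.\<close>

lemma R_expand:
  assumes q: "0 < q"
  shows "R q z m * emeasure (mu q) {..<u} = (\<integral>\<^sup>+t. (\<Sum>k. indicator {dyad m k..} t *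
    emeasure M {x\<in>hit z m k. X t x - X (dyad m k) x < u}) \<partial>expo q)"
proof -
  let ?p = "\<lambda>t. emeasure M {x\<in>space M. X t x < u}"
  have "(\<integral>\<^sup>+t. (\<Sum>k. indicator {dyad m k..} t * emeasure M {x\<in>hit z m k. X t x - X (dyad m k) x < u}) \<partial>expo q)
     = (\<integral>\<^sup>+t. (\<Sum>k. emeasure M (hit z m k) * (indicator {dyad m k..} t * ?p (t - dyad m k))) \<partial>expo q)"
  proof (intro nn_integral_cong suminf_cong)
    fix t k
    show "indicator {dyad m k..} t * emeasure M {x\<in>hit z m k. X t x - X (dyad m k) x < u} =
      emeasure M (hit z m k) * (indicator {dyad m k..} t * ?p (t - dyad m k))"
      using hit_markov[of "t - dyad m k" z m k u] by (simp add: indicator_def)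
  qed
  also have "\<dots> = (\<Sum>k. \<integral>\<^sup>+t. emeasure M (hit z m k) * (indicator {dyad m k..} t * ?p (t - dyad m k)) \<partial>expo q)"
    by (rule nn_integral_suminf) measurable
  also have "\<dots> = (\<Sum>k. emeasure M (hit z m k) * (\<integral>\<^sup>+t. indicator {dyad m k..} t * ?p (t - dyad m k) \<partial>expo q))"
    by (intro suminf_cong nn_integral_cmult) measurable
  also have "\<dots> = (\<Sum>k. ennreal (exp (- q * dyad m k)) * emeasure M (hit z m k) * (\<integral>\<^sup>+t. ?p t \<partial>expo q))"
    by (intro suminf_cong, subst nn_integral_expo_shift) (auto simp: q mult_ac)
  also have "\<dots> = R q z m * (\<integral>\<^sup>+t. ?p t \<partial>expo q)" unfolding R_def by simp
  finally show ?thesis by (simp add: emeasure_mu)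
qed

text \<open>The path at its grid crossing is below \<open>- z\<close>, so a further fall by more
  than \<open>y\<close> ends below \<open>- (z + y)\<close>. This direction has no error
  term.\<close>

lemma R_lower:
  assumes q: "0 < q"
  shows "R q z m * emeasure (mu q) {..<- y} \<le> emeasure (mu q) {..<- (z + y)}"
  unfolding R_expand[OF q] unfolding emeasure_mu[OF borel_open[OF open_lessThan]]
proof (rule nn_integral_mono)
  fix t
  have "(\<Sum>k. indicator {dyad m k..} t * emeasure M {x\<in>hit z m k. X t x - X (dyad m k) x < - y})
      \<le> (\<Sum>k. emeasure M (hit z m k \<inter> {x\<in>space M. X t x \<in> {..<- (z + y)}}))"
    by (intro suminf_le) (auto simp: indicator_def hit_def intro!: emeasure_mono)
  also have "\<dots> \<le> emeasure M {x\<in>space M. X t x \<in> {..<- (z + y)}}"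
    by (rule suminf_emeasure_hit) measurable
  finally show "(\<Sum>k. indicator {dyad m k..} t * emeasure M {x\<in>hit z m k. X t x - X (dyad m k) x < - y})
    \<le> emeasure M {x\<in>space M. X t x \<in> {..<- (z + y)}}" .
qed

text \<open>
  The two ways in which the grid can fail to witness a passage at exactly \<open>- z\<close>. Both become
  negligible as the mesh tends to 0, because there are no downward jumps.
\<close>

definition overshoot :: "real \<Rightarrow> real \<Rightarrow> nat \<Rightarrow> 'a set" where
  "overshoot z e m = (\<Union>k. {x\<in>hit z m k. X (dyad m k) x < - z - e})"

definition late :: "real \<Rightarrow> nat \<Rightarrow> real \<Rightarrow> 'a set" where
  "late z m t = {x\<in>space M. X t x < - z \<and> (\<forall>k. dyad m k \<le> t \<longrightarrow> - z \<le> X (dyad m k) x)}"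

lemma sets_overshoot [measurable]: "overshoot z e m \<in> sets M"
  unfolding overshoot_def by measurable

text \<open>A path that ends below \<open>- (z + y)\<close> is late, or overshoots by more than
  \<open>e\<close> at its crossing, or falls by more than \<open>y - e\<close> after the crossing.
  Nonnegativity of \<open>y\<close> ensures that such a path ends below \<open>- z\<close> at
  all.\<close>

lemma R_upper:
  assumes q: "0 < q" and y: "0 \<le> y"
  shows "emeasure (mu q) {..<- (z + y)} \<le> R q z m * emeasure (mu q) {..<- (y - e)} +
    (emeasure M (overshoot z e m) + (\<integral>\<^sup>+t. emeasure M (late z m t) \<partial>expo q))"
proof -
  let ?s = "\<lambda>t k. {x\<in>hit z m k. X t x - X (dyad m k) x < - (y - e)}"
  let ?S = "\<lambda>t. \<Union>k. (if dyad m k \<le> t then ?s t k else {})"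
  have [measurable]: "(\<lambda>t. emeasure M (late z m t)) \<in> borel_measurable borel"
    unfolding late_def by measurable
  have [measurable]: "(\<lambda>t. emeasure M (?s t k)) \<in> borel_measurable borel" for k
  proof -
    have "?s t k = {x\<in>space M. x \<in> hit z m k \<and> X t x - X (dyad m k) x < - (y - e)}" for t
      by (auto simp: hit_def)
    then show ?thesis by simp
  qed
  have "emeasure (mu q) {..<- (z + y)} \<le> (\<integral>\<^sup>+t. (\<Sum>k. indicator {dyad m k..} t * emeasure M (?s t k)) +
      (emeasure M (overshoot z e m) + emeasure M (late z m t)) \<partial>expo q)"
    unfolding emeasure_mu[OF borel_open[OF open_lessThan]]
  proof (rule nn_integral_mono)
    fix t
    have [measurable]: "late z m t \<in> sets M" unfolding late_def by measurable
    have sm: "(if dyad m k \<le> t then ?s t k else {}) \<in> sets M" for k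
    proof -
      have "?s t k \<in> sets M" by measurable
      then show ?thesis by simp
    qed
    then have rng: "range (\<lambda>k. if dyad m k \<le> t then ?s t k else {}) \<subseteq> sets M" by blast
    have [measurable]: "?S t \<in> sets M" by (rule sets.countable_UN[OF rng])
    have "{x\<in>space M. X t x \<in> {..<- (z + y)}} \<subseteq> ?S t \<union> (overshoot z e m \<union> late z m t)"
    proof
      fix x assume "x \<in> {x\<in>space M. X t x \<in> {..<- (z + y)}}"
      then have x: "x \<in> space M" "X t x < - (z + y)" by auto
      show "x \<in> ?S t \<union> (overshoot z e m \<union> late z m t)"
      proof (cases "\<exists>k. dyad m k \<le> t \<and> X (dyad m k) x < - z")
        case False
        then have "x \<in> late z m t" using x y by (auto simp: late_def not_less)
        then show ?thesis by simp
      next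
        case True
        then obtain k where "dyad m k \<le> t" "X (dyad m k) x < - z" by auto
        with hit_exists[OF x(1) this(2)] obtain j where j: "j \<le> k" "x \<in> hit z m j" by auto
        have jt: "dyad m j \<le> t" using dyad_mono[OF j(1), of m] \<open>dyad m k \<le> t\<close> by simp
        show ?thesis
        proof (cases "X (dyad m j) x < - z - e")
          case True
          then have "x \<in> overshoot z e m" using j by (auto simp: overshoot_def)
          then show ?thesis by simp
        next
          case False
          then have "x \<in> ?s t j" using j x by auto
          then have "x \<in> ?S t" using jt by (intro UN_I[of j]) auto
          then show ?thesis by simp
        qed
      qed
    qed
    then have "emeasure M {x\<in>space M. X t x \<in> {..<- (z + y)}} \<le> emeasure M (?S t \<union> (overshoot z e m \<union> late z m t))"
      by (intro emeasure_mono) measurable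
    also have "\<dots> \<le> emeasure M (?S t) + emeasure M (overshoot z e m \<union> late z m t)"
      by (intro emeasure_subadditive) auto
    also have "\<dots> \<le> (\<Sum>k. emeasure M (if dyad m k \<le> t then ?s t k else {})) +
        (emeasure M (overshoot z e m) + emeasure M (late z m t))"
    proof (rule add_mono)
      show "emeasure M (?S t) \<le> (\<Sum>k. emeasure M (if dyad m k \<le> t then ?s t k else {}))"
        by (rule emeasure_subadditive_countably[OF rng])
      show "emeasure M (overshoot z e m \<union> late z m t) \<le> emeasure M (overshoot z e m) + emeasure M (late z m t)"
        by (rule emeasure_subadditive) auto
    qed
    also have "(\<Sum>k. emeasure M (if dyad m k \<le> t then ?s t k else {})) = (\<Sum>k. indicator {dyad m k..} t * emeasure M (?s t k))"
      by (intro suminf_cong) (auto simp: indicator_def)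
    finally show "emeasure M {x\<in>space M. X t x \<in> {..<- (z + y)}} \<le> (\<Sum>k. indicator {dyad m k..} t * emeasure M (?s t k)) +
      (emeasure M (overshoot z e m) + emeasure M (late z m t))" .
  qed
  also have "\<dots> = R q z m * emeasure (mu q) {..<- (y - e)} +
    (emeasure M (overshoot z e m) + (\<integral>\<^sup>+t. emeasure M (late z m t) \<partial>expo q))"
    unfolding R_expand[OF q]
    using prob_space.emeasure_space_1[OF prob_space_expo[OF q]]
    by (simp add: nn_integral_add del: minus_diff_eq)
  finally show ?thesis .
qed

text \<open>Crossings from time \<open>d\<close> on carry a factor of at most
  \<open>exp (- q * d)\<close>, earlier ones are counted in full. With \<open>d = 0\<close> this
  shows that \<open>R\<close> is finite; with small \<open>d\<close> and large \<open>q\<close> it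
  shows that \<open>R\<close> is small.\<close>

lemma R_le:
  assumes q: "0 < q" and d: "0 \<le> d"
  shows "R q z m \<le> ennreal (exp (- q * d)) +
    emeasure M {x\<in>space M. \<exists>m k. dyad m k < d \<and> X (dyad m k) x < - z}" (is "_ \<le> _ + emeasure M ?D")
proof -
  have [measurable]: "?D \<in> sets M" by measurable
  have "R q z m \<le> (\<Sum>k. ennreal (exp (- q * d)) * emeasure M (hit z m k \<inter> space M) + emeasure M (hit z m k \<inter> ?D))"
    unfolding R_def
  proof (intro suminf_le)
    fix k
    show "ennreal (exp (- q * dyad m k)) * emeasure M (hit z m k) \<le>
      ennreal (exp (- q * d)) * emeasure M (hit z m k \<inter> space M) + emeasure M (hit z m k \<inter> ?D)"
    proof (cases "dyad m k < d")
      case True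
      then have "hit z m k \<inter> ?D = hit z m k" by (auto simp: hit_def)
      moreover have "ennreal (exp (- q * dyad m k)) \<le> 1" using q by simp
      then have "ennreal (exp (- q * dyad m k)) * emeasure M (hit z m k) \<le> 1 * emeasure M (hit z m k)"
        by (intro mult_right_mono) auto
      ultimately show ?thesis by (simp add: add_increasing)
    next
      case False
      have "hit z m k \<inter> space M = hit z m k" by (auto simp: hit_def)
      then show ?thesis using False q
        by (intro add_increasing2 mult_mono ennreal_leI) auto
    qed
  qed auto
  also have "\<dots> = ennreal (exp (- q * d)) * (\<Sum>k. emeasure M (hit z m k \<inter> space M)) + (\<Sum>k. emeasure M (hit z m k \<inter> ?D))"
    by (simp add: suminf_add[symmetric])
  also have "\<dots> \<le> ennreal (exp (- q * d)) * emeasure M (space M) + emeasure M ?D"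
    by (intro add_mono mult_left_mono suminf_emeasure_hit) auto
  finally show ?thesis by (simp add: emeasure_space_1)
qed

end

section \<open>The exponential lower tail\<close>

locale spectrally_positive_levy = levy M Y for M :: "'a measure" and Y +
  assumes sp: "spectrally_positive M Y"
    and nonmono: "\<not> (AE x in M. mono_on {0..} (\<lambda>t. Y t x))"
begin

text \<open>The form in which spectral positivity is used: a lower bound at all dyadic times before
  \<open>t\<close> persists at \<open>t\<close>. It speaks of grid values because passages are only
  observed on grids.\<close>

definition no_down_jump :: "'a \<Rightarrow> bool" where
  "no_down_jump x \<longleftrightarrow> (\<forall>t>0. \<forall>c. (\<forall>m k. dyad m k < t \<longrightarrow> c \<le> X (dyad m k) x) \<longrightarrow> c \<le> X t x)"

text \<open>If \<open>X t x < c\<close>, the left limit at \<open>t\<close> is below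
  \<open>c\<close> too, and then so is the path at some dyadic time shortly before
  \<open>t\<close>.\<close>

lemma AE_no_down_jump: "AE x in M. no_down_jump x"
proof -
  have "AE x in M. \<forall>t>0. Lim (at_left t) (\<lambda>s. Y s x) \<le> Y t x"
    using sp by (simp add: spectrally_positive_def)
  moreover have "AE x in M. x \<in> space M" by (rule AE_space)
  ultimately show ?thesis
  proof eventually_elim
    fix x assume L: "\<forall>t>0. Lim (at_left t) (\<lambda>s. Y s x) \<le> Y t x" and x: "x \<in> space M"
    show "no_down_jump x" unfolding no_down_jump_def
    proof (intro allI impI, rule ccontr)
      fix t c assume t: "0 < t" and D: "\<forall>m k. dyad m k < t \<longrightarrow> c \<le> X (dyad m k) x" and "\<not> c \<le> X t x"
      then have c: "X t x < c" by simp
      obtain l where l: "((\<lambda>s. Y s x) \<longlongrightarrow> l) (at_left t)"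
        using Y_cadlag[OF x] t unfolding cadlag_def by auto
      have "Lim (at_left t) (\<lambda>s. Y s x) = l" by (rule tendsto_Lim[OF _ l]) simp
      then have "l \<le> Y t x" using L t by auto
      then have "l < c + Y 0 x" using c t by (simp add: X_def)
      then have "eventually (\<lambda>s. Y s x < c + Y 0 x) (at_left t)" by (rule order_tendstoD(2)[OF l])
      then obtain b where b: "b < t" "\<And>s. b < s \<Longrightarrow> s < t \<Longrightarrow> Y s x < c + Y 0 x"
        unfolding eventually_at_left_field by auto
      obtain m k where mk: "max 0 b < dyad m k" "dyad m k < t"
        using dyad_dense[of "max 0 b" t] b t by auto
      then have "X (dyad m k) x < c" using b(2)[of "dyad m k"] by (simp add: X_def)
      then show False using D mk by force
    qed
  qed
qed

lemma right_limit_less: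
  assumes x: "x \<in> space M" and t: "0 \<le> t" and c: "X t x < c"
  obtains b where "t < b" "\<And>s. t \<le> s \<Longrightarrow> s < b \<Longrightarrow> X s x < c"
proof -
  have "eventually (\<lambda>s. X s x < c) (at_right t)"
    by (rule order_tendstoD(2)[OF X_right_continuous[OF x t] c])
  then obtain b where b: "t < b" "\<And>s. t < s \<Longrightarrow> s < b \<Longrightarrow> X s x < c"
    unfolding eventually_at_right_field by auto
  show ?thesis by (rule that[OF b(1)]) (use b c in \<open>metis order_le_less\<close>)
qed

lemma right_limit_greater:
  assumes x: "x \<in> space M" and t: "0 \<le> t" and c: "c < X t x"
  obtains b where "t < b" "\<And>s. t \<le> s \<Longrightarrow> s < b \<Longrightarrow> c < X s x"
proof -
  have "eventually (\<lambda>s. c < X s x) (at_right t)"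
    by (rule order_tendstoD(1)[OF X_right_continuous[OF x t] c])
  then obtain b where b: "t < b" "\<And>s. t < s \<Longrightarrow> s < b \<Longrightarrow> c < X s x"
    unfolding eventually_at_right_field by auto
  show ?thesis by (rule that[OF b(1)]) (use b c in \<open>metis order_le_less\<close>)
qed

text \<open>The grids are nested, so a crossing on a coarse grid is seen on every finer one.\<close>

lemma hit_before:
  assumes "m0 \<le> m" "X (dyad m0 k0) x < - z" "x \<in> hit z m k"
  shows "dyad m k \<le> dyad m0 k0"
proof (rule ccontr)
  assume "\<not> dyad m k \<le> dyad m0 k0"
  then have "dyad m (k0 * 2 ^ (m - m0)) < dyad m k" using dyad_refine[OF assms(1)] by simp
  then have "- z \<le> X (dyad m (k0 * 2 ^ (m - m0))) x"
    using assms(3) by (auto simp: hit_def dyad_less_iff)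
  then show False using assms(2) dyad_refine[OF assms(1)] by simp
qed

text \<open>At the infimum \<open>\<tau>\<close> of the dyadic passage times the path is still at
  least \<open>- z\<close>, and right continuity keeps it above \<open>- z - e\<close> on an
  interval after \<open>\<tau>\<close>. All sufficiently fine grids cross within that
  interval.\<close>

lemma overshoot_tendsto_0:
  assumes z: "0 \<le> z" and e: "0 < e"
  shows "(\<lambda>m. prob (overshoot z e m)) \<longlonglongrightarrow> 0"
proof (rule measure_tendsto_0)
  show "AE x in M. \<forall>\<^sub>F m in sequentially. x \<notin> overshoot z e m"
    using AE_no_down_jump AE_space
  proof eventually_elim
    fix x assume nd: "no_down_jump x" and x: "x \<in> space M"
    show "\<forall>\<^sub>F m in sequentially. x \<notin> overshoot z e m"
    proof (cases "\<exists>m k. X (dyad m k) x < - z")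
      case False
      then show ?thesis by (auto simp: overshoot_def hit_def)
    next
      case True
      define S where "S = {s. \<exists>m k. s = dyad m k \<and> X (dyad m k) x < - z}"
      define \<tau> where "\<tau> = Inf S"
      have S: "S \<noteq> {}" "bdd_below S" using True by (auto simp: S_def intro!: bdd_belowI[of _ 0])
      have \<tau>0: "0 \<le> \<tau>" unfolding \<tau>_def using S(1) by (rule cInf_greatest) (auto simp: S_def)
      have lo: "\<tau> \<le> dyad m k" if "X (dyad m k) x < - z" for m k
        unfolding \<tau>_def by (rule cInf_lower[OF _ S(2)]) (use that in \<open>auto simp: S_def\<close>)
      have "- z \<le> X \<tau> x"
      proof (cases "\<tau> = 0")
        case False
        then have "0 < \<tau>" using \<tau>0 by simp
        moreover have "\<forall>m k. dyad m k < \<tau> \<longrightarrow> - z \<le> X (dyad m k) x"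
          using lo by (meson not_less)
        ultimately show ?thesis using nd unfolding no_down_jump_def by blast
      qed (use z in simp)
      then have "- z - e < X \<tau> x" using e by simp
      then obtain b where b: "\<tau> < b" "\<And>s. \<tau> \<le> s \<Longrightarrow> s < b \<Longrightarrow> - z - e < X s x"
        using right_limit_greater[OF x \<tau>0] by metis
      obtain m0 k0 where mk: "X (dyad m0 k0) x < - z" "dyad m0 k0 < b"
        using cInf_lessD[OF S(1)] b(1) unfolding \<tau>_def S_def by blast
      have "x \<notin> overshoot z e m" if m: "m0 \<le> m" for m
      proof
        assume "x \<in> overshoot z e m"
        then obtain k where k: "x \<in> hit z m k" "X (dyad m k) x < - z - e" by (auto simp: overshoot_def)
        have "dyad m k < b" using hit_before[OF m mk(1) k(1)] mk(2) by simp
        moreover have "\<tau> \<le> dyad m k" using k(1) by (intro lo) (simp add: hit_def)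
        ultimately show False using b(2) k(2) by force
      qed
      then show ?thesis by (auto simp: eventually_sequentially)
    qed
  qed
qed simp

text \<open>If \<open>X t x < - z\<close>, the absence of downward jumps yields an earlier dyadic
  time at which the path is already below \<open>- z\<close>. From the level of that grid on, the
  path is not late at \<open>t\<close>.\<close>

lemma late_tendsto_0:
  assumes q: "0 < q"
  shows "(\<lambda>m. \<integral>\<^sup>+t. emeasure M (late z m t) \<partial>expo q) \<longlonglongrightarrow> 0"
proof -
  have [measurable]: "late z m t \<in> sets M" for m t unfolding late_def by measurable
  have "(\<lambda>m. \<integral>\<^sup>+t. emeasure M (late z m t) \<partial>expo q) \<longlonglongrightarrow> (\<integral>\<^sup>+t. 0 \<partial>expo q)"
  proof (rule nn_integral_dominated_convergence[where w="\<lambda>_. 1"])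
    show "(\<lambda>t. emeasure M (late z m t)) \<in> borel_measurable (expo q)" for m
      unfolding late_def by measurable
    show "AE t in expo q. (\<lambda>m. emeasure M (late z m t)) \<longlonglongrightarrow> 0"
      using AE_expo_pos[OF q]
    proof eventually_elim
      fix t :: real assume t: "0 < t"
      have "(\<lambda>m. prob (late z m t)) \<longlonglongrightarrow> 0"
      proof (rule measure_tendsto_0)
        show "AE x in M. \<forall>\<^sub>F m in sequentially. x \<notin> late z m t"
          using AE_no_down_jump AE_space
        proof eventually_elim
          fix x assume nd: "no_down_jump x" and x: "x \<in> space M"
          show "\<forall>\<^sub>F m in sequentially. x \<notin> late z m t"
          proof (cases "- z \<le> X t x")
            case False
            then obtain m0 k0 where mk: "dyad m0 k0 < t" "X (dyad m0 k0) x < - z"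
              using nd t unfolding no_down_jump_def by (meson not_less)
            have "x \<notin> late z m t" if m: "m0 \<le> m" for m
            proof
              assume "x \<in> late z m t"
              then have "dyad m (k0 * 2 ^ (m - m0)) \<le> t \<longrightarrow> - z \<le> X (dyad m (k0 * 2 ^ (m - m0))) x"
                unfolding late_def by blast
              then show False using mk dyad_refine[OF m, of k0] by simp
            qed
            then show ?thesis by (auto simp: eventually_sequentially)
          qed (auto simp: late_def)
        qed
      qed simp
      then show "(\<lambda>m. emeasure M (late z m t)) \<longlonglongrightarrow> 0"
        using tendsto_ennrealI by (fastforce simp: emeasure_eq_measure)
    qed
    show "AE t in expo q. emeasure M (late z m t) \<le> 1" for m
      by (simp add: emeasure_eq_measure)
    show "(\<integral>\<^sup>+t. 1 \<partial>expo q) < \<infinity>"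
      using prob_space.emeasure_space_1[OF prob_space_expo[OF q]] by simp
  qed auto
  then show ?thesis by simp
qed

section \<open>Multiplicativity and exponential decay of the lower tail\<close>

definition tail :: "real \<Rightarrow> real \<Rightarrow> real" where
  "tail q u = measure (mu q) {..<- u}"

lemma tail_bounds: "0 < q \<Longrightarrow> 0 \<le> tail q u" "0 < q \<Longrightarrow> tail q u \<le> 1"
  using prob_space.prob_le_1[OF prob_space_mu] by (auto simp: tail_def)

lemma emeasure_mu_tail: "0 < q \<Longrightarrow> emeasure (mu q) {..<- u} = ennreal (tail q u)"
  unfolding tail_def by (rule finite_measure.emeasure_eq_measure) (rule prob_space.finite_measure[OF prob_space_mu])

lemma tail_antimono: "0 < q \<Longrightarrow> u \<le> v \<Longrightarrow> tail q v \<le> tail q u"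
  unfolding tail_def
  by (intro finite_measure.finite_measure_mono prob_space.finite_measure[OF prob_space_mu]) auto

text \<open>Right continuity comes from the strict inequality in the event; in
  \<open>tail_mult\<close> it removes the allowance for overshoot.\<close>

lemma tail_right_continuous:
  assumes q: "0 < q"
  shows "(\<lambda>n. tail q (u + 1 / real (Suc n))) \<longlonglongrightarrow> tail q u"
proof -
  interpret mu: prob_space "mu q" by (rule prob_space_mu[OF q])
  have "(\<lambda>n. measure (mu q) {..<- (u + 1 / real (Suc n))}) \<longlonglongrightarrow> measure (mu q) (\<Union>n. {..<- (u + 1 / real (Suc n))})"
  proof (rule mu.finite_Lim_measure_incseq)
    show "incseq (\<lambda>n. {..<- (u + 1 / real (Suc n))})"
    proof (rule incseq_SucI, rule subsetI)
      fix n z assume "z \<in> {..<- (u + 1 / real (Suc n))}"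
      moreover have "1 / real (Suc (Suc n)) \<le> 1 / real (Suc n)" by (simp add: field_simps)
      ultimately show "z \<in> {..<- (u + 1 / real (Suc (Suc n)))}" by simp
    qed
  qed auto
  also have "(\<Union>n. {..<- (u + 1 / real (Suc n))}) = {..<- u}"
  proof (intro set_eqI iffI)
    fix z assume "z \<in> {..<- u}"
    then obtain n where "inverse (real (Suc n)) < - u - z" using reals_Archimedean[of "- u - z"] by auto
    then show "z \<in> (\<Union>n. {..<- (u + 1 / real (Suc n))})" by (auto intro!: exI[of _ n] simp: inverse_eq_divide)
  next
    fix z assume "z \<in> (\<Union>n. {..<- (u + 1 / real (Suc n))})"
    then obtain n where "z < - (u + 1 / real (Suc n))" by auto
    moreover have "0 < 1 / real (Suc n)" by simp
    ultimately show "z \<in> {..<- u}" unfolding lessThan_iff by linarith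
  qed
  finally show ?thesis by (simp add: tail_def)
qed

lemma tail_limit_0:
  assumes q: "0 < q"
  shows "(\<lambda>n. tail q (real n)) \<longlonglongrightarrow> 0"
proof -
  interpret mu: prob_space "mu q" by (rule prob_space_mu[OF q])
  have "(\<lambda>n. measure (mu q) {..<- real n}) \<longlonglongrightarrow> 0"
  proof (rule mu.measure_tendsto_0)
    show "AE z in mu q. \<forall>\<^sub>F m in sequentially. z \<notin> {..<- real m}"
    proof (rule AE_I2)
      fix z :: real
      show "\<forall>\<^sub>F m in sequentially. z \<notin> {..<- real m}"
        using filterlim_real_sequentially[unfolded filterlim_at_top, rule_format, of "- z"]
        by eventually_elim auto
    qed
  qed simp
  then show ?thesis by (simp add: tail_def)
qed

definition weight :: "real \<Rightarrow> real \<Rightarrow> nat \<Rightarrow> real" where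
  "weight q z m = enn2real (R q z m)"

definition err :: "real \<Rightarrow> real \<Rightarrow> real \<Rightarrow> nat \<Rightarrow> real" where
  "err q z d m = prob (overshoot z d m) + enn2real (\<integral>\<^sup>+t. emeasure M (late z m t) \<partial>expo q)"

lemma weight_nonneg: "0 \<le> weight q z m"
  by (simp add: weight_def)

lemma R_eq_weight: "0 < q \<Longrightarrow> R q z m = ennreal (weight q z m)"
  using order.strict_trans1[OF R_le[of q 0 z m], of \<infinity>]
  by (simp add: emeasure_eq_measure weight_def ennreal_enn2real)

lemma weight_lower:
  assumes q: "0 < q"
  shows "weight q z m * tail q y \<le> tail q (z + y)"
  using R_lower[OF q, of z m y] unfolding emeasure_mu_tail[OF q] R_eq_weight[OF q]
  by (simp add: ennreal_mult[symmetric] tail_bounds q weight_nonneg)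

lemma weight_le:
  assumes q: "0 < q" and d: "0 \<le> d"
  shows "weight q z m \<le> exp (- q * d) + prob {x\<in>space M. \<exists>m k. dyad m k < d \<and> X (dyad m k) x < - z}"
  using R_le[OF q d, of z m] unfolding emeasure_eq_measure R_eq_weight[OF q]
  by (simp add: ennreal_plus[symmetric] del: ennreal_plus)

lemma late_integral_eq:
  assumes q: "0 < q"
  shows "(\<integral>\<^sup>+t. emeasure M (late z m t) \<partial>expo q) = ennreal (enn2real (\<integral>\<^sup>+t. emeasure M (late z m t) \<partial>expo q))"
proof -
  have "(\<integral>\<^sup>+t. emeasure M (late z m t) \<partial>expo q) \<le> (\<integral>\<^sup>+t. 1 \<partial>expo q)"
    by (rule nn_integral_mono) (simp add: emeasure_eq_measure)
  also have "\<dots> < \<infinity>" using prob_space.emeasure_space_1[OF prob_space_expo[OF q]] by simp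
  finally show ?thesis by (simp add: ennreal_enn2real)
qed

lemma weight_upper:
  assumes q: "0 < q" and "0 \<le> y"
  shows "tail q (z + y) \<le> weight q z m * tail q (y - d) + err q z d m"
  using R_upper[OF assms, of z m d]
  unfolding emeasure_mu_tail[OF q] R_eq_weight[OF q] err_def
  apply (subst (asm) late_integral_eq[OF q])
  unfolding emeasure_eq_measure[of "overshoot z d m"]
  by (simp add: ennreal_mult[symmetric] ennreal_plus[symmetric] tail_bounds q weight_nonneg del: ennreal_plus)

lemma err_tendsto_0:
  assumes q: "0 < q" and zd: "0 \<le> z" "0 < d"
  shows "err q z d \<longlonglongrightarrow> 0"
proof -
  have "(\<lambda>m. ennreal (enn2real (\<integral>\<^sup>+t. emeasure M (late z m t) \<partial>expo q))) \<longlonglongrightarrow> ennreal 0"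
    using late_tendsto_0[OF q, of z] late_integral_eq[OF q, of z] by simp
  then have "(\<lambda>m. enn2real (\<integral>\<^sup>+t. emeasure M (late z m t) \<partial>expo q)) \<longlonglongrightarrow> 0"
    by (subst (asm) tendsto_ennreal_iff) auto
  from tendsto_add[OF overshoot_tendsto_0[OF zd] this] show ?thesis
    by (simp add: err_def[abs_def])
qed


text \<open>Up to errors, \<open>tail q (z + y)\<close> is \<open>weight q z m * tail q y\<close>,
  and \<open>y = 0\<close> gives \<open>tail q z\<close> as \<open>weight q z m * tail q 0\<close>.
  Cross-multiplying eliminates the weight, so its convergence in \<open>m\<close> need not be
  known.\<close>

lemma tail_mult:
  assumes q: "0 < q" and z: "0 \<le> z" and y: "0 \<le> y"
  shows "tail q 0 * tail q (z + y) = tail q z * tail q y"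
proof -
  note nn = tail_bounds(1)[OF q]
  have up: "tail q 0 * tail q (z + y + d) \<le> tail q z * tail q y" if d: "0 < d" for d
  proof -
    have "tail q 0 * tail q (z + y + d) - tail q z * tail q y \<le> tail q 0 * err q z d m" for m
    proof -
      \<comment> \<open>The overshoot allowance \<open>d\<close> is added to the argument
        beforehand, so that exactly \<open>y\<close> remains after \<open>weight_upper\<close>
        subtracts it.\<close>
      have "tail q 0 * tail q (z + (y + d)) \<le> tail q 0 * (weight q z m * tail q (y + d - d) + err q z d m)"
        using z y d by (intro mult_left_mono weight_upper q nn) auto
      also have "\<dots> = (weight q z m * tail q 0) * tail q y + tail q 0 * err q z d m" by (simp add: algebra_simps)
      also have "(weight q z m * tail q 0) * tail q y \<le> tail q (z + 0) * tail q y"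
        by (intro mult_right_mono weight_lower q nn)
      finally show ?thesis by (simp add: algebra_simps)
    qed
    then have "tail q 0 * tail q (z + y + d) - tail q z * tail q y \<le> tail q 0 * 0"
      by (intro LIMSEQ_le_const[OF tendsto_mult[OF tendsto_const err_tendsto_0[OF q z d]]]) auto
    then show ?thesis by simp
  qed
  have lo: "tail q (z + d) * tail q y \<le> tail q 0 * tail q (z + y)" if d: "0 < d" for d
  proof -
    have "tail q (z + d) * tail q y - tail q 0 * tail q (z + y) \<le> tail q y * err q z d m" for m
    proof -
      have "tail q (z + d) * tail q y \<le> (weight q z m * tail q (d - d) + err q z d m) * tail q y"
        using z d by (intro mult_right_mono weight_upper q nn) auto
      also have "\<dots> = tail q 0 * (weight q z m * tail q y) + tail q y * err q z d m" by (simp add: algebra_simps)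
      also have "tail q 0 * (weight q z m * tail q y) \<le> tail q 0 * tail q (z + y)"
        by (intro mult_left_mono weight_lower q nn)
      finally show ?thesis by simp
    qed
    then have "tail q (z + d) * tail q y - tail q 0 * tail q (z + y) \<le> tail q y * 0"
      by (intro LIMSEQ_le_const[OF tendsto_mult[OF tendsto_const err_tendsto_0[OF q z d]]]) auto
    then show ?thesis by simp
  qed
  show ?thesis
  proof (rule antisym)
    show "tail q 0 * tail q (z + y) \<le> tail q z * tail q y"
      by (rule LIMSEQ_le_const2[OF tendsto_mult[OF tendsto_const tail_right_continuous[OF q]]])
         (use up in auto)
    show "tail q z * tail q y \<le> tail q 0 * tail q (z + y)"
      by (rule LIMSEQ_le_const2[OF tendsto_mult[OF tail_right_continuous[OF q] tendsto_const]])
         (use lo in auto)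
  qed
qed

text \<open>If the sampled process were almost surely nonnegative, then so would be
  \<open>X t\<close> for almost every \<open>t\<close>, by right continuity for every
  \<open>t\<close>, and by stationarity every increment. Monotonicity on the dyadic times would
  extend to whole paths, which is excluded.\<close>

lemma tail_0_pos:
  assumes q: "0 < q"
  shows "0 < tail q 0"
proof (rule ccontr)
  assume "\<not> 0 < tail q 0"
  then have "tail q 0 = 0" using tail_bounds(1)[OF q, of 0] by simp
  then have "(\<integral>\<^sup>+t. emeasure M {x\<in>space M. X t x \<in> {..<0}} \<partial>expo q) = 0"
    using emeasure_mu_tail[OF q, of 0] by (simp add: emeasure_mu)
  then have "AE t in expo q. emeasure M {x\<in>space M. X t x \<in> {..<0}} = 0"
    by (subst (asm) nn_integral_0_iff_AE) simp_all
  then have ae: "AE t in lborel. 0 \<le> t \<longrightarrow> emeasure M {x\<in>space M. X t x \<in> {..<0}} = 0"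
    by (simp add: AE_expo_iff q)
  have near: "\<exists>t. s < t \<and> t < s + 1 / real (Suc n) \<and> (AE x in M. 0 \<le> X t x)" if s: "0 \<le> s" for s n
  proof (rule ccontr)
    assume no: "\<not> ?thesis"
    have "AE t in lborel. t \<notin> {s<..<s + 1 / real (Suc n)}"
      using ae
    proof eventually_elim
      fix t assume t: "0 \<le> t \<longrightarrow> emeasure M {x\<in>space M. X t x \<in> {..<0}} = 0"
      show "t \<notin> {s<..<s + 1 / real (Suc n)}"
      proof
        assume a: "t \<in> {s<..<s + 1 / real (Suc n)}"
        then have "emeasure M {x\<in>space M. X t x \<in> {..<0}} = 0" using t s by auto
        then have "AE x in M. 0 \<le> X t x"
          by (subst AE_iff_measurable[where N="{x\<in>space M. X t x \<in> {..<0}}"]) (auto simp: not_le)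
        then show False using no a by auto
      qed
    qed
    then have "emeasure lborel {s<..<s + 1 / real (Suc n)} = 0"
      by (subst (asm) AE_iff_measurable[where N="{s<..<s + 1 / real (Suc n)}"]) auto
    then show False by simp
  qed
  have nonneg: "AE x in M. 0 \<le> X s x" if s: "0 \<le> s" for s
  proof -
    obtain t where t: "\<And>n. s < t n" "\<And>n. t n < s + 1 / real (Suc n)" "\<And>n. AE x in M. 0 \<le> X (t n) x"
      using near[OF s] by metis
    have lim: "t \<longlonglongrightarrow> s"
    proof (rule real_tendsto_sandwich[OF _ _ tendsto_const])
      have "(\<lambda>n. s + 1 / real (Suc n)) \<longlonglongrightarrow> s + 0"
        by (intro tendsto_intros LIMSEQ_Suc[OF lim_1_over_n])
      then show "(\<lambda>n. s + 1 / real (Suc n)) \<longlonglongrightarrow> s" by simp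
    qed (intro always_eventually allI less_imp_le t)+
    have fl: "filterlim t (at_right s) sequentially"
      using lim t(1) by (intro filterlim_at_withinI) (auto intro!: always_eventually simp: less_imp_neq)
    have "AE x in M. \<forall>n. 0 \<le> X (t n) x" using t(3) by (simp add: AE_all_countable)
    then show ?thesis using AE_space
    proof eventually_elim
      fix x assume "\<forall>n. 0 \<le> X (t n) x" and x: "x \<in> space M"
      moreover have "(\<lambda>n. X (t n) x) \<longlonglongrightarrow> X s x"
        by (rule filterlim_compose[OF X_right_continuous[OF x s] fl])
      ultimately show "0 \<le> X s x" by (intro LIMSEQ_le_const) auto
    qed
  qed
  have incr: "AE x in M. X s x \<le> X (s + h) x" if sh: "0 \<le> s" "0 \<le> h" for s h
  proof -
    have "AE z in distr M borel (X h). 0 \<le> z"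
      by (subst AE_distr_iff) (use nonneg[OF sh(2)] in auto)
    then have "AE z in distr M borel (\<lambda>x. X (s + h) x - X s x). 0 \<le> z"
      by (simp only: X_increment_distr[OF sh])
    then show ?thesis by (subst (asm) AE_distr_iff) auto
  qed
  have "AE x in M. \<forall>m k n l. dyad m k \<le> dyad n l \<longrightarrow> X (dyad m k) x \<le> X (dyad n l) x"
  proof (simp only: AE_all_countable, intro allI)
    fix m k n l
    show "AE x in M. dyad m k \<le> dyad n l \<longrightarrow> X (dyad m k) x \<le> X (dyad n l) x"
      using incr[of "dyad m k" "dyad n l - dyad m k"] by (cases "dyad m k \<le> dyad n l") auto
  qed
  then have "AE x in M. mono_on {0..} (\<lambda>t. Y t x)"
    using AE_space AE_X_eq
  proof eventually_elim
    fix x assume D: "\<forall>m k n l. dyad m k \<le> dyad n l \<longrightarrow> X (dyad m k) x \<le> X (dyad n l) x"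
      and x: "x \<in> space M" and XY: "\<forall>t\<ge>0. X t x = Y t x"
    have "X s x \<le> X t x" if st: "0 \<le> s" "s \<le> t" for s t
    proof (rule ccontr)
      assume "\<not> X s x \<le> X t x"
      then obtain c where c: "X t x < c" "c < X s x" using dense[of "X t x" "X s x"] by (auto simp: not_le)
      have "s < t" using st c by (cases "s = t") auto
      obtain b where b: "t < b" "\<And>u. t \<le> u \<Longrightarrow> u < b \<Longrightarrow> X u x < c"
        using right_limit_less[OF x _ c(1)] st by (metis order_trans)
      obtain b' where b': "s < b'" "\<And>u. s \<le> u \<Longrightarrow> u < b' \<Longrightarrow> c < X u x"
        using right_limit_greater[OF x _ c(2)] st by metis
      obtain m k where mk: "s < dyad m k" "dyad m k < min t b'"
        using dyad_dense[of s "min t b'"] b' st \<open>s < t\<close> by auto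
      obtain n l where nl: "t < dyad n l" "dyad n l < b"
        using dyad_dense[of t b] b st by auto
      have "X (dyad m k) x \<le> X (dyad n l) x" using D mk nl by auto
      then show False using b(2)[of "dyad n l"] b'(2)[of "dyad m k"] mk nl by auto
    qed
    then show "mono_on {0..} (\<lambda>t. Y t x)"
      using XY by (auto simp: mono_on_def)
  qed
  then show False using nonmono by simp
qed

text \<open>Once the tail is known to be exponential, its exponent can be read off at distance
  1.\<close>

definition rate :: "real \<Rightarrow> real" where
  "rate q = ln (tail q 0) - ln (tail q 1)"

lemma tail_eq:
  assumes q: "0 < q"
  shows "0 < rate q" "0 \<le> u \<Longrightarrow> tail q u = tail q 0 * exp (- rate q * u)"
proof -
  define h where "h u = tail q u / tail q 0" for u
  have p0: "0 < tail q 0" by (rule tail_0_pos[OF q])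
  have mult: "h (s + t) = h s * h t" if "0 \<le> s" "0 \<le> t" for s t
    using tail_mult[OF q that] p0 by (simp add: h_def field_simps)
  have anti: "h t \<le> h s" if "s \<le> t" for s t
    using tail_antimono[OF q that] p0 by (simp add: h_def divide_right_mono)
  have h0: "h 0 = 1" using p0 by (simp add: h_def)
  \<comment> \<open>Right continuity at 0 gives \<open>0 < h d\<close> for some small
    \<open>d\<close>; the powers of \<open>h d\<close> are values of the antitone \<open>h\<close>
    at arbitrarily distant points.\<close>
  have pos: "0 < h t" if t: "0 \<le> t" for t
  proof -
    have "(\<lambda>n. tail q (0 + 1 / real (Suc n))) \<longlonglongrightarrow> tail q 0" by (rule tail_right_continuous[OF q])
    from order_tendstoD(1)[OF this p0] obtain n where n: "0 < tail q (1 / real (Suc n))"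
      by (auto simp: eventually_sequentially)
    define d where "d = 1 / real (Suc n)"
    have d: "0 < d" "0 < h d" using n p0 by (auto simp: d_def h_def)
    have "h (real k * d) = h d ^ k" for k
    proof (induction k)
      case (Suc k)
      have "h (real (Suc k) * d) = h (d + real k * d)" by (simp add: algebra_simps)
      then show ?case using mult[of d "real k * d"] d Suc by simp
    qed (simp add: h0)
    moreover obtain k :: nat where "t \<le> real k * d"
      using real_arch_simple[of "t / d"] d by (auto simp: field_simps)
    ultimately show ?thesis using anti[of t "real k * d"] zero_less_power[OF d(2), of k]
      by (metis order.strict_trans2)
  qed
  have int: "set_integrable lborel {0..b} h" for b
  proof -
    have "(\<lambda>x. - h (x::real)) \<in> borel_measurable borel"
      using anti by (intro borel_measurable_mono) (auto simp: mono_def)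
    then have [measurable]: "h \<in> borel_measurable borel" using borel_measurable_uminus by fastforce
    have hb: "norm (h x) \<le> 1 / tail q 0" for x
      using tail_bounds[OF q, of x] p0 by (simp add: h_def divide_right_mono)
    show ?thesis unfolding set_integrable_def
      by (rule integrableI_bounded_set_indicator[where B="1 / tail q 0"]) (use hb in \<open>auto simp: emeasure_lborel_Icc_eq\<close>)
  qed
  obtain k where k: "\<And>t. 0 \<le> t \<Longrightarrow> h t = exp (k * t)"
    using multiplicative_imp_exp[OF pos mult int] by auto
  have t: "tail q u = tail q 0 * exp (k * u)" if "0 \<le> u" for u
    using k[OF that] p0 by (simp add: h_def field_simps)
  have rk: "rate q = - k"
    using t[of 1] p0 by (simp add: rate_def ln_mult)
  show "tail q u = tail q 0 * exp (- rate q * u)" if "0 \<le> u"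
    using t[OF that] rk by simp
  show "0 < rate q"
  proof (rule ccontr)
    assume "\<not> 0 < rate q"
    then have "tail q 0 \<le> tail q (real n)" for n
      using t[of "real n"] rk p0 by simp
    then have "tail q 0 \<le> 0"
      by (intro LIMSEQ_le_const[OF tail_limit_0[OF q]]) auto
    then show False using p0 by simp
  qed
qed

text \<open>A passage below \<open>- 1\<close> before a short time \<open>d\<close> is improbable by
  right continuity at 0, and a later one is discounted by \<open>exp (- q * d)\<close>. So the
  weight for level 1 is small for large \<open>q\<close>, which forces fast decay of the
  tail.\<close>

lemma rate_unbounded: "\<exists>q>b. a < rate q"
proof -
  define p where "p d = prob {x\<in>space M. \<exists>m k. dyad m k < d \<and> X (dyad m k) x < - 1}" for d
  have "(\<lambda>n. p (1 / real (Suc n))) \<longlonglongrightarrow> 0" unfolding p_def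
  proof (rule measure_tendsto_0)
    show "AE x in M. \<forall>\<^sub>F n in sequentially. x \<notin> {x\<in>space M. \<exists>m k. dyad m k < 1 / real (Suc n) \<and> X (dyad m k) x < - 1}"
      using AE_space
    proof eventually_elim
      fix x assume x: "x \<in> space M"
      obtain c where c: "0 < c" "\<And>s. 0 \<le> s \<Longrightarrow> s < c \<Longrightarrow> - 1 < X s x"
        using right_limit_greater[OF x, of 0 "-1"] by auto
      obtain N where "inverse (real (Suc N)) < c" using reals_Archimedean[OF c(1)] by auto
      then have N: "1 / real (Suc N) < c" by (simp add: inverse_eq_divide)
      have "x \<notin> {x\<in>space M. \<exists>m k. dyad m k < 1 / real (Suc n) \<and> X (dyad m k) x < - 1}" if n: "N \<le> n" for n
      proof -
        have "1 / real (Suc n) \<le> 1 / real (Suc N)" using n by (intro divide_left_mono) auto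
        then have lt: "dyad m k < c" if "dyad m k < 1 / real (Suc n)" for m k
          using N that by linarith
        show ?thesis
        proof
          assume "x \<in> {x\<in>space M. \<exists>m k. dyad m k < 1 / real (Suc n) \<and> X (dyad m k) x < - 1}"
          then obtain m k where "dyad m k < 1 / real (Suc n)" "X (dyad m k) x < - 1" by blast
          then show False using c(2)[OF dyad_nonneg lt, of m k] by simp
        qed
      qed
      then show "\<forall>\<^sub>F n in sequentially. x \<notin> {x\<in>space M. \<exists>m k. dyad m k < 1 / real (Suc n) \<and> X (dyad m k) x < - 1}"
        by (auto simp: eventually_sequentially)
    qed
  qed measurable
  from order_tendstoD(2)[OF this, of "exp (- 2 * \<bar>a\<bar>) / 2"]
  obtain n where "p (1 / real (Suc n)) < exp (- 2 * \<bar>a\<bar>) / 2" by (auto simp: eventually_sequentially)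
  then obtain d where d: "0 < d" "p d < exp (- 2 * \<bar>a\<bar>) / 2"
    using that[of "1 / real (Suc n)"] by (metis divide_pos_pos of_nat_0_less_iff zero_less_Suc zero_less_one)
  \<comment> \<open>The second entry makes \<open>exp (- q * d)\<close> at most half of
    \<open>exp (- 2 * \<bar>a\<bar>)\<close>; the other half bounds \<open>p d\<close>. The 2 in the
    exponent matches the distance 2 in \<open>tail q 2\<close>.\<close>
  define q where "q = max (\<bar>b\<bar> + 1) ((2 * \<bar>a\<bar> + 2) / d)"
  have q: "0 < q" "b < q" by (auto simp: q_def)
  have "2 * \<bar>a\<bar> + 2 \<le> q * d" using d by (auto simp: q_def pos_divide_le_eq[symmetric])
  then have "exp (- q * d) \<le> exp (- 2 * \<bar>a\<bar> - 2)" by simp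
  also have "\<dots> = exp (- 2 * \<bar>a\<bar>) * exp (- 2)" by (simp add: exp_diff exp_minus field_simps)
  also have "\<dots> \<le> exp (- 2 * \<bar>a\<bar>) * (1 / 2)"
  proof (intro mult_left_mono)
    have "(2::real) \<le> exp 2" using exp_ge_add_one_self[of 2] by simp
    then show "exp (- 2 :: real) \<le> 1 / 2" by (simp add: exp_minus field_simps)
  qed simp
  finally have small: "exp (- q * d) + p d < exp (- 2 * \<bar>a\<bar>)" using d(2) by simp
  have "tail q 2 - (exp (- q * d) + p d) * tail q 0 \<le> err q 1 1 m" for m
  proof -
    have "tail q (1 + 1) \<le> weight q 1 m * tail q (1 - 1) + err q 1 1 m"
      by (rule weight_upper[OF q(1)]) simp
    also have "weight q 1 m * tail q (1 - 1) \<le> (exp (- q * d) + p d) * tail q (1 - 1)"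
      unfolding p_def using d by (intro mult_right_mono weight_le tail_bounds q) auto
    finally show ?thesis by simp
  qed
  then have "tail q 2 - (exp (- q * d) + p d) * tail q 0 \<le> 0"
    by (intro LIMSEQ_le_const[OF err_tendsto_0[OF q(1), of 1 1]]) auto
  then have "tail q 0 * exp (- rate q * 2) \<le> (exp (- q * d) + p d) * tail q 0"
    using tail_eq(2)[OF q(1), of 2] by simp
  then have "exp (- rate q * 2) \<le> exp (- q * d) + p d"
    using tail_0_pos[OF q(1)] by (simp add: mult.commute)
  also note small
  finally have "\<bar>a\<bar> < rate q" by simp
  then show ?thesis using q by (intro exI[of _ q]) auto
qed


section \<open>The Laplace exponent\<close>

text \<open>Conditioned on being negative and reflected, \<open>mu q\<close> has a distribution
  function that is read off from \<open>tail_eq\<close>; it is that of the exponential law of rate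
  \<open>rate q\<close>.\<close>

lemma nn_integral_mu_negative:
  assumes q: "0 < q" and h[measurable]: "h \<in> borel_measurable borel"
  shows "(\<integral>\<^sup>+z. h z * indicator {..<0} z \<partial>mu q) = ennreal (tail q 0) * (\<integral>\<^sup>+y. h (- y) \<partial>expo (rate q))"
proof -
  interpret mu: prob_space "mu q" by (rule prob_space_mu[OF q])
  let ?N = "uniform_measure (mu q) {..<0}"
  have c: "0 < tail q 0" by (rule tail_0_pos[OF q])
  have e: "emeasure (mu q) {..<0} = ennreal (tail q 0)" using emeasure_mu_tail[OF q, of 0] by simp
  interpret N: prob_space ?N
    by (rule prob_space_uniform_measure) (use e c in auto)
  have "distributed ?N lborel uminus (exponential_density (rate q))"
  proof (rule N.exponential_distributed_iff[OF tail_eq(1)[OF q], THEN iffD2], intro conjI allI impI)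
    fix a :: real assume a: "0 \<le> a"
    have "N.prob {x\<in>space ?N. - x \<le> a} = measure (mu q) ({..<0} \<inter> {- a..}) / measure (mu q) {..<0}"
    proof -
      have "{x\<in>space ?N. - x \<le> a} = {- a..}" by auto
      then show ?thesis by (simp, subst measure_uniform_measure) (use e c in auto)
    qed
    also have "{..<0} \<inter> {- a..} = {..<0} - {..<- a}" using a by auto
    also have "measure (mu q) ({..<0} - {..<- a}) = tail q 0 - tail q a"
      using a by (subst mu.finite_measure_Diff) (auto simp: tail_def)
    also have "\<dots> / measure (mu q) {..<0} = 1 - exp (- a * rate q)"
      using tail_eq(2)[OF q a] c by (simp add: tail_def field_simps)
    finally show "N.prob {x\<in>space ?N. - x \<le> a} = 1 - exp (- a * rate q)" .
  qed (use tail_eq(1)[OF q] in auto)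
  from distributed_nn_integral[OF this, of "\<lambda>y. h (- y)"]
  have "(\<integral>\<^sup>+y. h (- y) \<partial>expo (rate q)) = (\<integral>\<^sup>+z. h z \<partial>?N)"
    by (simp add: nn_integral_expo)
  also have "\<dots> = (\<integral>\<^sup>+z. h z * indicator {..<0} z \<partial>mu q) / ennreal (tail q 0)"
    by (subst nn_integral_uniform_measure) (simp_all add: e)
  finally show ?thesis using c
    by (simp add: ennreal_times_divide mult.commute[of "ennreal (tail q 0)"] ennreal_mult_divide_eq)
qed

text \<open>The values are in \<open>ennreal\<close> because finiteness is only available from
  \<open>mgf_finite\<close> on.\<close>

definition mgf :: "real \<Rightarrow> real \<Rightarrow> ennreal" where
  "mgf a t = (\<integral>\<^sup>+x. ennreal (exp (- a * X t x)) \<partial>M)"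

lemma mgf_measurable [measurable]: "mgf a \<in> borel_measurable borel"
  unfolding mgf_def[abs_def] by measurable

lemma mgf_add:
  assumes "0 \<le> s" "0 \<le> t"
  shows "mgf a (s + t) = mgf a s * mgf a t"
proof -
  have e: "ennreal (exp (- a * (u + v))) = ennreal (exp (- a * u)) * ennreal (exp (- a * v))" for u v
    by (simp only: distrib_left exp_add ennreal_mult exp_ge_zero)
  have "mgf a (s + t) = (\<integral>\<^sup>+x. (\<integral>\<^sup>+y. ennreal (exp (- a * (X s x + X t y))) \<partial>M) \<partial>M)"
    unfolding mgf_def by (rule nn_integral_X_semigroup[OF assms]) simp
  also have "\<dots> = mgf a s * mgf a t"
    unfolding e mgf_def by (subst nn_integral_cmult, measurable) (rule nn_integral_multc, measurable)
  finally show ?thesis .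
qed

lemma mgf_pos: "0 < mgf a t"
proof (rule ccontr)
  assume "\<not> 0 < mgf a t"
  then have "mgf a t = 0" by (simp add: zero_less_iff_neq_zero)
  then have "AE x in M. ennreal (exp (- a * X t x)) = 0"
    unfolding mgf_def by (subst (asm) nn_integral_0_iff_AE) auto
  then have "AE x in M. False" by eventually_elim simp
  then show False by simp
qed

lemma nn_integral_exp_mu: "(\<integral>\<^sup>+z. ennreal (exp (- a * z)) \<partial>mu q) = (\<integral>\<^sup>+t. mgf a t \<partial>expo q)"
  unfolding mgf_def by (rule nn_integral_mu) simp

lemma nn_integral_exp_mu_negative:
  assumes q: "0 < q" and a: "a < rate q"
  shows "(\<integral>\<^sup>+z. ennreal (exp (- a * z)) * indicator {..<0} z \<partial>mu q) =
    ennreal (tail q 0 * rate q / (rate q - a))"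
  using nn_integral_expo_exp[OF tail_eq(1)[OF q] a] tail_eq(1)[OF q] a tail_bounds(1)[OF q, of 0]
  by (subst nn_integral_mu_negative[OF q]) (simp_all add: ennreal_mult[symmetric])

lemma nn_integral_exp_mu_positive:
  assumes "0 < q" "0 \<le> a"
  shows "(\<integral>\<^sup>+z. ennreal (exp (- a * z)) * indicator {0..} z \<partial>mu q) \<le> 1"
proof -
  interpret mu: prob_space "mu q" by (rule prob_space_mu) fact
  have "(\<integral>\<^sup>+z. ennreal (exp (- a * z)) * indicator {0..} z \<partial>mu q) \<le> (\<integral>\<^sup>+z. 1 \<partial>mu q)"
    using assms by (intro nn_integral_mono) (auto simp: indicator_def)
  then show ?thesis using mu.emeasure_space_1 by simp
qed

lemma nn_integral_mu_split:
  assumes [measurable]: "h \<in> borel_measurable borel"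
  shows "(\<integral>\<^sup>+z. h z \<partial>mu q) = (\<integral>\<^sup>+z. h z * indicator {0..} z \<partial>mu q) + (\<integral>\<^sup>+z. h z * indicator {..<0} z \<partial>mu q)"
  by (subst nn_integral_add[symmetric]) (auto intro!: nn_integral_cong simp: indicator_def)

lemma nn_integral_mgf_finite:
  assumes q: "0 < q" and a: "0 \<le> a" "a < rate q"
  shows "(\<integral>\<^sup>+t. mgf a t \<partial>expo q) < \<infinity>"
proof -
  have "(\<integral>\<^sup>+t. mgf a t \<partial>expo q) \<le> 1 + ennreal (tail q 0 * rate q / (rate q - a))"
    unfolding nn_integral_exp_mu[symmetric]
    by (subst nn_integral_mu_split, simp, unfold nn_integral_exp_mu_negative[OF q a(2)])
       (intro add_mono nn_integral_exp_mu_positive q a order_refl)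
  also have "\<dots> < \<infinity>" by simp
  finally show ?thesis .
qed

text \<open>At an exponential time of rate \<open>q\<close> with \<open>a < rate q\<close> the
  transform is finite, so \<open>mgf a t\<close> is finite for almost every \<open>t\<close>.
  Finiteness at one \<open>t > s\<close> passes down to \<open>s\<close> through
  \<open>mgf_add\<close>, the other factor being positive.\<close>

lemma mgf_finite:
  assumes a: "0 \<le> a" and s: "0 \<le> s"
  shows "mgf a s < \<infinity>"
proof -
  obtain q where q: "0 < q" "a < rate q" using rate_unbounded[of 0 a] by auto
  have "AE t in expo q. mgf a t \<noteq> \<infinity>"
    by (rule nn_integral_PInf_AE) (use nn_integral_mgf_finite[OF q(1) a q(2)] in auto)
  then have ae: "AE t in lborel. 0 \<le> t \<longrightarrow> mgf a t \<noteq> \<infinity>" by (simp add: AE_expo_iff q)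
  have "\<exists>t>s. mgf a t \<noteq> \<infinity>"
  proof (rule ccontr)
    assume no: "\<not> ?thesis"
    have "AE t in lborel. t \<notin> {s<..<s + 1}"
      using ae by eventually_elim (use no s in auto)
    then have "emeasure lborel {s<..<s + 1} = 0"
      by (subst (asm) AE_iff_measurable[where N="{s<..<s + 1}"]) auto
    then show False by simp
  qed
  then obtain t where t: "s < t" "mgf a t \<noteq> \<infinity>" by auto
  have "mgf a t = mgf a s * mgf a (t - s)" using mgf_add[of s "t - s" a] s t by simp
  then show ?thesis using t(2) mgf_pos[of a "t - s"]
    by (auto simp: ennreal_top_mult less_top[symmetric] split: if_splits)
qed

lemma integrable_exp: "0 \<le> a \<Longrightarrow> 0 \<le> t \<Longrightarrow> integrable M (\<lambda>x. exp (- a * X t x))"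
  by (rule integrableI_nonneg) (use mgf_finite[of a t] in \<open>auto simp: mgf_def\<close>)

definition phi :: "real \<Rightarrow> real" where
  "phi = laplace_exponent M Y"

lemma phi_eq: "phi a = ln (expectation (\<lambda>x. exp (- a * X 1 x)))"
proof -
  have [measurable]: "Y 1 \<in> borel_measurable M" by (rule Y_measurable) simp
  have "expectation (\<lambda>x. exp (- a * Y 1 x)) = expectation (\<lambda>x. exp (- a * X 1 x))"
  proof (rule integral_cong_AE)
    show "AE x in M. exp (- a * Y 1 x) = exp (- a * X 1 x)"
      using AE_X_eq by eventually_elim simp
  qed auto
  then show ?thesis by (simp add: phi_def laplace_exponent_def)
qed

lemma mgf_eq:
  assumes a: "0 \<le> a" and t: "0 \<le> t"
  shows "mgf a t = ennreal (exp (t * phi a))"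
proof -
  define h where "h t = expectation (\<lambda>x. exp (- a * X t x))" for t
  have h: "mgf a t = ennreal (h t)" if "0 \<le> t" for t
    unfolding mgf_def h_def by (rule nn_integral_eq_integral) (use integrable_exp[OF a that] in auto)
  have pos: "0 < h t" if "0 \<le> t" for t using mgf_pos[of a t] h[OF that] by simp
  have mult: "h (s + t) = h s * h t" if "0 \<le> s" "0 \<le> t" for s t
  proof -
    have "ennreal (h (s + t)) = ennreal (h s * h t)"
      using mgf_add[OF that, of a] unfolding h[OF that(1)] h[OF that(2)] h[OF add_nonneg_nonneg[OF that]]
      by (simp add: ennreal_mult less_imp_le pos that)
    then show ?thesis using pos that by (simp add: less_imp_le)
  qed
  have [measurable]: "h \<in> borel_measurable borel" unfolding h_def[abs_def] by measurable
  obtain q where q: "0 < q" "a < rate q" using rate_unbounded[of 0 a] by auto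
  have int: "set_integrable lborel {0..b} h" for b
    unfolding set_integrable_def
  proof (rule integrableI_nonneg)
    show "AE x in lborel. 0 \<le> indicator {0..b} x *\<^sub>R h x"
      by (auto simp: indicator_def less_imp_le pos)
    \<comment> \<open>The factor \<open>exp (q * b) / q\<close> raises the exponential density to at
      least 1 on \<open>{0..b}\<close>. This turns finiteness at an exponential time into local
      integrability.\<close>
    have "(\<integral>\<^sup>+t. ennreal (indicator {0..b} t *\<^sub>R h t) \<partial>lborel) \<le>
        (\<integral>\<^sup>+t. ennreal (exp (q * b) / q) * (ennreal (exponential_density q t) * mgf a t) \<partial>lborel)"
    proof (rule nn_integral_mono)
      fix t
      show "ennreal (indicator {0..b} t *\<^sub>R h t) \<le> ennreal (exp (q * b) / q) * (ennreal (exponential_density q t) * mgf a t)"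
      proof (cases "t \<in> {0..b}")
        case True
        then have "t * q \<le> q * b" using q by (simp add: mult.commute)
        then have "1 \<le> exp (q * b) / q * exponential_density q t"
          using True q by (simp add: exponential_density_def exp_minus field_simps)
        then have "1 * h t \<le> exp (q * b) / q * exponential_density q t * h t"
          using True pos[of t] by (intro mult_right_mono) auto
        then show ?thesis using True q pos[of t]
          by (simp add: h ennreal_mult[symmetric] exponential_density_nonneg ennreal_leI mult.assoc)
      qed simp
    qed
    also have "\<dots> = ennreal (exp (q * b) / q) * (\<integral>\<^sup>+t. mgf a t \<partial>expo q)"
      by (subst nn_integral_cmult, measurable) (simp add: nn_integral_expo)
    also have "\<dots> < \<infinity>" using nn_integral_mgf_finite[OF q(1) a q(2)] by (simp add: ennreal_mult_less_top)
    finally show "(\<integral>\<^sup>+t. ennreal (indicator {0..b} t *\<^sub>R h t) \<partial>lborel) < \<infinity>" .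
  qed simp
  obtain k where k: "\<And>t. 0 \<le> t \<Longrightarrow> h t = exp (k * t)"
    using multiplicative_imp_exp[OF pos mult int] by auto
  have "phi a = k" using k[of 1] by (simp add: phi_eq h_def)
  then show ?thesis using h[OF t] k[OF t] by (simp add: mult.commute)
qed

lemma expectation_exp: "0 \<le> a \<Longrightarrow> expectation (\<lambda>x. exp (- a * X 1 x)) = exp (phi a)"
  using mgf_eq[of a 1] nn_integral_eq_integral[OF integrable_exp[of a 1]]
  by (simp add: mgf_def)

lemma nn_integral_exp_mu_eq:
  assumes q: "0 < q" and a: "0 \<le> a"
  shows "(\<integral>\<^sup>+z. ennreal (exp (- a * z)) \<partial>mu q) = (\<integral>\<^sup>+t. ennreal (exp (phi a * t)) \<partial>expo q)"
  unfolding nn_integral_exp_mu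
  by (rule nn_integral_cong_AE, rule AE_mp[OF AE_expo_pos[OF q]])
     (auto intro!: AE_I2 simp: mgf_eq[OF a] mult.commute)

text \<open>Otherwise the transform at the exponential time would be infinite, contrary to
  \<open>nn_integral_mgf_finite\<close>.\<close>

lemma phi_less:
  assumes q: "0 < q" and a: "0 \<le> a" "a < rate q"
  shows "phi a < q"
proof (rule ccontr)
  assume "\<not> phi a < q"
  then have "(\<integral>\<^sup>+t. mgf a t \<partial>expo q) = \<infinity>"
    unfolding nn_integral_exp_mu[symmetric] nn_integral_exp_mu_eq[OF q a(1)]
    by (intro nn_integral_expo_exp_infinite q) simp
  then show False using nn_integral_mgf_finite[OF assms] by simp
qed

lemma continuous_on_phi: "continuous_on {0..} phi"
proof -
  have "continuous_on {0..} (\<lambda>a. expectation (\<lambda>x. exp (- a * X 1 x)))"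
    by (rule continuous_on_laplace_transform_Ici) (use integrable_exp in \<open>auto simp: finite_measure_axioms\<close>)
  then have "continuous_on {0..} (\<lambda>a. ln (expectation (\<lambda>x. exp (- a * X 1 x))))"
    by (rule continuous_on_ln) (metis atLeast_iff exp_not_eq_zero expectation_exp)
  then show ?thesis by (simp add: phi_eq[abs_def])
qed

lemma phi_0 [simp]: "phi 0 = 0"
  by (simp add: phi_eq prob_space)

text \<open>Convexity of the exponent along segments from 0, where it vanishes. The convexity
  inequality of \<open>exp\<close> between 0 and \<open>- a * y - phi a\<close> is integrated, using
  that \<open>exp (- a * X 1 x - phi a)\<close> has mean 1.\<close>

lemma phi_star:
  assumes "0 \<le> u" "u \<le> 1" "0 \<le> a"
  shows "phi (u * a) \<le> u * phi a"
proof -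
  have "exp (- (u * a) * y) \<le> exp (u * phi a) * (1 - u + u * (exp (- a * y) * exp (- phi a)))" for y
  proof -
    have "exp ((1 - u) *\<^sub>R 0 + u *\<^sub>R (- a * y - phi a)) \<le> (1 - u) * exp 0 + u * exp (- a * y - phi a)"
      by (rule convex_onD[OF exp_convex, of u]) (use assms in auto)
    then have "exp (u * phi a) * exp (u * (- a * y - phi a)) \<le> exp (u * phi a) * (1 - u + u * exp (- a * y - phi a))"
      by (intro mult_left_mono) auto
    also have "exp (u * phi a) * exp (u * (- a * y - phi a)) = exp (- (u * a) * y)"
      by (simp add: exp_add[symmetric] algebra_simps)
    finally show ?thesis by (simp add: exp_diff exp_minus field_simps)
  qed
  then have "expectation (\<lambda>x. exp (- (u * a) * X 1 x)) \<le>
      expectation (\<lambda>x. exp (u * phi a) * (1 - u + u * (exp (- a * X 1 x) * exp (- phi a))))"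
    using assms integrable_exp[of a 1] integrable_exp[of "u * a" 1]
    by (intro integral_mono) auto
  also have "\<dots> = exp (u * phi a) * (1 - u + u * (expectation (\<lambda>x. exp (- a * X 1 x)) * exp (- phi a)))"
    using assms integrable_exp[of a 1] by (simp add: prob_space)
  also have "\<dots> = exp (u * phi a)" unfolding expectation_exp[OF assms(3)] by (simp add: exp_minus)
  finally show ?thesis using assms expectation_exp[of "u * a"] by simp
qed

text \<open>
  The transform of the negative part has a pole at \<open>rate q\<close>, which forces \<open>q / (q - phi a)\<close> to
  blow up there.
\<close>

lemma phi_rate:
  assumes q: "0 < q"
  shows "phi (rate q) = q"
proof -
  define \<theta> where "\<theta> = rate q"
  define c where "c = tail q 0"
  have t: "0 < \<theta>" "0 < c" using tail_eq(1)[OF q] tail_0_pos[OF q] by (auto simp: \<theta>_def c_def)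
  define u where "u n = \<theta> * (1 - 1 / real (Suc n))" for n
  have u: "0 \<le> u n" "u n < \<theta>" for n
  proof -
    have "0 < 1 / real (Suc n)" "1 / real (Suc n) \<le> 1" by auto
    then show "0 \<le> u n" "u n < \<theta>" using t by (auto simp: u_def simp del: of_nat_Suc)
  qed
  have "u \<longlonglongrightarrow> \<theta> * (1 - 0)"
    unfolding u_def by (intro tendsto_intros LIMSEQ_Suc[OF lim_1_over_n])
  then have lim: "u \<longlonglongrightarrow> \<theta>" by simp
  have plim: "(\<lambda>n. phi (u n)) \<longlonglongrightarrow> phi \<theta>"
    by (rule continuous_on_tendsto_compose[OF continuous_on_phi lim]) (use t u in auto)
  have "phi \<theta> \<le> q"
    by (rule LIMSEQ_le_const2[OF plim])
       (use phi_less[OF q u(1)] u(2) in \<open>auto simp: \<theta>_def intro!: less_imp_le\<close>)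
  \<comment> \<open>The negative part alone bounds the transform from below. Cleared of
    denominators, the bound survives the passage to \<open>\<theta>\<close>.\<close>
  moreover have "(q - phi (u n)) * (c * \<theta>) \<le> q * (\<theta> - u n)" for n
  proof -
    have un: "u n < rate q" using u by (simp add: \<theta>_def)
    have l: "phi (u n) < q" by (rule phi_less[OF q u(1) un])
    have "ennreal (c * \<theta> / (\<theta> - u n)) \<le> (\<integral>\<^sup>+z. ennreal (exp (- u n * z)) \<partial>mu q)"
      unfolding c_def \<theta>_def nn_integral_exp_mu_negative[OF q un, symmetric]
      by (rule nn_integral_mono) (auto simp: indicator_def)
    also have "\<dots> = ennreal (q / (q - phi (u n)))"
      using nn_integral_exp_mu_eq[OF q u(1)] nn_integral_expo_exp[OF q l] by simp
    finally have "c * \<theta> / (\<theta> - u n) \<le> q / (q - phi (u n))" using q l by (subst (asm) ennreal_le_iff) auto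
    then show ?thesis using l u(2)[of n] by (simp add: field_simps)
  qed
  then have "(q - phi \<theta>) * (c * \<theta>) \<le> q * (\<theta> - \<theta>)"
    by (intro LIMSEQ_le[OF tendsto_mult[OF tendsto_diff[OF tendsto_const plim] tendsto_const]
        tendsto_mult[OF tendsto_const tendsto_diff[OF tendsto_const lim]]]) auto
  then have "q \<le> phi \<theta>" using t by (simp add: mult_le_0_iff)
  ultimately show ?thesis by (simp add: \<theta>_def)
qed

text \<open>\<open>phi\<close> need not be monotone near 0; comparing \<open>rate q\<close> with
  \<open>a\<close> on the segment from 0 to \<open>a\<close> by \<open>phi_star\<close>
  suffices.\<close>

lemma phi_greater:
  assumes q: "0 < q" and a: "rate q < a"
  shows "q < phi a"
proof -
  have t: "0 < rate q" by (rule tail_eq(1)[OF q])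
  have "phi (rate q / a * a) \<le> rate q / a * phi a"
    by (rule phi_star) (use t a in auto)
  then have "q * a \<le> rate q * phi a" using t a phi_rate[OF q] by (simp add: field_simps)
  moreover have "q * rate q < q * a" using q a by simp
  ultimately have "rate q * q < rate q * phi a" by (simp add: mult.commute)
  then show ?thesis using t by simp
qed

lemma phi_eq_iff: "0 < q \<Longrightarrow> 0 \<le> a \<Longrightarrow> phi a = q \<longleftrightarrow> a = rate q"
  using phi_less[of q a] phi_greater[of q a] phi_rate[of q] by (cases a "rate q" rule: linorder_cases) auto

lemma right_inverse_phi:
  assumes "0 < q"
  shows "right_inverse phi q = rate q"
proof -
  have "{a. 0 \<le> a \<and> phi a = q} = {rate q}"
    using phi_eq_iff[OF assms] tail_eq(1)[OF assms] by auto
  then show ?thesis by (simp add: right_inverse_def)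
qed

lemma rate_less_iff:
  assumes "0 < p" "0 < q"
  shows "rate p < rate q \<longleftrightarrow> p < q"
proof -
  have *: "rate p < rate q" if "0 < p" "0 < q" "p < q" for p q
    using phi_greater[of q "rate p"] phi_rate[of p] phi_rate[of q] that
    by (cases "rate p" "rate q" rule: linorder_cases) auto
  show ?thesis
    using *[of p q] *[of q p] assms by (cases p q rule: linorder_cases) auto
qed

end

section \<open>The resolvent equation\<close>

text \<open>The truncation at \<open>x\<close> keeps the integral finite even for
  \<open>a > l\<close>, so one expression serves on both sides of \<open>l\<close>.\<close>

lemma nn_integral_expo_exp_atMost:
  assumes l: "0 < l" and x: "0 \<le> x" and a: "a \<noteq> l"
  shows "(\<integral>\<^sup>+y. ennreal (exp (a * y)) * indicator {..x} y \<partial>expo l) = ennreal (l * (1 - exp ((a - l) * x)) / (l - a))"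
proof -
  let ?F = "\<lambda>y. l * exp ((a - l) * y) / (a - l)"
  have "(\<integral>\<^sup>+y. ennreal (exp (a * y)) * indicator {..x} y \<partial>expo l) =
      (\<integral>\<^sup>+y. ennreal (exponential_density l y) * (ennreal (exp (a * y)) * indicator {..x} y) \<partial>lborel)"
    by (rule nn_integral_expo) simp
  also have "\<dots> = (\<integral>\<^sup>+y. ennreal (l * exp ((a - l) * y)) * indicator {0..x} y \<partial>lborel)"
  proof (rule nn_integral_cong)
    fix y
    have "exp (- y * l) * exp (a * y) = exp ((a - l) * y)"
      by (simp add: exp_add[symmetric] algebra_simps)
    then show "ennreal (exponential_density l y) * (ennreal (exp (a * y)) * indicator {..x} y) =
        ennreal (l * exp ((a - l) * y)) * indicator {0..x} y"
      using l by (auto simp: exponential_density_def indicator_def ennreal_mult[symmetric] mult.assoc)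
  qed
  also have "\<dots> = ennreal (?F x - ?F 0)"
    by (rule nn_integral_FTC_Icc) (use a l x in \<open>auto intro!: derivative_eq_intros\<close>)
  also have "?F x - ?F 0 = l * (1 - exp ((a - l) * x)) / (l - a)"
    using a by (simp add: divide_simps) (simp add: algebra_simps)
  finally show ?thesis .
qed

text \<open>The sign matters for either order of \<open>a\<close> and \<open>b\<close>, because
  \<open>ennreal\<close> would turn a negative value into 0.\<close>

lemma exp_slope_nonneg:
  fixes a b x :: real
  assumes x: "0 \<le> x" and ab: "a \<noteq> b"
  shows "0 \<le> (exp (- a * x) - exp (- b * x)) / (b - a)"
proof (cases "a < b")
  case True
  then show ?thesis using x by (intro divide_nonneg_nonneg) (auto intro: mult_right_mono)
next
  case False
  then show ?thesis using x ab by (intro divide_nonpos_nonpos) (auto intro: mult_right_mono)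
qed

text \<open>Two competing clocks of rates \<open>q\<close> and \<open>r - q\<close> first ring at an
  exponential time of rate \<open>r\<close>. With probability \<open>q / r\<close> the ring is that
  of the \<open>q\<close>-clock; otherwise its remaining time is again exponential of rate
  \<open>q\<close>.\<close>

lemma expo_resolvent:
  assumes q: "0 < q" and qr: "q < r" and p[measurable]: "p \<in> borel_measurable borel"
  shows "(\<integral>\<^sup>+t. p t \<partial>expo q) = ennreal (q / r) * (\<integral>\<^sup>+t. p t \<partial>expo r) +
    ennreal (1 - q / r) * (\<integral>\<^sup>+s. (\<integral>\<^sup>+t. p (s + t) \<partial>expo q) \<partial>expo r)"
proof -
  have r: "0 < r" using q qr by simp
  interpret Q: prob_space "expo q" by (rule prob_space_expo[OF q])
  interpret Rr: prob_space "expo r" by (rule prob_space_expo[OF r])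
  interpret QR: pair_sigma_finite "expo q" "expo r" ..
  have tr: "(\<integral>\<^sup>+t. p (s + t) \<partial>expo q) = ennreal (exp (q * s)) * (\<integral>\<^sup>+w. p w * indicator {s..} w \<partial>expo q)"
    if s: "0 \<le> s" for s
  proof -
    have "(\<integral>\<^sup>+w. p w * indicator {s..} w \<partial>expo q) = (\<integral>\<^sup>+w. indicator {s..} w * (\<lambda>t. p (s + t)) (w - s) \<partial>expo q)"
      by (intro nn_integral_cong) (simp add: mult.commute)
    also have "\<dots> = ennreal (exp (- q * s)) * (\<integral>\<^sup>+t. p (s + t) \<partial>expo q)"
      by (rule nn_integral_expo_shift[OF q s]) simp
    finally show ?thesis
      by (simp add: mult.assoc[symmetric] ennreal_mult[symmetric] exp_add[symmetric])
  qed
  have inner: "(\<integral>\<^sup>+s. ennreal (exp (q * s)) * indicator {..w} s \<partial>expo r) = ennreal (r / (r - q) * (1 - exp (- (r - q) * w)))"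
    if w: "0 \<le> w" for w
    using nn_integral_expo_exp_atMost[OF r w, of q] qr by (simp add: field_simps)
  have "(\<integral>\<^sup>+s. (\<integral>\<^sup>+t. p (s + t) \<partial>expo q) \<partial>expo r) =
      (\<integral>\<^sup>+s. (\<integral>\<^sup>+w. p w * (ennreal (exp (q * s)) * indicator {..w} s) \<partial>expo q) \<partial>expo r)"
  proof (rule nn_integral_cong_AE, rule AE_mp[OF AE_expo_pos[OF r]], rule AE_I2, rule impI)
    fix s :: real assume s: "0 < s"
    have "(\<integral>\<^sup>+w. p w * (ennreal (exp (q * s)) * indicator {..w} s) \<partial>expo q) =
        (\<integral>\<^sup>+w. ennreal (exp (q * s)) * (p w * indicator {s..} w) \<partial>expo q)"
      by (intro nn_integral_cong) (simp add: indicator_def mult.commute)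
    also have "\<dots> = (\<integral>\<^sup>+t. p (s + t) \<partial>expo q)"
      using s by (subst nn_integral_cmult) (simp_all add: tr)
    finally show "(\<integral>\<^sup>+t. p (s + t) \<partial>expo q) = (\<integral>\<^sup>+w. p w * (ennreal (exp (q * s)) * indicator {..w} s) \<partial>expo q)" by simp
  qed
  also have "\<dots> = (\<integral>\<^sup>+w. (\<integral>\<^sup>+s. p w * (ennreal (exp (q * s)) * indicator {..w} s) \<partial>expo r) \<partial>expo q)"
    by (rule QR.Fubini') (simp add: indicator_def)
  also have "\<dots> = (\<integral>\<^sup>+w. p w * ennreal (r / (r - q) * (1 - exp (- (r - q) * w))) \<partial>expo q)"
    by (rule nn_integral_cong_AE, rule AE_mp[OF AE_expo_pos[OF q]], rule AE_I2, rule impI,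
        subst nn_integral_cmult) (simp_all add: inner)
  finally have "ennreal (1 - q / r) * (\<integral>\<^sup>+s. (\<integral>\<^sup>+t. p (s + t) \<partial>expo q) \<partial>expo r) =
      (\<integral>\<^sup>+w. ennreal (1 - q / r) * (p w * ennreal (r / (r - q) * (1 - exp (- (r - q) * w)))) \<partial>expo q)"
    by (simp add: nn_integral_cmult)
  also have "\<dots> = (\<integral>\<^sup>+w. p w * ennreal (1 - exp (- (r - q) * w)) \<partial>expo q)"
  proof (rule nn_integral_cong_AE, rule AE_mp[OF AE_expo_pos[OF q]], rule AE_I2, rule impI)
    fix w :: real assume w: "0 < w"
    have "(1 - q / r) * (r / (r - q) * (1 - exp (- (r - q) * w))) = 1 - exp (- (r - q) * w)"
      using r qr by (simp add: field_simps)
    moreover have "0 \<le> 1 - exp (- (r - q) * w)" "0 \<le> 1 - q / r"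
      using w qr r mult_nonpos_nonneg[of "q - r" w] by auto
    ultimately have "ennreal (1 - q / r) * ennreal (r / (r - q) * (1 - exp (- (r - q) * w))) = ennreal (1 - exp (- (r - q) * w))"
      by (simp only: ennreal_mult'[symmetric])
    then show "ennreal (1 - q / r) * (p w * ennreal (r / (r - q) * (1 - exp (- (r - q) * w)))) = p w * ennreal (1 - exp (- (r - q) * w))"
      by (metis mult.left_commute)
  qed
  \<comment> \<open>Relative to \<open>expo q\<close>, this term and the one in \<open>I\<close>
    have the densities \<open>1 - exp (- (r - q) * w)\<close> and
    \<open>exp (- (r - q) * w)\<close>, which add up to 1.\<close>
  finally have J: "ennreal (1 - q / r) * (\<integral>\<^sup>+s. (\<integral>\<^sup>+t. p (s + t) \<partial>expo q) \<partial>expo r) =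
    (\<integral>\<^sup>+w. p w * ennreal (1 - exp (- (r - q) * w)) \<partial>expo q)" .
  have I: "ennreal (q / r) * (\<integral>\<^sup>+t. p t \<partial>expo r) = (\<integral>\<^sup>+w. ennreal (exp (- (r - q) * w)) * p w \<partial>expo q)"
    using nn_integral_expo_tilt[OF q, of "- (r - q)" p] qr r by simp
  show ?thesis unfolding I J
  proof (subst nn_integral_add[symmetric])
    show "(\<integral>\<^sup>+t. p t \<partial>expo q) = (\<integral>\<^sup>+w. ennreal (exp (- (r - q) * w)) * p w + p w * ennreal (1 - exp (- (r - q) * w)) \<partial>expo q)"
    proof (rule nn_integral_cong_AE, rule AE_mp[OF AE_expo_pos[OF q]], rule AE_I2, rule impI)
      fix w :: real assume "0 < w"
      then have "0 \<le> 1 - exp (- (r - q) * w)" using qr mult_nonpos_nonneg[of "q - r" w] by simp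
      then have "ennreal (exp (- (r - q) * w)) + ennreal (1 - exp (- (r - q) * w)) = 1"
        by (subst ennreal_plus[symmetric]) auto
      then show "p w = ennreal (exp (- (r - q) * w)) * p w + p w * ennreal (1 - exp (- (r - q) * w))"
        by (metis distrib_left mult.commute mult.right_neutral)
    qed
  qed auto
qed

context spectrally_positive_levy
begin

lemma mu_resolvent:
  assumes q: "0 < q" and qr: "q < r" and h[measurable]: "h \<in> borel_measurable borel"
  shows "(\<integral>\<^sup>+z. h z \<partial>mu q) = ennreal (q / r) * (\<integral>\<^sup>+z. h z \<partial>mu r) +
    ennreal (1 - q / r) * (\<integral>\<^sup>+x. (\<integral>\<^sup>+z. h (x + z) \<partial>mu q) \<partial>mu r)"
proof -
  have r: "0 < r" using q qr by simp
  interpret Q: prob_space "expo q" by (rule prob_space_expo[OF q])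
  interpret MQ: pair_sigma_finite M "expo q" ..
  have "(\<integral>\<^sup>+x. (\<integral>\<^sup>+z. h (x + z) \<partial>mu q) \<partial>mu r) = (\<integral>\<^sup>+s. (\<integral>\<^sup>+x. (\<integral>\<^sup>+z. h (X s x + z) \<partial>mu q) \<partial>M) \<partial>expo r)"
  proof (rule nn_integral_mu)
    interpret mu: prob_space "mu q" by (rule prob_space_mu[OF q])
    show "(\<lambda>x. \<integral>\<^sup>+z. h (x + z) \<partial>mu q) \<in> borel_measurable borel" by measurable
  qed
  also have "\<dots> = (\<integral>\<^sup>+s. (\<integral>\<^sup>+x. (\<integral>\<^sup>+t. (\<integral>\<^sup>+y. h (X s x + X t y) \<partial>M) \<partial>expo q) \<partial>M) \<partial>expo r)"
    by (simp add: nn_integral_mu)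
  also have "\<dots> = (\<integral>\<^sup>+s. (\<integral>\<^sup>+t. (\<integral>\<^sup>+x. (\<integral>\<^sup>+y. h (X s x + X t y) \<partial>M) \<partial>M) \<partial>expo q) \<partial>expo r)"
    by (intro nn_integral_cong MQ.Fubini'[symmetric]) measurable
  also have "\<dots> = (\<integral>\<^sup>+s. (\<integral>\<^sup>+t. (\<integral>\<^sup>+x. h (X (s + t) x) \<partial>M) \<partial>expo q) \<partial>expo r)"
  proof (rule nn_integral_cong_AE, rule AE_mp[OF AE_expo_pos[OF r]], rule AE_I2, rule impI)
    fix s :: real assume s: "0 < s"
    show "(\<integral>\<^sup>+t. (\<integral>\<^sup>+x. (\<integral>\<^sup>+y. h (X s x + X t y) \<partial>M) \<partial>M) \<partial>expo q) = (\<integral>\<^sup>+t. (\<integral>\<^sup>+x. h (X (s + t) x) \<partial>M) \<partial>expo q)"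
    proof (rule nn_integral_cong_AE, rule AE_mp[OF AE_expo_pos[OF q]], rule AE_I2, rule impI)
      fix t :: real assume "0 < t"
      then show "(\<integral>\<^sup>+x. (\<integral>\<^sup>+y. h (X s x + X t y) \<partial>M) \<partial>M) = (\<integral>\<^sup>+x. h (X (s + t) x) \<partial>M)"
        using s by (subst nn_integral_X_semigroup) auto
    qed
  qed
  finally have J: "(\<integral>\<^sup>+x. (\<integral>\<^sup>+z. h (x + z) \<partial>mu q) \<partial>mu r) =
    (\<integral>\<^sup>+s. (\<integral>\<^sup>+t. (\<integral>\<^sup>+x. h (X (s + t) x) \<partial>M) \<partial>expo q) \<partial>expo r)" .
  show ?thesis unfolding J nn_integral_mu[OF h]
    by (rule expo_resolvent[OF q qr]) measurable
qed

section \<open>The transform of the nonnegative part of a step\<close>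

text \<open>The restriction to \<open>{0..}\<close> keeps the transform finite for every
  \<open>a \<ge> 0\<close>, also beyond \<open>rate q\<close>.\<close>

definition K :: "real \<Rightarrow> real \<Rightarrow> real" where
  "K q a = (\<integral>z. indicator {0..} z * exp (- a * z) \<partial>mu q)"

lemma integrable_K:
  assumes "0 < q" "0 \<le> a"
  shows "integrable (mu q) (\<lambda>z. indicator {0..} z * exp (- a * z))"
proof -
  interpret mu: prob_space "mu q" by (rule prob_space_mu) fact
  show ?thesis
    by (rule mu.integrable_const_bound[where B=1]) (use assms in \<open>auto simp: indicator_def\<close>)
qed

lemma K_nonneg: "0 \<le> K q a"
  unfolding K_def by (rule Bochner_Integration.integral_nonneg) (simp add: indicator_def)

lemma nn_integral_K:
  assumes "0 < q" "0 \<le> a"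
  shows "(\<integral>\<^sup>+z. ennreal (indicator {0..} z * exp (- a * z)) \<partial>mu q) = ennreal (K q a)"
  unfolding K_def by (rule nn_integral_eq_integral[OF integrable_K[OF assms]]) (simp add: indicator_def)

lemma K_diff:
  assumes q: "0 < q" and a: "0 \<le> a" "0 \<le> b" "a \<noteq> b" and c: "0 \<le> c"
  shows "(\<integral>\<^sup>+z. ennreal (indicator {0..} z * (c * (exp (- a * z) - exp (- b * z)) / (b - a))) \<partial>mu q) =
      ennreal (c * (K q a - K q b) / (b - a))"
    and "0 \<le> c * (K q a - K q b) / (b - a)"
proof -
  let ?f = "\<lambda>z. indicator {0..} z * (c * (exp (- a * z) - exp (- b * z)) / (b - a))"
  have eq: "?f = (\<lambda>z. c / (b - a) * (indicator {0..} z * exp (- a * z) - indicator {0..} z * exp (- b * z)))"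
    by (auto simp: fun_eq_iff indicator_def)
  have int: "integrable (mu q) ?f"
    unfolding eq by (intro integrable_mult_right Bochner_Integration.integrable_diff integrable_K q a)
  have nn: "0 \<le> ?f z" for z
    using exp_slope_nonneg[of z a b] a c mult_nonneg_nonneg[of c "(exp (- a * z) - exp (- b * z)) / (b - a)"]
    by (simp add: indicator_def)
  have val: "(\<integral>z. ?f z \<partial>mu q) = c * (K q a - K q b) / (b - a)"
  proof -
    have "(\<integral>z. ?f z \<partial>mu q) =
        c / (b - a) * (\<integral>z. indicator {0..} z * exp (- a * z) - indicator {0..} z * exp (- b * z) \<partial>mu q)"
      unfolding eq by (rule integral_mult_right_zero)
    also have "(\<integral>z. indicator {0..} z * exp (- a * z) - indicator {0..} z * exp (- b * z) \<partial>mu q) = K q a - K q b"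
      unfolding K_def by (rule Bochner_Integration.integral_diff) (intro integrable_K q a)+
    finally show ?thesis by simp
  qed
  have "(\<integral>\<^sup>+z. ennreal (?f z) \<partial>mu q) = ennreal (\<integral>z. ?f z \<partial>mu q)"
    by (rule nn_integral_eq_integral[OF int]) (simp only: nn AE_I2)
  then show "(\<integral>\<^sup>+z. ennreal (?f z) \<partial>mu q) = ennreal (c * (K q a - K q b) / (b - a))"
    unfolding val .
  have "0 \<le> (\<integral>z. ?f z \<partial>mu q)" by (rule Bochner_Integration.integral_nonneg) (rule nn)
  then show "0 \<le> c * (K q a - K q b) / (b - a)" unfolding val .
qed

text \<open>On the negative half-line \<open>mu q\<close> has the density
  \<open>neg q * exp (rate q * z)\<close>. Hence \<open>neg q / (rate q - a)\<close> is the
  transform of that part for \<open>a < rate q\<close>, and its continuation for larger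
  \<open>a\<close>.\<close>

abbreviation "neg q \<equiv> tail q 0 * rate q"

lemma neg_nonneg: "0 < q \<Longrightarrow> 0 \<le> neg q"
  using tail_bounds(1)[of q 0] tail_eq(1)[of q] by simp

text \<open>The indicator cuts the negative step off at \<open>- x\<close>, which makes the value
  finite also for \<open>a > rate q\<close>.\<close>

lemma shifted_negative:
  assumes q: "0 < q" and x: "0 \<le> x" and a: "a \<noteq> rate q"
  shows "(\<integral>\<^sup>+z. ennreal (indicator {0..} (x + z) * exp (- a * (x + z))) * indicator {..<0} z \<partial>mu q) =
    ennreal (neg q * (exp (- a * x) - exp (- rate q * x)) / (rate q - a))"
proof -
  have t: "0 < rate q" by (rule tail_eq(1)[OF q])
  have "(\<integral>\<^sup>+z. ennreal (indicator {0..} (x + z) * exp (- a * (x + z))) * indicator {..<0} z \<partial>mu q) =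
      ennreal (tail q 0) * (\<integral>\<^sup>+y. ennreal (indicator {0..} (x + - y) * exp (- a * (x + - y))) \<partial>expo (rate q))"
    by (rule nn_integral_mu_negative[OF q]) simp
  also have "(\<integral>\<^sup>+y. ennreal (indicator {0..} (x + - y) * exp (- a * (x + - y))) \<partial>expo (rate q)) =
      (\<integral>\<^sup>+y. ennreal (exp (- a * x)) * (ennreal (exp (a * y)) * indicator {..x} y) \<partial>expo (rate q))"
  proof (rule nn_integral_cong)
    fix y
    have "exp (- a * (x + - y)) = exp (- a * x) * exp (a * y)" by (simp add: exp_add[symmetric] algebra_simps)
    then show "ennreal (indicator {0..} (x + - y) * exp (- a * (x + - y))) = ennreal (exp (- a * x)) * (ennreal (exp (a * y)) * indicator {..x} y)"
      by (simp add: indicator_def ennreal_mult)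
  qed
  also have "\<dots> = ennreal (exp (- a * x)) * ennreal (rate q * (1 - exp ((a - rate q) * x)) / (rate q - a))"
    by (subst nn_integral_cmult, measurable) (simp only: nn_integral_expo_exp_atMost[OF t x a])
  also have "\<dots> = ennreal (exp (- a * x) * (rate q * (1 - exp ((a - rate q) * x)) / (rate q - a)))"
    by (simp only: ennreal_mult'[OF exp_ge_zero])
  also have "ennreal (tail q 0) * \<dots> = ennreal (tail q 0 * (exp (- a * x) * (rate q * (1 - exp ((a - rate q) * x)) / (rate q - a))))"
    by (simp only: ennreal_mult'[OF tail_bounds(1)[OF q]])
  also have "tail q 0 * (exp (- a * x) * (rate q * (1 - exp ((a - rate q) * x)) / (rate q - a))) =
      neg q * (exp (- a * x) - exp (- a * x) * exp ((a - rate q) * x)) / (rate q - a)"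
    by (simp add: algebra_simps diff_divide_distrib)
  also have "exp (- a * x) * exp ((a - rate q) * x) = exp (- rate q * x)"
    by (simp add: exp_add[symmetric] algebra_simps)
  finally show ?thesis .
qed

lemma shifted_negative_nonneg:
  assumes q: "0 < q" and x: "0 \<le> x" and a: "a \<noteq> rate q"
  shows "0 \<le> neg q * (exp (- a * x) - exp (- rate q * x)) / (rate q - a)"
  using mult_nonneg_nonneg[OF neg_nonneg[OF q] exp_slope_nonneg[OF x a]] by simp

lemma shifted_laplace:
  assumes q: "0 < q" and x: "0 \<le> x" and a: "0 \<le> a" "a \<noteq> rate q"
  shows "(\<integral>\<^sup>+z. ennreal (indicator {0..} (x + z) * exp (- a * (x + z))) \<partial>mu q) =
    ennreal (exp (- a * x) * K q a + neg q * (exp (- a * x) - exp (- rate q * x)) / (rate q - a))"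
proof -
  have "(\<integral>\<^sup>+z. ennreal (indicator {0..} (x + z) * exp (- a * (x + z))) * indicator {0..} z \<partial>mu q) =
      (\<integral>\<^sup>+z. ennreal (exp (- a * x)) * ennreal (indicator {0..} z * exp (- a * z)) \<partial>mu q)"
  proof (rule nn_integral_cong)
    fix z
    have "exp (- a * (x + z)) = exp (- a * x) * exp (- a * z)" by (simp add: exp_add[symmetric] algebra_simps)
    then show "ennreal (indicator {0..} (x + z) * exp (- a * (x + z))) * indicator {0..} z =
        ennreal (exp (- a * x)) * ennreal (indicator {0..} z * exp (- a * z))"
      using x by (simp add: indicator_def ennreal_mult)
  qed
  also have "\<dots> = ennreal (exp (- a * x) * K q a)"
    by (subst nn_integral_cmult, measurable) (simp only: nn_integral_K[OF q a(1)] ennreal_mult K_nonneg exp_ge_zero)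
  finally show ?thesis
    by (subst nn_integral_mu_split, measurable)
       (simp only: shifted_negative[OF q x a(2)] shifted_negative_nonneg[OF q x a(2)] ennreal_plus
         K_nonneg mult_nonneg_nonneg exp_ge_zero)
qed

lemma resolvent_positive_part:
  assumes q: "0 < q" and r: "0 < r" and a: "0 \<le> a" "a \<noteq> rate q"
  shows "(\<integral>\<^sup>+x. (\<integral>\<^sup>+z. ennreal (indicator {0..} (x + z) * exp (- a * (x + z))) \<partial>mu q) * indicator {0..} x \<partial>mu r) =
    ennreal (K r a * K q a) + ennreal (neg q * (K r a - K r (rate q)) / (rate q - a))"
proof -
  let ?b = "\<lambda>x. neg q * (exp (- a * x) - exp (- rate q * x)) / (rate q - a)"
  have "(\<integral>\<^sup>+x. (\<integral>\<^sup>+z. ennreal (indicator {0..} (x + z) * exp (- a * (x + z))) \<partial>mu q) * indicator {0..} x \<partial>mu r) =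
      (\<integral>\<^sup>+x. ennreal (K q a) * ennreal (indicator {0..} x * exp (- a * x)) + ennreal (indicator {0..} x * ?b x) \<partial>mu r)"
  proof (rule nn_integral_cong)
    fix x :: real
    show "(\<integral>\<^sup>+z. ennreal (indicator {0..} (x + z) * exp (- a * (x + z))) \<partial>mu q) * indicator {0..} x =
        ennreal (K q a) * ennreal (indicator {0..} x * exp (- a * x)) + ennreal (indicator {0..} x * ?b x)"
    proof (cases "0 \<le> x")
      case True
      have "ennreal (exp (- a * x) * K q a + ?b x) = ennreal (K q a * exp (- a * x)) + ennreal (?b x)"
        using shifted_negative_nonneg[OF q True a(2)] K_nonneg[of q a]
        by (subst ennreal_plus) (simp_all add: mult.commute[of "K q a"])
      also have "ennreal (K q a * exp (- a * x)) = ennreal (K q a) * ennreal (exp (- a * x))"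
        by (rule ennreal_mult) (simp_all add: K_nonneg)
      finally show ?thesis
        unfolding shifted_laplace[OF q True a] using True by simp
    qed simp
  qed
  also have "\<dots> = ennreal (K q a) * (\<integral>\<^sup>+x. ennreal (indicator {0..} x * exp (- a * x)) \<partial>mu r) +
      (\<integral>\<^sup>+x. ennreal (indicator {0..} x * ?b x) \<partial>mu r)"
    by (subst nn_integral_add, measurable, subst nn_integral_cmult, measurable)
  also have "(\<integral>\<^sup>+x. ennreal (indicator {0..} x * ?b x) \<partial>mu r) = ennreal (neg q * (K r a - K r (rate q)) / (rate q - a))"
    by (rule K_diff(1)) (use r a tail_eq(1)[OF q] neg_nonneg[OF q] in auto)
  also have "(\<integral>\<^sup>+x. ennreal (indicator {0..} x * exp (- a * x)) \<partial>mu r) = ennreal (K r a)"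
    by (rule nn_integral_K[OF r a(1)])
  also have "ennreal (K q a) * ennreal (K r a) = ennreal (K r a * K q a)"
    by (subst mult.commute, rule ennreal_mult[symmetric]) (simp_all add: K_nonneg)
  finally show ?thesis .
qed

text \<open>A negative \<open>x\<close> must be compensated by a nonnegative \<open>z\<close>. After
  exchanging the integrals, \<open>z\<close> is the starting point and \<open>x\<close> the negative
  step, so \<open>shifted_negative\<close> applies with \<open>r\<close> in place of
  \<open>q\<close>; two negative steps contribute nothing.\<close>

lemma resolvent_negative_part:
  assumes q: "0 < q" and r: "0 < r" and a: "0 \<le> a" "a \<noteq> rate r"
  shows "(\<integral>\<^sup>+x. (\<integral>\<^sup>+z. ennreal (indicator {0..} (x + z) * exp (- a * (x + z))) \<partial>mu q) * indicator {..<0} x \<partial>mu r) =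
    ennreal (neg r * (K q a - K q (rate r)) / (rate r - a))"
proof -
  let ?h = "\<lambda>z. ennreal (indicator {0..} z * exp (- a * z))"
  interpret Q: prob_space "mu q" by (rule prob_space_mu[OF q])
  interpret Rr: prob_space "mu r" by (rule prob_space_mu[OF r])
  interpret QR: pair_sigma_finite "mu q" "mu r" ..
  have "(\<integral>\<^sup>+x. (\<integral>\<^sup>+z. ?h (x + z) \<partial>mu q) * indicator {..<0} x \<partial>mu r) =
      (\<integral>\<^sup>+x. (\<integral>\<^sup>+z. ?h (x + z) * indicator {..<0} x \<partial>mu q) \<partial>mu r)"
    by (intro nn_integral_cong nn_integral_multc[symmetric]) simp
  also have "\<dots> = (\<integral>\<^sup>+z. (\<integral>\<^sup>+x. ?h (x + z) * indicator {..<0} x \<partial>mu r) \<partial>mu q)"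
  proof (rule QR.Fubini')
    have "(\<lambda>p. ?h (snd p + fst p) * indicator {..<0} (snd p)) \<in> borel_measurable (borel \<Otimes>\<^sub>M borel)"
      by measurable
    then show "(\<lambda>(z, x). ?h (x + z) * indicator {..<0} x) \<in> borel_measurable (mu q \<Otimes>\<^sub>M mu r)"
      by (simp add: case_prod_unfold cong: measurable_cong_sets)
  qed
  also have "\<dots> = (\<integral>\<^sup>+z. ennreal (indicator {0..} z * (neg r * (exp (- a * z) - exp (- rate r * z)) / (rate r - a))) \<partial>mu q)"
  proof (rule nn_integral_cong)
    fix z :: real
    show "(\<integral>\<^sup>+x. ?h (x + z) * indicator {..<0} x \<partial>mu r) =
      ennreal (indicator {0..} z * (neg r * (exp (- a * z) - exp (- rate r * z)) / (rate r - a)))"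
    proof (cases "0 \<le> z")
      case True
      have "(\<integral>\<^sup>+x. ?h (x + z) * indicator {..<0} x \<partial>mu r) = (\<integral>\<^sup>+x. ?h (z + x) * indicator {..<0} x \<partial>mu r)"
        by (simp only: add.commute)
      also have "\<dots> = ennreal (neg r * (exp (- a * z) - exp (- rate r * z)) / (rate r - a))"
        by (rule shifted_negative[OF r True a(2)])
      finally show ?thesis using True by simp
    next
      case False
      then have "(\<integral>\<^sup>+x. ?h (x + z) * indicator {..<0} x \<partial>mu r) = (\<integral>\<^sup>+x. 0 \<partial>mu r)"
        by (intro nn_integral_cong) (auto simp: indicator_def)
      then show ?thesis using False by simp
    qed
  qed
  also have "\<dots> = ennreal (neg r * (K q a - K q (rate r)) / (rate r - a))"
    by (rule K_diff(1)) (use q a tail_eq(1)[OF r] neg_nonneg[OF r] in auto)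
  finally show ?thesis .
qed

text \<open>For the truncated exponential all terms of the resolvent equation are finite, wherever
  \<open>a\<close> lies relative to the two rates. Where \<open>K r\<close> is known, this is a
  linear equation for \<open>K q a\<close>.\<close>

lemma K_resolvent:
  assumes q: "0 < q" and qr: "q < r" and a: "0 \<le> a" "a \<noteq> rate q" "a \<noteq> rate r"
  shows "K q a = q / r * K r a + (1 - q / r) * (K r a * K q a +
    neg q * (K r a - K r (rate q)) / (rate q - a) + neg r * (K q a - K q (rate r)) / (rate r - a))"
proof -
  have r: "0 < r" using q qr by simp
  interpret Q: prob_space "mu q" by (rule prob_space_mu[OF q])
  let ?h = "\<lambda>z. ennreal (indicator {0..} z * exp (- a * z))"
  define A where "A = K r a * K q a"
  define B where "B = neg q * (K r a - K r (rate q)) / (rate q - a)"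
  define C where "C = neg r * (K q a - K q (rate r)) / (rate r - a)"
  have A0: "0 \<le> A" by (simp add: A_def K_nonneg)
  have B0: "0 \<le> B" unfolding B_def
    by (rule K_diff(2)) (use r a tail_eq(1)[OF q] neg_nonneg[OF q] in auto)
  have C0: "0 \<le> C" unfolding C_def
    by (rule K_diff(2)) (use q a tail_eq(1)[OF r] neg_nonneg[OF r] in auto)
  have "(\<integral>\<^sup>+x. (\<integral>\<^sup>+z. ?h (x + z) \<partial>mu q) \<partial>mu r) =
      (\<integral>\<^sup>+x. (\<integral>\<^sup>+z. ?h (x + z) \<partial>mu q) * indicator {0..} x \<partial>mu r) +
      (\<integral>\<^sup>+x. (\<integral>\<^sup>+z. ?h (x + z) \<partial>mu q) * indicator {..<0} x \<partial>mu r)"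
  proof (rule nn_integral_mu_split)
    have "(\<lambda>p. ?h (fst p + snd p)) \<in> borel_measurable (borel \<Otimes>\<^sub>M borel)" by measurable
    then have "(\<lambda>(x, z). ?h (x + z)) \<in> borel_measurable (borel \<Otimes>\<^sub>M mu q)"
      by (simp add: case_prod_unfold cong: measurable_cong_sets)
    from Q.borel_measurable_nn_integral[OF this]
    show "(\<lambda>x. \<integral>\<^sup>+z. ?h (x + z) \<partial>mu q) \<in> borel_measurable borel" .
  qed
  then have J: "(\<integral>\<^sup>+x. (\<integral>\<^sup>+z. ?h (x + z) \<partial>mu q) \<partial>mu r) = ennreal A + ennreal B + ennreal C"
    unfolding resolvent_positive_part[OF q r a(1,2)] resolvent_negative_part[OF q r a(1,3)] A_def B_def C_def .
  have "(\<integral>\<^sup>+z. ?h z \<partial>mu q) = ennreal (q / r) * (\<integral>\<^sup>+z. ?h z \<partial>mu r) +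
      ennreal (1 - q / r) * (\<integral>\<^sup>+x. (\<integral>\<^sup>+z. ?h (x + z) \<partial>mu q) \<partial>mu r)"
    by (rule mu_resolvent[OF q qr]) simp
  then have "ennreal (K q a) = ennreal (q / r) * ennreal (K r a) +
      ennreal (1 - q / r) * (ennreal A + ennreal B + ennreal C)"
    unfolding J nn_integral_K[OF q a(1)] nn_integral_K[OF r a(1)] .
  also have "\<dots> = ennreal (q / r) * ennreal (K r a) + ennreal (1 - q / r) * ennreal (A + B + C)"
    using A0 B0 C0 by (simp only: ennreal_plus add_nonneg_nonneg)
  also have "\<dots> = ennreal (q / r * K r a) + ennreal ((1 - q / r) * (A + B + C))"
    using q qr r by (simp only: ennreal_mult' divide_nonneg_nonneg less_imp_le diff_ge_0_iff_ge divide_le_eq_1_pos)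
  also have "\<dots> = ennreal (q / r * K r a + (1 - q / r) * (A + B + C))"
    using A0 B0 C0 q qr r K_nonneg[of r a] by (subst ennreal_plus) (auto intro!: mult_nonneg_nonneg)
  finally have "K q a = q / r * K r a + (1 - q / r) * (A + B + C)"
    using A0 B0 C0 q qr r K_nonneg[of r a] K_nonneg[of q a]
    by (subst (asm) ennreal_inj) (auto intro!: add_nonneg_nonneg mult_nonneg_nonneg)
  then show ?thesis by (simp add: A_def B_def C_def)
qed

lemma K_small:
  assumes q: "0 < q" and a: "0 \<le> a" "a < rate q"
  shows "K q a + neg q / (rate q - a) = q / (q - phi a)"
proof -
  have l: "phi a < q" by (rule phi_less[OF q a])
  have nn: "0 \<le> neg q / (rate q - a)" using neg_nonneg[OF q] a by simp
  have "ennreal (q / (q - phi a)) = (\<integral>\<^sup>+z. ennreal (exp (- a * z)) \<partial>mu q)"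
    using nn_integral_exp_mu_eq[OF q a(1)] nn_integral_expo_exp[OF q l] by simp
  also have "\<dots> = (\<integral>\<^sup>+z. ennreal (indicator {0..} z * exp (- a * z)) \<partial>mu q) + ennreal (neg q / (rate q - a))"
  proof -
    have e: "ennreal (exp (- a * z)) * indicator {0..} z = ennreal (indicator {0..} z * exp (- a * z))" for z :: real
      by (simp add: indicator_def)
    show ?thesis
      by (subst nn_integral_mu_split, measurable) (simp only: nn_integral_exp_mu_negative[OF q a(2)] e)
  qed
  also have "\<dots> = ennreal (K q a + neg q / (rate q - a))"
    using nn K_nonneg by (simp only: nn_integral_K[OF q a(1)] ennreal_plus)
  finally show ?thesis using l q nn K_nonneg[of q a] by (subst (asm) ennreal_inj) auto
qed

text \<open>
  Beyond \<open>rate q\<close> the resolvent equation, with \<open>r\<close> so large that \<open>a < rate r\<close>, gives the claim up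
  to a term proportional to a constant \<open>D\<close> independent of \<open>a\<close>; the case \<open>a = 0\<close> shows \<open>D = 0\<close>.
\<close>

lemma K_formula:
  assumes q: "0 < q" and a: "0 \<le> a" "a \<noteq> rate q"
  shows "K q a + neg q / (rate q - a) = q / (q - phi a)"
proof (cases "a < rate q")
  case True
  then show ?thesis by (rule K_small[OF q a(1)])
next
  case False
  then have ga: "rate q < a" using a by simp
  obtain r where r: "q < r" "a < rate r" using rate_unbounded[of q a] by auto
  have r0: "0 < r" using q r by simp
  note tq = tail_eq(1)[OF q]
  have qr: "rate q < rate r" using ga r by simp
  have Kr: "K r b = r / (r - phi b) - neg r / (rate r - b)" if "0 \<le> b" "b < rate r" for b
    using K_small[OF r0 that] by simp
  \<comment> \<open>Since \<open>phi (rate r) = r\<close>, this is minus the defect of the claimed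
    formula at the point \<open>rate r\<close>.\<close>
  define D where "D = neg q / (rate r - rate q) - q / (r - q) - K q (rate r)"
  have main: "(K q b + neg q / (rate q - b)) * (q - phi b) = q + neg r / (rate r - b) * ((1 - q / r) * D) * (r - phi b)"
    if b: "0 \<le> b" "b < rate r" "b \<noteq> rate q" for b
  proof -
    define s where "s = rate q - b"
    define t where "t = rate r - b"
    have st: "s \<noteq> 0" "t \<noteq> 0" "rate r - rate q = t - s" "t \<noteq> s" using b qr by (auto simp: s_def t_def)
    define f where "f = r - phi b"
    have f: "f \<noteq> 0" using phi_less[OF r0 b(1,2)] by (simp add: f_def)
    have Krb: "K r b = r / f - neg r / t" using Kr[OF b(1,2)] by (simp add: f_def t_def)
    have Krq: "K r (rate q) = r / (r - q) - neg r / (t - s)"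
      using Kr[of "rate q"] qr tq phi_rate[OF q] st(3) by simp
    have "K q b = q / r * K r b + (1 - q / r) * (K r b * K q b + neg q * (K r b - K r (rate q)) / s + neg r * (K q b - K q (rate r)) / t)"
      using K_resolvent[OF q r(1) b(1,3)] b by (simp add: s_def t_def)
    then have "K q b = q / r * (r / f - neg r / t) + (1 - q / r) * ((r / f - neg r / t) * K q b
        + neg q * (r / f - neg r / t - (r / (r - q) - neg r / (t - s))) / s + neg r * (K q b - K q (rate r)) / t)"
      unfolding Krb Krq .
    moreover define k where "k = K q b"
    moreover define m where "m = K q (rate r)"
    moreover define n where "n = neg q"
    moreover define n' where "n' = neg r"
    moreover define d where "d = r - q"
    ultimately have e: "k = q / r * (r / f - n' / t) + (d / r) * ((r / f - n' / t) * k
        + n * (r / f - n' / t - (r / d - n' / (t - s))) / s + n' * (k - m) / t)"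
      using r0 by (simp add: diff_divide_distrib)
    have nz: "r \<noteq> 0" "d \<noteq> 0" "t - s \<noteq> 0" using r0 r st by (auto simp: d_def)
    have q': "q = r - d" by (simp add: d_def)
    have g: "q - phi b = f - d" by (simp add: f_def d_def)
    \<comment> \<open>The relation is multiplied by \<open>f\<close>; the products of
      \<open>n\<close> and \<open>n'\<close> then combine through the partial fraction
      \<open>1 / (t - s) - 1 / t\<close>.\<close>
    have "(k + n / s) * (f - d) = q + n' / t * ((d / r) * (n / (t - s) - q / d - m)) * f"
    proof -
      have "k * f = f * (q / r * (r / f - n' / t) + (d / r) * ((r / f - n' / t) * k
        + n * (r / f - n' / t - (r / d - n' / (t - s))) / s + n' * (k - m) / t))"
        using e by (metis mult.commute)
      also have "\<dots> = q - q * f * n' / (r * t) + d * k + n * d / s - n * f / s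
          + (d / r) * f * n * n' * (1 / (t - s) - 1 / t) / s - (d / r) * f * n' * m / t"
        using nz f st by (simp add: field_simps)
      also have "1 / (t - s) - 1 / t = s / (t * (t - s))"
        using nz st by (simp add: field_simps)
      also have "(d / r) * f * n * n' * (s / (t * (t - s))) / s = (d / r) * f * n * n' / (t * (t - s))"
        using st by simp
      finally have "k * f = q - q * f * n' / (r * t) + d * k + n * d / s - n * f / s
          + (d / r) * f * n * n' / (t * (t - s)) - (d / r) * f * n' * m / t" .
      then have "(k + n / s) * (f - d) = q - q * f * n' / (r * t)
          + (d / r) * f * n * n' / (t * (t - s)) - (d / r) * f * n' * m / t"
        by (simp add: algebra_simps diff_divide_distrib)
      also have "\<dots> = q + n' / t * ((d / r) * (n / (t - s) - q / d - m)) * f"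
        using nz st by (simp add: field_simps)
      finally show ?thesis .
    qed
    moreover have "1 - q / r = d / r" using r0 by (simp add: d_def diff_divide_distrib)
    ultimately show ?thesis
      unfolding D_def g by (simp add: k_def n_def n'_def m_def s_def t_def f_def d_def)
  qed
  have tr: "0 < rate r" using tq qr by simp
  have "K q 0 + neg q / (rate q - 0) = 1"
    by (rule trans[OF K_small[OF q order_refl tq]]) (use q in simp)
  moreover have "(K q 0 + neg q / (rate q - 0)) * (q - phi 0) =
      q + neg r / (rate r - 0) * ((1 - q / r) * D) * (r - phi 0)"
    by (rule main) (use tq tr in auto)
  ultimately have "1 * (q - phi 0) = q + neg r / (rate r - 0) * ((1 - q / r) * D) * (r - phi 0)"
    by metis
  then have "neg r / (rate r - 0) * ((1 - q / r) * D) * (r - phi 0) = 0" by simp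
  \<comment> \<open>At the point 0 the coefficient of \<open>D\<close> is
    \<open>neg r / rate r * (r - q)\<close>, which is positive.\<close>
  then have "D = 0" using tr r0 r(1) tail_0_pos[OF r0] by auto
  then have "(K q a + neg q / (rate q - a)) * (q - phi a) = q"
    using main[OF a(1) r(2) a(2)] by simp
  moreover have "q - phi a \<noteq> 0" using phi_greater[OF q ga] by simp
  ultimately show ?thesis by (simp add: field_simps)
qed

end

section \<open>Lindley's recursion\<close>

text \<open>The new step is prepended: \<open>z\<close> is the first step and \<open>m\<close> the
  maximum of the walk formed by the remaining ones. So this is directly the law of the running
  maximum, without time reversal.\<close>

primrec lindley :: "real measure \<Rightarrow> nat \<Rightarrow> real measure" where
  "lindley N 0 = return borel 0"
| "lindley N (Suc n) = distr (N \<Otimes>\<^sub>M lindley N n) borel (\<lambda>(z, m). max 0 (z + m))"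

lemma sets_lindley [simp, measurable_cong]: "sets (lindley N n) = sets borel"
  and space_lindley [simp]: "space (lindley N n) = UNIV"
  by (induction n) simp_all

lemma prob_space_lindley:
  assumes "prob_space N" and [measurable_cong]: "sets N = sets borel"
  shows "prob_space (lindley N n)"
proof (induction n)
  case 0
  show ?case by (simp add: prob_space_return)
next
  case (Suc n)
  have "prob_space (N \<Otimes>\<^sub>M lindley N n)" by (rule prob_space_pair[OF assms(1) Suc])
  then show ?case
    unfolding lindley.simps by (rule prob_space.prob_space_distr) (simp add: case_prod_unfold)
qed

lemma AE_lindley_nonneg:
  assumes [measurable_cong]: "sets N = sets borel"
  shows "AE m in lindley N n. 0 \<le> m"
proof (cases n)
  case 0
  show ?thesis unfolding 0 lindley.simps by (subst AE_return) auto
next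
  case (Suc k)
  show ?thesis unfolding Suc lindley.simps
    by (subst AE_distr_iff) (auto simp: case_prod_unfold)
qed

lemma nn_integral_lindley_Suc:
  assumes N: "prob_space N" and [measurable_cong]: "sets N = sets borel"
    and [measurable]: "h \<in> borel_measurable borel"
  shows "(\<integral>\<^sup>+m. h m \<partial>lindley N (Suc n)) = (\<integral>\<^sup>+m. (\<integral>\<^sup>+z. h (max 0 (z + m)) \<partial>N) \<partial>lindley N n)"
proof -
  interpret N: prob_space N by fact
  interpret L: prob_space "lindley N n" by (rule prob_space_lindley) fact+
  interpret NL: pair_sigma_finite N "lindley N n" ..
  have "(\<integral>\<^sup>+m. h m \<partial>lindley N (Suc n)) = (\<integral>\<^sup>+p. (\<lambda>(z, m). h (max 0 (z + m))) p \<partial>(N \<Otimes>\<^sub>M lindley N n))"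
    unfolding lindley.simps by (subst nn_integral_distr) (auto simp: case_prod_unfold)
  also have "\<dots> = (\<integral>\<^sup>+m. (\<integral>\<^sup>+z. h (max 0 (z + m)) \<partial>N) \<partial>lindley N n)"
    by (subst NL.nn_integral_snd[symmetric]) (auto simp: case_prod_unfold)
  finally show ?thesis .
qed

context spectrally_positive_levy
begin

abbreviation lam :: "real \<Rightarrow> nat \<Rightarrow> real measure" where
  "lam q \<equiv> lindley (mu q)"

lemma prob_space_lam: "0 < q \<Longrightarrow> prob_space (lam q n)"
  by (intro prob_space_lindley prob_space_mu) simp_all

definition F :: "real \<Rightarrow> nat \<Rightarrow> real \<Rightarrow> real" where
  "F q n a = (\<integral>m. exp (- a * m) \<partial>lam q n)"

lemma integrable_F:
  assumes "0 < q" "0 \<le> a"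
  shows "integrable (lam q n) (\<lambda>m. exp (- a * m))"
proof -
  interpret L: prob_space "lam q n" by (rule prob_space_lam) fact
  show ?thesis
  proof (rule L.integrable_const_bound[where B=1])
    show "AE m in lam q n. norm (exp (- a * m)) \<le> 1"
      using AE_lindley_nonneg[of "mu q" n] by (rule AE_mp) (use assms in \<open>auto intro!: AE_I2\<close>)
  qed simp
qed

lemma nn_integral_F:
  "0 < q \<Longrightarrow> 0 \<le> a \<Longrightarrow> (\<integral>\<^sup>+m. ennreal (exp (- a * m)) \<partial>lam q n) = ennreal (F q n a)"
  unfolding F_def by (rule nn_integral_eq_integral[OF integrable_F]) auto

lemma F_bounds:
  assumes "0 < q" "0 \<le> a"
  shows "0 \<le> F q n a" "F q n a \<le> 1"
proof -
  interpret L: prob_space "lam q n" by (rule prob_space_lam) fact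
  show "0 \<le> F q n a" unfolding F_def by (rule Bochner_Integration.integral_nonneg) simp
  have "F q n a \<le> (\<integral>m. 1 \<partial>lam q n)" unfolding F_def
  proof (rule integral_mono_AE[OF integrable_F[OF assms]])
    show "AE m in lam q n. exp (- a * m) \<le> 1"
      using AE_lindley_nonneg[of "mu q" n] by (rule AE_mp) (use assms in \<open>auto intro!: AE_I2\<close>)
  qed simp
  then show "F q n a \<le> 1" using L.prob_space by simp
qed

lemma F_0 [simp]: "F q 0 a = 1"
  unfolding F_def by (simp add: integral_return)

text \<open>The steps with \<open>z < - m\<close> lead to the value 0 and contribute
  \<open>tail q m\<close>, a multiple of \<open>exp (- rate q * m)\<close>. Hence one step produces
  only the exponents \<open>a\<close> and \<open>rate q\<close>, for \<open>a\<close> on either side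
  of \<open>rate q\<close>.\<close>

lemma step_laplace:
  assumes q: "0 < q" and m: "0 \<le> m" and a: "0 \<le> a" "a \<noteq> rate q"
  shows "(\<integral>\<^sup>+z. ennreal (exp (- a * max 0 (z + m))) \<partial>mu q) =
    ennreal ((K q a + neg q / (rate q - a)) * exp (- a * m) - tail q 0 * a / (rate q - a) * exp (- rate q * m))"
    and "0 \<le> (K q a + neg q / (rate q - a)) * exp (- a * m) - tail q 0 * a / (rate q - a) * exp (- rate q * m)"
proof -
  let ?b = "neg q * (exp (- a * m) - exp (- rate q * m)) / (rate q - a)"
  have t: "tail q m = tail q 0 * exp (- rate q * m)" by (rule tail_eq(2)[OF q m])
  have nn: "0 \<le> exp (- a * m) * K q a + ?b" "0 \<le> tail q m"
    using shifted_negative_nonneg[OF q m a(2)] K_nonneg[of q a] tail_bounds(1)[OF q]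
    by (auto intro!: add_nonneg_nonneg mult_nonneg_nonneg)
  have nz: "rate q - a \<noteq> 0" using a by simp
  have id: "exp (- a * m) * K q a + ?b + tail q m =
      (K q a + neg q / (rate q - a)) * exp (- a * m) - tail q 0 * a / (rate q - a) * exp (- rate q * m)"
  proof -
    have "tail q 0 = tail q 0 * rate q / (rate q - a) - tail q 0 * a / (rate q - a)"
      using nz by (simp add: diff_divide_distrib[symmetric] right_diff_distrib[symmetric])
    then have "tail q m = neg q / (rate q - a) * exp (- rate q * m) - tail q 0 * a / (rate q - a) * exp (- rate q * m)"
      unfolding t by (metis left_diff_distrib)
    then show ?thesis by (simp add: algebra_simps diff_divide_distrib)
  qed
  have "(\<integral>\<^sup>+z. ennreal (exp (- a * max 0 (z + m))) \<partial>mu q) =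
      (\<integral>\<^sup>+z. ennreal (indicator {0..} (m + z) * exp (- a * (m + z))) + indicator {..<- m} z \<partial>mu q)"
    by (intro nn_integral_cong) (auto simp: indicator_def max_def add.commute)
  also have "\<dots> = (\<integral>\<^sup>+z. ennreal (indicator {0..} (m + z) * exp (- a * (m + z))) \<partial>mu q) + emeasure (mu q) {..<- m}"
    by (subst nn_integral_add) auto
  also have "\<dots> = ennreal (exp (- a * m) * K q a + ?b) + ennreal (tail q m)"
    by (simp only: shifted_laplace[OF q m a] emeasure_mu_tail[OF q])
  also have "\<dots> = ennreal (exp (- a * m) * K q a + ?b + tail q m)"
    by (rule ennreal_plus[symmetric]) (rule nn)+
  finally show "(\<integral>\<^sup>+z. ennreal (exp (- a * max 0 (z + m))) \<partial>mu q) =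
    ennreal ((K q a + neg q / (rate q - a)) * exp (- a * m) - tail q 0 * a / (rate q - a) * exp (- rate q * m))"
    unfolding id .
  show "0 \<le> (K q a + neg q / (rate q - a)) * exp (- a * m) - tail q 0 * a / (rate q - a) * exp (- rate q * m)"
    using nn unfolding id[symmetric] by (rule add_nonneg_nonneg)
qed

lemma F_Suc:
  assumes q: "0 < q" and a: "0 \<le> a" "a \<noteq> rate q"
  shows "F q (Suc n) a = q / (q - phi a) * F q n a - tail q 0 * a / (rate q - a) * F q n (rate q)"
proof -
  let ?L = "K q a + neg q / (rate q - a)" and ?c = "tail q 0 * a / (rate q - a)"
  have t: "0 \<le> rate q" using tail_eq(1)[OF q] by simp
  have int: "integrable (lam q n) (\<lambda>m. ?L * exp (- a * m) - ?c * exp (- rate q * m))"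
    by (intro Bochner_Integration.integrable_diff integrable_mult_right integrable_F q a t)
  have "ennreal (F q (Suc n) a) = (\<integral>\<^sup>+m. (\<integral>\<^sup>+z. ennreal (exp (- a * max 0 (z + m))) \<partial>mu q) \<partial>lam q n)"
    unfolding nn_integral_F[OF q a(1), symmetric]
    by (rule nn_integral_lindley_Suc) (simp_all add: prob_space_mu q)
  also have "\<dots> = (\<integral>\<^sup>+m. ennreal (?L * exp (- a * m) - ?c * exp (- rate q * m)) \<partial>lam q n)"
    by (rule nn_integral_cong_AE, rule AE_mp[OF AE_lindley_nonneg[of "mu q" n]])
       (auto intro!: AE_I2 simp only: sets_mu step_laplace(1)[OF q _ a])
  also have "\<dots> = ennreal (\<integral>m. ?L * exp (- a * m) - ?c * exp (- rate q * m) \<partial>lam q n)"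
  proof (rule nn_integral_eq_integral[OF int])
    show "AE m in lam q n. 0 \<le> ?L * exp (- a * m) - ?c * exp (- rate q * m)"
      using AE_lindley_nonneg[of "mu q" n]
      by (rule AE_mp) (auto intro!: AE_I2 simp only: sets_mu step_laplace(2)[OF q _ a])
  qed
  also have "(\<integral>m. ?L * exp (- a * m) - ?c * exp (- rate q * m) \<partial>lam q n) = ?L * F q n a - ?c * F q n (rate q)"
    unfolding F_def
    by (subst Bochner_Integration.integral_diff)
       (simp_all only: integral_mult_right_zero integrable_mult_right integrable_F q a t)
  finally have e: "ennreal (F q (Suc n) a) = ennreal (?L * F q n a - ?c * F q n (rate q))" .
  \<comment> \<open>The sign is needed to read a real equation off the one in
    \<open>ennreal\<close>.\<close>
  have "0 \<le> (\<integral>m. ?L * exp (- a * m) - ?c * exp (- rate q * m) \<partial>lam q n)"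
  proof (rule integral_nonneg_AE)
    show "AE m in lam q n. 0 \<le> ?L * exp (- a * m) - ?c * exp (- rate q * m)"
      using AE_lindley_nonneg[of "mu q" n]
      by (rule AE_mp) (auto intro!: AE_I2 simp only: sets_mu step_laplace(2)[OF q _ a])
  qed
  also have "\<dots> = ?L * F q n a - ?c * F q n (rate q)" by fact
  finally show ?thesis
    using e F_bounds(1)[OF q a(1)] K_formula[OF q a] by (simp del: times_divide_eq_left times_divide_eq_right)
qed

section \<open>Geometric mixtures of the walk maxima\<close>

text \<open>The transform of the maximum over a geometric number of steps. It is used with
  \<open>e = \<beta> / (\<beta> + \<omega>)\<close>, the probability that killing precedes the next
  inspection.\<close>

definition S :: "real \<Rightarrow> real \<Rightarrow> real \<Rightarrow> real" where
  "S q e a = (\<Sum>n. e * (1 - e) ^ n * F q n a)"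

lemma S_summable:
  assumes q: "0 < q" and e: "0 < e" "e < 1" and a: "0 \<le> a"
  shows "summable (\<lambda>n. e * (1 - e) ^ n * F q n a)"
proof (rule summable_comparison_test)
  show "\<exists>N. \<forall>n\<ge>N. norm (e * (1 - e) ^ n * F q n a) \<le> e * (1 - e) ^ n"
    using F_bounds[OF q a] e by (auto simp: abs_mult power_abs intro!: exI[of _ 0] mult_left_le)
  show "summable (\<lambda>n. e * (1 - e) ^ n)" using e by (intro summable_mult summable_geometric) auto
qed

lemma S_equation:
  assumes q: "0 < q" and e: "0 < e" "e < 1" and a: "0 \<le> a" "a \<noteq> rate q"
  shows "S q e a = e + (1 - e) * (q / (q - phi a) * S q e a - tail q 0 * a / (rate q - a) * S q e (rate q))"
proof -
  have t: "0 \<le> rate q" using tail_eq(1)[OF q] by simp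
  define A where "A = q / (q - phi a)"
  define c where "c = tail q 0 * a / (rate q - a)"
  have s1: "(\<lambda>n. e * (1 - e) ^ n * F q n a) sums S q e a"
    unfolding S_def by (rule summable_sums[OF S_summable[OF q e a(1)]])
  have s2: "(\<lambda>n. e * (1 - e) ^ n * F q n (rate q)) sums S q e (rate q)"
    unfolding S_def by (rule summable_sums[OF S_summable[OF q e t]])
  have pt: "(1 - e) * (A * (e * w * f) - c * (e * w * g)) = e * ((1 - e) * w) * (A * f - c * g)" for w f g :: real
    by (simp only: right_diff_distrib mult.assoc mult.left_commute mult.commute)
  have "(\<lambda>n. (1 - e) * (A * (e * (1 - e) ^ n * F q n a) - c * (e * (1 - e) ^ n * F q n (rate q)))) sums
      ((1 - e) * (A * S q e a - c * S q e (rate q)))"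
    by (intro sums_mult sums_diff s1 s2)
  then have "(\<lambda>n. e * (1 - e) ^ Suc n * F q (Suc n) a) sums ((1 - e) * (A * S q e a - c * S q e (rate q)))"
    unfolding pt F_Suc[OF q a] A_def[symmetric] c_def[symmetric] power_Suc .
  \<comment> \<open>The recursion only covers the indices from 1 on; the term at 0, where
    \<open>F q 0 a = 1\<close>, contributes \<open>e\<close>.\<close>
  from sums_Suc[where f="\<lambda>n. e * (1 - e) ^ n * F q n a", OF this]
  have "(\<lambda>n. e * (1 - e) ^ n * F q n a) sums
      ((1 - e) * (A * S q e a - c * S q e (rate q)) + e * (1 - e) ^ 0 * F q 0 a)" .
  from sums_unique2[OF s1 this] show ?thesis unfolding A_def c_def by simp
qed

text \<open>
  The factor \<open>b - phi a\<close> vanishes at \<open>a = rate b\<close>, which determines the unknown \<open>S q e (rate q)\<close>.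
\<close>

lemma S_formula:
  assumes b: "0 < b" "b < q" and a: "0 \<le> a" "a \<noteq> rate q" "a \<noteq> rate b"
  shows "S q (b / q) a =
    (a - rate b) / (b - phi a) * (b / rate b) * ((q - phi a) / (a - rate q)) * (rate q / q)"
proof -
  define e where "e = b / q"
  have q: "0 < q" using b by simp
  have e: "0 < e" "e < 1" "e * q = b" using b by (auto simp: e_def)
  have r: "0 < rate b" "rate b < rate q"
    using tail_eq(1)[OF b(1)] rate_less_iff[OF b(1) q] b by auto
  define c where "c = (1 - e) * tail q 0 * S q e (rate q)"
  have main: "S q e x * (b - phi x) / (q - phi x) = e - c * x / (rate q - x)"
    if x: "0 \<le> x" "x \<noteq> rate q" for x
  proof -
    have nz: "q - phi x \<noteq> 0" using phi_eq_iff[OF q x(1)] x by auto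
    have "S q e x = e + (1 - e) * (q / (q - phi x) * S q e x) - c * x / (rate q - x)"
      using S_equation[OF q e(1,2) x] by (simp add: c_def algebra_simps)
    \<comment> \<open>Because \<open>(1 - e) * q = q - b\<close>, the two multiples of
      \<open>S q e x\<close> merge into one with numerator \<open>b - phi x\<close>.\<close>
    moreover have "S q e x * (b - phi x) / (q - phi x) = S q e x - (1 - e) * (q / (q - phi x) * S q e x)"
      using nz e(3) by (simp add: field_simps)
    ultimately show ?thesis by simp
  qed
  have "e - c * rate b / (rate q - rate b) = 0"
    using main[of "rate b"] r phi_rate[OF b(1)] by simp
  then have c: "c = e * (rate q - rate b) / rate b" using r by (simp add: field_simps)
  have nz: "q - phi a \<noteq> 0" "b - phi a \<noteq> 0" "rate q - a \<noteq> 0" "a - rate q \<noteq> 0"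
    using phi_eq_iff[OF q a(1)] phi_eq_iff[OF b(1) a(1)] a by auto
  have "e - c * a / (rate q - a) = e * rate q * (rate b - a) / (rate b * (rate q - a))"
    using nz r by (simp add: c field_simps)
  moreover have "S q e a = (q - phi a) / (b - phi a) * (S q e a * (b - phi a) / (q - phi a))"
    using nz by simp
  ultimately have "S q e a = (q - phi a) / (b - phi a) * (e * rate q * (rate b - a) / (rate b * (rate q - a)))"
    using main[OF a(1,2)] by metis
  also have "e * rate q * (rate b - a) / (rate b * (rate q - a)) = e * rate q * (a - rate b) / (rate b * (a - rate q))"
  proof -
    have "(rate b - a) / (rate q - a) = (a - rate b) / (a - rate q)"
      using nz by (simp add: field_simps)
    then show ?thesis by (metis times_divide_times_eq)
  qed
  finally show ?thesis using q by (simp add: e_def mult_ac)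
qed

end

section \<open>Singular points and vanishing killing rate\<close>

lemma quot_lim_regular: "f a \<noteq> 0 \<or> g a \<noteq> 0 \<Longrightarrow> quot_lim f g a = f a / g a"
  by (auto simp: quot_lim_def)

lemma quot_lim_eqI:
  assumes a: "0 \<le> a" and z: "f a = 0" "g a = 0"
    and lim: "(h \<longlongrightarrow> l) (at a within {0..})"
    and ev: "eventually (\<lambda>u. f u / g u = h u) (at a within {0..})"
  shows "quot_lim f g a = l"
proof -
  have "at_right a \<le> at a within {0..}" by (rule at_le) (use a in auto)
  then have nt: "at a within {0..} \<noteq> bot"
    by (metis bot.extremum_uniqueI trivial_limit_at_right_real)
  have "((\<lambda>u. f u / g u) \<longlongrightarrow> l) (at a within {0..})"
    using lim by (rule Lim_transform_eventually) (use ev in \<open>auto elim: eventually_mono\<close>)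
  then have "Lim (at a within {0..}) (\<lambda>u. f u / g u) = l" by (rule tendsto_Lim[OF nt])
  then show ?thesis using z by (simp add: quot_lim_def)
qed

text \<open>
  At a singular point the limit of one quotient exists because it equals \<open>\<Phi>\<close> divided by the other,
  nonvanishing factors; no differentiability of \<open>\<phi>\<close> is needed.
\<close>

lemma extend_to_quot_lim:
  fixes \<Phi> \<phi> :: "real \<Rightarrow> real"
  assumes cont: "continuous_on {0..} \<Phi>" "continuous_on {0..} \<phi>"
    and A: "0 \<le> A" "\<And>a. 0 \<le> a \<Longrightarrow> \<phi> a = \<beta> \<longleftrightarrow> a = A"
    and B: "0 < B" "\<And>a. 0 \<le> a \<Longrightarrow> \<phi> a = q \<longleftrightarrow> a = B"
    and AB: "A \<noteq> B" and c: "c \<noteq> 0"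
    and form: "\<And>a. 0 \<le> a \<Longrightarrow> a \<noteq> A \<Longrightarrow> a \<noteq> B \<Longrightarrow>
      \<Phi> a = (a - A) / (\<beta> - \<phi> a) * c * ((q - \<phi> a) / (a - B))"
    and a: "0 \<le> a"
  shows "\<Phi> a = quot_lim (\<lambda>a. a - A) (\<lambda>a. \<beta> - \<phi> a) a * c * quot_lim (\<lambda>a. q - \<phi> a) (\<lambda>a. a - B) a"
proof -
  have lim: "(\<Phi> \<longlongrightarrow> \<Phi> x) (at x within {0..})" "(\<phi> \<longlongrightarrow> \<phi> x) (at x within {0..})" if "0 \<le> x" for x
    using cont that by (auto simp: continuous_on_def)
  have ne: "eventually (\<lambda>u. u \<noteq> A) (at x within {0..})" "eventually (\<lambda>u. u \<noteq> B) (at x within {0..})"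
    "eventually (\<lambda>u. 0 \<le> u) (at x within {0..})" for x
    using eventually_neq_at_within[of A x "{0..}"] eventually_neq_at_within[of B x "{0..}"]
    by (auto simp: eventually_at_filter)
  consider "a = A" | "a = B" | "a \<noteq> A" "a \<noteq> B" by auto
  then show ?thesis
  proof cases
    case 1
    have v: "\<phi> A = \<beta>" using A by auto
    have "\<phi> A \<noteq> q" using B(2)[OF A(1)] AB by simp
    then have d: "(q - \<phi> A) / (A - B) \<noteq> 0" using AB by simp
    have "quot_lim (\<lambda>a. a - A) (\<lambda>a. \<beta> - \<phi> a) A = \<Phi> A / (c * ((q - \<phi> A) / (A - B)))"
    proof (rule quot_lim_eqI[OF A(1)])
      show "((\<lambda>u. \<Phi> u / (c * ((q - \<phi> u) / (u - B)))) \<longlongrightarrow> \<Phi> A / (c * ((q - \<phi> A) / (A - B)))) (at A within {0..})"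
        using AB c d by (intro tendsto_intros lim A) auto
      show "\<forall>\<^sub>F u in at A within {0..}. (u - A) / (\<beta> - \<phi> u) = \<Phi> u / (c * ((q - \<phi> u) / (u - B)))"
        using ne
      proof eventually_elim
        case (elim u)
        then show ?case using form[of u] B(2)[of u] c by simp
      qed
    qed (use v in auto)
    moreover have "quot_lim (\<lambda>a. q - \<phi> a) (\<lambda>a. a - B) A = (q - \<phi> A) / (A - B)"
      by (rule quot_lim_regular) (use AB in simp)
    ultimately show ?thesis using 1 c d by simp
  next
    case 2
    have B0: "0 \<le> B" using B by simp
    have v: "\<phi> B = q" using B by auto
    have "\<phi> B \<noteq> \<beta>" using A(2)[OF B0] AB by simp
    then have d: "(B - A) / (\<beta> - \<phi> B) \<noteq> 0" using AB by simp
    have "quot_lim (\<lambda>a. q - \<phi> a) (\<lambda>a. a - B) B = \<Phi> B / ((B - A) / (\<beta> - \<phi> B) * c)"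
    proof (rule quot_lim_eqI[OF B0])
      show "((\<lambda>u. \<Phi> u / ((u - A) / (\<beta> - \<phi> u) * c)) \<longlongrightarrow> \<Phi> B / ((B - A) / (\<beta> - \<phi> B) * c)) (at B within {0..})"
        using \<open>\<phi> B \<noteq> \<beta>\<close> c d by (intro tendsto_intros lim B0) auto
      show "\<forall>\<^sub>F u in at B within {0..}. (q - \<phi> u) / (u - B) = \<Phi> u / ((u - A) / (\<beta> - \<phi> u) * c)"
        using ne
      proof eventually_elim
        case (elim u)
        then show ?case using form[of u] A(2)[of u] c by simp
      qed
    qed (use v in auto)
    moreover have "quot_lim (\<lambda>a. a - A) (\<lambda>a. \<beta> - \<phi> a) B = (B - A) / (\<beta> - \<phi> B)"
      by (rule quot_lim_regular) (use AB in simp)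
    ultimately show ?thesis using 2 c d by simp
  next
    case 3
    then show ?thesis using form[OF a] by (simp add: quot_lim_regular)
  qed
qed

context spectrally_positive_levy
begin

text \<open>Jensen's inequality, by the tangent of \<open>exp\<close> at \<open>- a * m\<close>.
  With a negative mean it bounds \<open>phi\<close> below by a positive multiple of
  \<open>a\<close>.\<close>

lemma phi_ge_mean:
  assumes int: "integrable M (Y 1)" and a: "0 \<le> a"
  shows "- a * expectation (Y 1) \<le> phi a"
proof -
  define m where "m = expectation (Y 1)"
  have [measurable]: "Y 1 \<in> borel_measurable M" by (rule Y_measurable) simp
  have eY: "expectation (\<lambda>x. exp (- a * Y 1 x)) = exp (phi a)"
  proof -
    have "expectation (\<lambda>x. exp (- a * Y 1 x)) = expectation (\<lambda>x. exp (- a * X 1 x))"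
    proof (rule integral_cong_AE)
      show "AE x in M. exp (- a * Y 1 x) = exp (- a * X 1 x)"
        using AE_X_eq by eventually_elim simp
    qed auto
    then show ?thesis using expectation_exp[OF a] by simp
  qed
  have intY: "integrable M (\<lambda>x. exp (- a * Y 1 x))"
  proof (rule integrable_cong_AE_imp[OF integrable_exp[OF a, of 1]])
    show "AE x in M. exp (- a * X 1 x) = exp (- a * Y 1 x)"
      using AE_X_eq by eventually_elim simp
  qed auto
  have "expectation (\<lambda>x. exp (- a * m) * (1 - a * (Y 1 x - m))) \<le> expectation (\<lambda>x. exp (- a * Y 1 x))"
  proof (rule integral_mono)
    fix x
    have "exp (- a * m) * (1 + (- a * (Y 1 x - m))) \<le> exp (- a * m) * exp (- a * (Y 1 x - m))"
      by (intro mult_left_mono exp_ge_add_one_self) simp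
    also have "\<dots> = exp (- a * Y 1 x)" by (simp add: exp_add[symmetric] algebra_simps)
    finally show "exp (- a * m) * (1 - a * (Y 1 x - m)) \<le> exp (- a * Y 1 x)" by simp
  qed (use int intY in auto)
  also have "expectation (\<lambda>x. exp (- a * m) * (1 - a * (Y 1 x - m))) = exp (- a * m)"
    using int by (simp add: prob_space m_def[symmetric])
  finally have "exp (- a * m) \<le> exp (phi a)" unfolding eY .
  then show ?thesis by (simp add: m_def)
qed

text \<open>If \<open>b < phi d\<close>, the conclusion of \<open>phi_less\<close> fails at
  \<open>d\<close>, so \<open>d\<close> does not lie below \<open>rate b\<close>.\<close>

lemma rate_tendsto_0:
  assumes pos: "\<And>a. 0 < a \<Longrightarrow> 0 < phi a"
  shows "(rate \<longlongrightarrow> 0) (at_right 0)"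
proof (rule tendstoI)
  fix d :: real assume d: "0 < d"
  have "dist (rate b) 0 < d" if "0 < b" "b < phi d" for b
    using phi_less[of b d] tail_eq(1)[of b] phi_rate[of b] that d
    by (cases "rate b" d rule: linorder_cases) auto
  then show "\<forall>\<^sub>F b in at_right 0. dist (rate b) 0 < d"
    using pos[OF d] unfolding eventually_at_right_field by blast
qed

text \<open>
  Letting the killing rate tend to 0 with \<open>q\<close> fixed, Abel's theorem turns the geometric mixtures
  of the \<open>F q n\<close> into their limit; this also produces the limit of \<open>b / rate b\<close>, without
  differentiating \<open>phi\<close>.
\<close>

lemma unkilled_limit:
  assumes q: "0 < q"
    and m: "integrable M (Y 1)" "expectation (Y 1) < 0"
    and Fl: "\<And>a. 0 < a \<Longrightarrow> (\<lambda>n. F q n a) \<longlonglongrightarrow> G a"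
  obtains \<kappa> where "0 < \<kappa>" "((\<lambda>b. b / rate b) \<longlongrightarrow> \<kappa>) (at_right 0)"
    "\<And>a. 0 < a \<Longrightarrow> a \<noteq> rate q \<Longrightarrow> G a = a / (0 - phi a) * \<kappa> * ((q - phi a) / (a - rate q)) * (rate q / q)"
    "(\<lambda>n. G (rate (1 / real (Suc n)))) \<longlonglongrightarrow> 1"
proof -
  define e where "e = - expectation (Y 1)"
  have e: "0 < e" using m by (simp add: e_def)
  have low: "a * e \<le> phi a" if "0 \<le> a" for a using phi_ge_mean[OF m(1) that] by (simp add: e_def)
  have pos: "0 < phi a" if "0 < a" for a
    using low[of a] mult_pos_pos[OF that e] that by linarith
  have tq: "0 < rate q" by (rule tail_eq(1)[OF q])
  note r0 = rate_tendsto_0[OF pos]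
  define C where "C a = (q - phi a) / (a - rate q) * (rate q / q)" for a
  have C0: "C a \<noteq> 0" if "0 \<le> a" "a \<noteq> rate q" for a
    using that phi_eq_iff[OF q that(1)] tq q by (auto simp: C_def)
  have evq: "\<forall>\<^sub>F b in at_right 0. 0 < b \<and> b < q"
    unfolding eventually_at_right_field using q by (intro exI[of _ q]) auto
  have SG: "((\<lambda>b. S q (b / q) a) \<longlongrightarrow> G a) (at_right 0)" if "0 < a" for a
  proof -
    have "((\<lambda>e. S q e a) \<longlongrightarrow> G a) (at_right 0)"
      unfolding S_def by (rule abel_mean_tendsto[OF Fl[OF that]])
    moreover have "filterlim (\<lambda>b. b / q) (at_right 0) (at_right 0)"
    proof (rule filterlim_at_withinI)
      have "((\<lambda>b. b / q) \<longlongrightarrow> 0 / q) (at_right 0)" using q by (intro tendsto_intros) auto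
      then show "((\<lambda>b. b / q) \<longlongrightarrow> 0) (at_right 0)" by simp
      show "\<forall>\<^sub>F b in at_right 0. b / q \<in> {0<..} - {0}"
        using evq by eventually_elim auto
    qed
    ultimately show ?thesis by (rule filterlim_compose)
  qed
  \<comment> \<open>\<open>S_formula\<close> is solved for \<open>b / rate b\<close>; everything
    else in it is known to converge.\<close>
  have ratio: "((\<lambda>b. b / rate b) \<longlongrightarrow> G a * (0 - phi a) / (a * C a)) (at_right 0)"
    if a: "0 < a" "a \<noteq> rate q" for a
  proof -
    have "((\<lambda>b. S q (b / q) a * (b - phi a) / ((a - rate b) * C a)) \<longlongrightarrow> G a * (0 - phi a) / ((a - 0) * C a)) (at_right 0)"
      using a C0[of a] by (intro tendsto_intros SG r0) auto
    then have "((\<lambda>b. S q (b / q) a * (b - phi a) / ((a - rate b) * C a)) \<longlongrightarrow> G a * (0 - phi a) / (a * C a)) (at_right 0)"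
      by simp
    moreover have "\<forall>\<^sub>F b in at_right 0. S q (b / q) a * (b - phi a) / ((a - rate b) * C a) = b / rate b"
    proof -
      have "\<forall>\<^sub>F b in at_right 0. rate b < a" by (rule order_tendstoD(2)[OF r0 a(1)])
      with evq show ?thesis
      proof eventually_elim
        case (elim b)
        have "S q (b / q) a = (a - rate b) / (b - phi a) * (b / rate b) * C a"
          using S_formula[of b q a] elim a by (simp add: C_def)
        moreover have "b - phi a \<noteq> 0" using phi_eq_iff[of b a] elim a by auto
        moreover have "a - rate b \<noteq> 0" "C a \<noteq> 0" using elim a C0[of a] by auto
        ultimately show ?case by simp
      qed
    qed
    ultimately show ?thesis by (rule Lim_transform_eventually)
  qed
  define \<kappa> where "\<kappa> = Lim (at_right 0) (\<lambda>b. b / rate b)"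
  have \<kappa>: "\<kappa> = G a * (0 - phi a) / (a * C a)" if "0 < a" "a \<noteq> rate q" for a
    unfolding \<kappa>_def by (rule tendsto_Lim[OF _ ratio[OF that]]) simp
  have lim: "((\<lambda>b. b / rate b) \<longlongrightarrow> \<kappa>) (at_right 0)"
    using ratio[of "rate q / 2"] \<kappa>[of "rate q / 2"] tq by simp
  \<comment> \<open>Here \<open>b = phi (rate b)\<close> is at least \<open>rate b * e\<close>, so
    the limit cannot be 0.\<close>
  have "e \<le> \<kappa>"
  proof (rule tendsto_lowerbound[OF lim])
    show "\<forall>\<^sub>F b in at_right 0. e \<le> b / rate b"
      using evq
    proof eventually_elim
      case (elim b)
      then show ?case using low[of "rate b"] tail_eq(1)[of b] phi_rate[of b] by (simp add: field_simps)
    qed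
  qed simp
  then have \<kappa>0: "0 < \<kappa>" using e by simp
  have form: "G a = a / (0 - phi a) * \<kappa> * ((q - phi a) / (a - rate q)) * (rate q / q)"
    if a: "0 < a" "a \<noteq> rate q" for a
  proof -
    have "G a = a / (0 - phi a) * \<kappa> * C a"
      using \<kappa>[OF a] pos[OF a(1)] C0[of a] a by simp
    then show ?thesis by (simp add: C_def)
  qed
  \<comment> \<open>Along the points \<open>rate b\<close> one has \<open>phi (rate b) = b\<close>,
    so the first quotient in \<open>form\<close> is \<open>- rate b / b\<close> and tends to
    \<open>- 1 / \<kappa>\<close>, while \<open>C 0 = - 1\<close>.\<close>
  have "(\<lambda>n. G (rate (1 / real (Suc n)))) \<longlonglongrightarrow> 1"
  proof -
    have fl: "filterlim (\<lambda>n. 1 / real (Suc n)) (at_right 0) sequentially"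
      by (intro filterlim_at_withinI LIMSEQ_Suc[OF lim_1_over_n]) auto
    have "((\<lambda>b. inverse (- (b / rate b)) * \<kappa> * C (rate b)) \<longlongrightarrow> inverse (- \<kappa>) * \<kappa> * C 0) (at_right 0)"
    proof (intro tendsto_intros lim)
      have "(phi \<longlongrightarrow> phi 0) (at 0 within {0..})"
        using continuous_on_phi by (auto simp: continuous_on_def simp del: phi_0)
      then have "(C \<longlongrightarrow> C 0) (at 0 within {0..})"
        unfolding C_def using tq q by (intro tendsto_intros) auto
      moreover have "filterlim rate (at 0 within {0..}) (at_right 0)"
      proof (rule filterlim_at_withinI[OF r0])
        show "\<forall>\<^sub>F b in at_right 0. rate b \<in> {0..} - {0}"
          using evq by eventually_elim (use tail_eq(1) in force)
      qed
      ultimately show "((\<lambda>b. C (rate b)) \<longlongrightarrow> C 0) (at_right 0)" by (rule filterlim_compose)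
    qed (use \<kappa>0 in auto)
    moreover have "inverse (- \<kappa>) * \<kappa> * C 0 = 1" using \<kappa>0 tq q by (simp add: C_def)
    ultimately have "((\<lambda>b. inverse (- (b / rate b)) * \<kappa> * C (rate b)) \<longlongrightarrow> 1) (at_right 0)" by simp
    moreover have "\<forall>\<^sub>F b in at_right 0. inverse (- (b / rate b)) * \<kappa> * C (rate b) = G (rate b)"
      using evq
    proof eventually_elim
      case (elim b)
      then have "0 < rate b" "rate b \<noteq> rate q" using tail_eq(1)[of b] rate_less_iff[of b q] q by auto
      then show ?case using form[of "rate b"] phi_rate[of b] elim by (simp add: C_def)
    qed
    ultimately have "((\<lambda>b. G (rate b)) \<longlongrightarrow> 1) (at_right 0)" by (rule Lim_transform_eventually)
    then show ?thesis by (rule filterlim_compose[OF _ fl])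
  qed
  then show ?thesis using that \<kappa>0 lim form by blast
qed

end

section \<open>Maxima of killed random walks\<close>

lemma (in prob_space) indep_var_nn_integral:
  assumes ind: "indep_var S A T B" and f[measurable]: "case_prod f \<in> borel_measurable (S \<Otimes>\<^sub>M T)"
  shows "(\<integral>\<^sup>+x. f (A x) (B x) \<partial>M) = (\<integral>\<^sup>+x. (\<integral>\<^sup>+y. f (A y) (B x) \<partial>M) \<partial>M)"
proof -
  have A[measurable]: "A \<in> measurable M S" and B[measurable]: "B \<in> measurable M T"
    and eq: "distr M S A \<Otimes>\<^sub>M distr M T B = distr M (S \<Otimes>\<^sub>M T) (\<lambda>x. (A x, B x))"
    using ind unfolding indep_var_distribution_eq by auto
  interpret SA: prob_space "distr M S A" by (rule prob_space_distr) simp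
  interpret TB: prob_space "distr M T B" by (rule prob_space_distr) simp
  interpret P: pair_sigma_finite "distr M S A" "distr M T B" ..
  have f': "case_prod f \<in> borel_measurable (distr M S A \<Otimes>\<^sub>M distr M T B)"
    using f by (simp cong: measurable_cong_sets)
  have "(\<integral>\<^sup>+x. f (A x) (B x) \<partial>M) = (\<integral>\<^sup>+p. case_prod f p \<partial>(distr M S A \<Otimes>\<^sub>M distr M T B))"
    unfolding eq by (subst nn_integral_distr) auto
  also have "\<dots> = (\<integral>\<^sup>+v. (\<integral>\<^sup>+u. f u v \<partial>distr M S A) \<partial>distr M T B)"
    using P.nn_integral_snd[OF f'] by simp
  also have "\<dots> = (\<integral>\<^sup>+x. (\<integral>\<^sup>+u. f u (B x) \<partial>distr M S A) \<partial>M)"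
  proof (rule nn_integral_distr[OF B])
    show "(\<lambda>v. \<integral>\<^sup>+u. f u v \<partial>distr M S A) \<in> borel_measurable (distr M T B)"
      using SA.borel_measurable_nn_integral[of "\<lambda>v u. f u v" "distr M T B"] measurable_pair_swap[OF f']
      by (simp add: case_prod_unfold)
  qed
  also have "\<dots> = (\<integral>\<^sup>+x. (\<integral>\<^sup>+y. f (A y) (B x) \<partial>M) \<partial>M)"
  proof (rule nn_integral_cong, rule nn_integral_distr[OF A])
    fix x assume "x \<in> space M"
    then have "B x \<in> space T" by (rule measurable_space[OF B])
    from measurable_Pair1[OF f this] show "(\<lambda>u. f u (B x)) \<in> borel_measurable (distr M S A)" by simp
  qed
  finally show ?thesis .
qed

text \<open>The pathwise counterpart of \<open>lindley\<close>, with the first step peeled off;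
  \<open>mx_eq_Max\<close> identifies it with the maximum of the partial sums.\<close>

primrec mx :: "(nat \<Rightarrow> real) \<Rightarrow> nat \<Rightarrow> real" where
  "mx s 0 = 0"
| "mx s (Suc n) = max 0 (s 0 + mx (\<lambda>j. s (Suc j)) n)"

lemma mx_eq_Max: "mx s n = Max ((\<lambda>k. \<Sum>j<k. s j) ` {..n})"
proof (induction n arbitrary: s)
  case (Suc n)
  have "(\<lambda>k. \<Sum>j<k. s j) ` {..Suc n} = insert 0 ((\<lambda>x. s 0 + x) ` (\<lambda>k. \<Sum>j<k. s (Suc j)) ` {..n})"
    by (simp add: atMost_Suc_eq_insert_0 image_image sum.lessThan_Suc_shift del: sum.lessThan_Suc)
  then have "Max ((\<lambda>k. \<Sum>j<k. s j) ` {..Suc n}) = max 0 (Max ((\<lambda>x. s 0 + x) ` (\<lambda>k. \<Sum>j<k. s (Suc j)) ` {..n}))"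
    by simp
  also have "Max ((\<lambda>x. s 0 + x) ` (\<lambda>k. \<Sum>j<k. s (Suc j)) ` {..n}) = s 0 + Max ((\<lambda>k. \<Sum>j<k. s (Suc j)) ` {..n})"
    by (intro hom_Max_commute[symmetric]) (auto simp: max_add_distrib_right)
  finally show ?case by (simp add: Suc)
qed simp

lemma mx_nonneg: "0 \<le> mx s n"
  by (cases n) simp_all

lemma mx_upper: "k \<le> n \<Longrightarrow> (\<Sum>j<k. s j) \<le> mx s n"
  unfolding mx_eq_Max by (rule Max_ge) auto

lemma mx_mono: "m \<le> n \<Longrightarrow> mx s m \<le> mx s n"
  unfolding mx_eq_Max by (rule Max_mono) auto

lemma mx_measurable [measurable (raw)]:
  assumes "\<And>j. (\<lambda>w. s w j) \<in> borel_measurable N"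
  shows "(\<lambda>w. mx (s w) n) \<in> borel_measurable N"
  using assms
proof (induction n arbitrary: s)
  case (Suc n)
  note [measurable] = Suc.prems Suc.IH[of "\<lambda>w j. s w (Suc j)"]
  show ?case unfolding mx.simps by measurable
qed simp

text \<open>
  The weights \<open>w\<close> absorb the killing: for the random walk they are 1, while for the inspection
  scheme they are the survival probabilities of the interarrival times.
\<close>

lemma (in prob_space) weighted_lindley:
  fixes U :: "nat \<Rightarrow> 'a \<Rightarrow> 'b" and z :: "'b \<Rightarrow> real" and w :: "'b \<Rightarrow> ennreal"
  assumes ind: "indep_vars (\<lambda>_. N) U {l..}"
    and [measurable]: "w \<in> borel_measurable N" "z \<in> borel_measurable N"
    and L: "prob_space \<mu>" and sets_\<mu>[measurable_cong]: "sets \<mu> = sets borel"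
    and step: "\<And>k h. l \<le> k \<Longrightarrow> h \<in> borel_measurable borel \<Longrightarrow>
      (\<integral>\<^sup>+x. w (U k x) * h (z (U k x)) \<partial>M) = p * (\<integral>\<^sup>+y. h y \<partial>\<mu>)"
    and r: "r \<le> 1"
    and h[measurable]: "h \<in> borel_measurable borel" and i: "l \<le> i"
  shows "(\<integral>\<^sup>+x. (\<Prod>j<n + r. w (U (i + j) x)) * h (mx (\<lambda>j. z (U (i + j) x)) n) \<partial>M) =
    p ^ (n + r) * (\<integral>\<^sup>+y. h y \<partial>lindley \<mu> n)"
  using h i
\<comment> \<open>Peeling off step \<open>i\<close> replaces \<open>h\<close> by its average
  \<open>g\<close> over that step and restarts at \<open>Suc i\<close>. With \<open>r = 1\<close>
  the product contains the weight of one further step that does not enter the maximum.\<close>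
proof (induction n arbitrary: h i)
  case 0
  note [measurable] = 0(1)
  interpret \<mu>: prob_space \<mu> by fact
  have ret: "(\<integral>\<^sup>+y. h y \<partial>lindley \<mu> 0) = h 0" using 0(1) by (simp add: nn_integral_return)
  show ?case
  proof (cases r)
    case 0
    then show ?thesis using ret by (simp add: emeasure_space_1)
  next
    case (Suc r')
    then have "r = 1" using r by simp
    moreover have "(\<integral>\<^sup>+x. w (U i x) * h 0 \<partial>M) = p * h 0"
      using step[OF 0(2), of "\<lambda>_. h 0"] \<mu>.emeasure_space_1 by simp
    ultimately show ?thesis using ret by simp
  qed
next
  case (Suc n)
  note [measurable] = Suc.prems(1)
  interpret \<mu>: prob_space \<mu> by fact
  let ?R = "{Suc i..}"
  have ind': "indep_var (PiM {i} (\<lambda>_. N)) (\<lambda>x. \<lambda>k\<in>{i}. U k x) (PiM ?R (\<lambda>_. N)) (\<lambda>x. \<lambda>k\<in>?R. U k x)"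
    by (rule indep_var_restrict[OF ind]) (use Suc.prems(2) in auto)
  have [measurable]: "(\<lambda>v. v (Suc i + j)) \<in> measurable (PiM ?R (\<lambda>_. N)) N" for j
    by (rule measurable_component_singleton) simp
  have [measurable]: "(\<lambda>v. v i) \<in> measurable (PiM {i} (\<lambda>_. N)) N"
    by (rule measurable_component_singleton) simp
  define g where "g m = (\<integral>\<^sup>+y. h (max 0 (y + m)) \<partial>\<mu>)" for m
  have [measurable]: "g \<in> borel_measurable borel" unfolding g_def by measurable
  define f where "f u v = w (u i) * ((\<Prod>j<n + r. w (v (Suc i + j))) * h (max 0 (z (u i) + mx (\<lambda>j. z (v (Suc i + j))) n)))" for u v
  have fm: "case_prod f \<in> borel_measurable (PiM {i} (\<lambda>_. N) \<Otimes>\<^sub>M PiM ?R (\<lambda>_. N))"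
    unfolding f_def by measurable
  have "(\<integral>\<^sup>+x. (\<Prod>j<Suc n + r. w (U (i + j) x)) * h (mx (\<lambda>j. z (U (i + j) x)) (Suc n)) \<partial>M) =
      (\<integral>\<^sup>+x. f (\<lambda>k\<in>{i}. U k x) (\<lambda>k\<in>?R. U k x) \<partial>M)"
    by (intro nn_integral_cong) (simp add: f_def prod.lessThan_Suc_shift mult.assoc del: prod.lessThan_Suc)
  also have "\<dots> = (\<integral>\<^sup>+x. (\<integral>\<^sup>+y. f (\<lambda>k\<in>{i}. U k y) (\<lambda>k\<in>?R. U k x) \<partial>M) \<partial>M)"
    by (rule indep_var_nn_integral[OF ind' fm])
  also have "\<dots> = (\<integral>\<^sup>+x. p * ((\<Prod>j<n + r. w (U (Suc i + j) x)) * g (mx (\<lambda>j. z (U (Suc i + j) x)) n)) \<partial>M)"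
  proof (rule nn_integral_cong)
    fix x
    let ?c = "\<Prod>j<n + r. w (U (Suc i + j) x)" and ?m = "mx (\<lambda>j. z (U (Suc i + j) x)) n"
    have "(\<integral>\<^sup>+y. f (\<lambda>k\<in>{i}. U k y) (\<lambda>k\<in>?R. U k x) \<partial>M) =
        (\<integral>\<^sup>+y. w (U i y) * (\<lambda>t. ?c * h (max 0 (t + ?m))) (z (U i y)) \<partial>M)"
      by (simp add: f_def)
    also have "\<dots> = p * (\<integral>\<^sup>+t. ?c * h (max 0 (t + ?m)) \<partial>\<mu>)"
      by (rule step) (use Suc.prems in auto)
    also have "(\<integral>\<^sup>+t. ?c * h (max 0 (t + ?m)) \<partial>\<mu>) = ?c * g ?m"
      unfolding g_def by (rule nn_integral_cmult) measurable
    finally show "(\<integral>\<^sup>+y. f (\<lambda>k\<in>{i}. U k y) (\<lambda>k\<in>?R. U k x) \<partial>M) = p * (?c * g ?m)" .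
  qed
  also have "\<dots> = p * (\<integral>\<^sup>+x. (\<Prod>j<n + r. w (U (Suc i + j) x)) * g (mx (\<lambda>j. z (U (Suc i + j) x)) n) \<partial>M)"
  proof (rule nn_integral_cmult)
    have [measurable]: "U (Suc i + j) \<in> measurable M N" for j
      using ind Suc.prems(2) by (auto simp: indep_vars_def)
    show "(\<lambda>x. (\<Prod>j<n + r. w (U (Suc i + j) x)) * g (mx (\<lambda>j. z (U (Suc i + j) x)) n)) \<in> borel_measurable M"
      by measurable
  qed
  also have "\<dots> = p * (p ^ (n + r) * (\<integral>\<^sup>+y. g y \<partial>lindley \<mu> n))"
    by (subst Suc.IH) (use Suc.prems(2) in auto)
  also have "(\<integral>\<^sup>+y. g y \<partial>lindley \<mu> n) = (\<integral>\<^sup>+y. h y \<partial>lindley \<mu> (Suc n))"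
    unfolding g_def by (rule nn_integral_lindley_Suc[OF L sets_\<mu> Suc.prems(1), symmetric])
  finally show ?case by (simp add: mult.assoc)
qed

context spectrally_positive_levy
begin

section \<open>Laplace transforms of the killed and the unkilled maximum\<close>

text \<open>\<open>A n\<close> is the event that the last inspection has index \<open>n\<close>.
  That these events exhaust the space almost surely is derived: for \<open>a = 0\<close> the
  hypothesis \<open>E\<close> gives them geometric probabilities with total mass 1.\<close>

lemma killed_expectation:
  fixes V :: "'a \<Rightarrow> real" and W :: "nat \<Rightarrow> 'a \<Rightarrow> real" and A :: "nat \<Rightarrow> 'a set"
  assumes b: "0 < b" "b < q"
    and [measurable]: "V \<in> borel_measurable M" "\<And>n. W n \<in> borel_measurable M" "\<And>n. A n \<in> sets M"
    and disj: "disjoint_family A"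
    and V: "AE x in M. \<forall>n. x \<in> A n \<longrightarrow> V x = W n x"
    and E: "\<And>n a. 0 \<le> a \<Longrightarrow> (\<integral>\<^sup>+x. indicator (A n) x * ennreal (exp (- a * W n x)) \<partial>M) =
      ennreal (b / q * (1 - b / q) ^ n * F q n a)"
  shows "AE x in M. \<exists>n. x \<in> A n"
    and "0 \<le> a \<Longrightarrow> expectation (\<lambda>x. exp (- a * V x)) = S q (b / q) a"
proof -
  define e where "e = b / q"
  have q: "0 < q" using b by simp
  have e: "0 < e" "e < 1" using b by (auto simp: e_def)
  have sumE: "(\<Sum>n. ennreal (e * (1 - e) ^ n * F q n a)) = ennreal (S q e a)" if "0 \<le> a" for a
    unfolding S_def
    by (rule suminf_ennreal_eq[OF _ summable_sums[OF S_summable[OF q e that]]])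
       (use e F_bounds[OF q that] in auto)
  have F0: "F q n 0 = 1" for n
    using prob_space.prob_space[OF prob_space_lam[OF q, of n]] by (simp add: F_def)
  have S0: "S q e 0 = 1"
    using sums_mult[OF geometric_sums[of "1 - e"], of e] e by (simp add: S_def F0 sums_iff)
  have PA: "emeasure M (A n) = ennreal (e * (1 - e) ^ n * F q n 0)" for n
    using E[of 0 n] by (simp add: e_def)
  have "emeasure M (\<Union>n. A n) = (\<Sum>n. emeasure M (A n))"
    by (rule suminf_emeasure[symmetric]) (use disj in auto)
  then have "emeasure M (\<Union>n. A n) = 1" using sumE[of 0] S0 by (simp add: PA)
  then have ae: "AE x in M. x \<in> (\<Union>n. A n)"
    by (intro AE_prob_1) (simp add: emeasure_eq_measure)
  then show "AE x in M. \<exists>n. x \<in> A n" by simp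
  assume a: "0 \<le> a"
  have "(\<integral>\<^sup>+x. ennreal (exp (- a * V x)) \<partial>M) = (\<integral>\<^sup>+x. (\<Sum>n. indicator (A n) x * ennreal (exp (- a * W n x))) \<partial>M)"
  proof (rule nn_integral_cong_AE)
    show "AE x in M. ennreal (exp (- a * V x)) = (\<Sum>n. indicator (A n) x * ennreal (exp (- a * W n x)))"
      using ae V
    proof eventually_elim
      case (elim x)
      then obtain n where n: "x \<in> A n" by auto
      have "indicator (A m) x * ennreal (exp (- a * W m x)) = 0" if "m \<notin> {n}" for m
        using disj n that by (auto simp: disjoint_family_on_def indicator_def)
      then have "(\<Sum>n. indicator (A n) x * ennreal (exp (- a * W n x))) = (\<Sum>m\<in>{n}. indicator (A m) x * ennreal (exp (- a * W m x)))"
        by (intro suminf_finite) auto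
      then show ?case using n elim by simp
    qed
  qed
  also have "\<dots> = (\<Sum>n. \<integral>\<^sup>+x. indicator (A n) x * ennreal (exp (- a * W n x)) \<partial>M)"
    by (rule nn_integral_suminf) measurable
  also have "\<dots> = ennreal (S q e a)" using E[OF a] sumE[OF a] by (simp add: e_def)
  finally have nn: "(\<integral>\<^sup>+x. ennreal (exp (- a * V x)) \<partial>M) = ennreal (S q e a)" .
  have "0 \<le> S q e a" unfolding S_def
    by (rule suminf_nonneg[OF S_summable[OF q e a]]) (use e F_bounds[OF q a] in auto)
  then show "expectation (\<lambda>x. exp (- a * V x)) = S q (b / q) a"
    by (subst integral_eq_nn_integral) (auto simp: nn[unfolded mult_minus_left] e_def)
qed

lemma continuous_on_laplace_nonneg:
  fixes V :: "'a \<Rightarrow> real"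
  assumes [measurable]: "V \<in> borel_measurable M" and V: "AE x in M. 0 \<le> V x"
  shows "continuous_on {0..} (\<lambda>a. expectation (\<lambda>x. exp (- a * V x)))"
proof (rule continuous_on_laplace_transform_Ici)
  fix b :: real assume b: "0 \<le> b"
  show "integrable M (\<lambda>x. exp (- b * V x))"
  proof (rule integrable_const_bound[where B=1])
    show "AE x in M. norm (exp (- b * V x)) \<le> 1"
      using V by eventually_elim (use b in auto)
  qed simp
qed (simp_all add: finite_measure_axioms)

lemma killed_formula:
  assumes b: "0 < b" "b < q"
    and [measurable]: "V \<in> borel_measurable M" and V: "AE x in M. 0 \<le> V x"
    and E: "\<And>a. 0 \<le> a \<Longrightarrow> expectation (\<lambda>x. exp (- a * V x)) = S q (b / q) a"
    and a: "0 \<le> a"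
  shows "expectation (\<lambda>x. exp (- a * V x)) =
    quot_lim (\<lambda>a. a - rate b) (\<lambda>a. b - phi a) a * (b / rate b * (rate q / q)) *
    quot_lim (\<lambda>a. q - phi a) (\<lambda>a. a - rate q) a"
proof -
  have q: "0 < q" using b by simp
  note rb = tail_eq(1)[OF b(1)] and rq = tail_eq(1)[OF q]
  have lt: "rate b < rate q" using rate_less_iff[OF b(1) q] b by simp
  show ?thesis
  proof (rule extend_to_quot_lim[OF continuous_on_laplace_nonneg[OF assms(3) V] continuous_on_phi])
    fix x :: real assume x: "0 \<le> x" "x \<noteq> rate b" "x \<noteq> rate q"
    show "expectation (\<lambda>y. exp (- x * V y)) =
        (x - rate b) / (b - phi x) * (b / rate b * (rate q / q)) * ((q - phi x) / (x - rate q))"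
      unfolding E[OF x(1)] S_formula[OF b x(1,3,2)] by (simp add: mult_ac)
  qed (use rb rq lt a b q phi_eq_iff[OF b(1)] phi_eq_iff[OF q] in auto)
qed


text \<open>
  A real-valued \<open>SUP\<close> of an unbounded set is a junk value, so finiteness of the supremum is part of
  the proof: its probability is at least every \<open>G a\<close>, and \<open>G a\<close> tends to 1 as \<open>a\<close> tends to 0.
\<close>

lemma unkilled_formula:
  fixes V :: "'a \<Rightarrow> real" and s :: "'a \<Rightarrow> nat \<Rightarrow> real"
  assumes q: "0 < q"
    and m: "integrable M (Y 1)" "expectation (Y 1) < 0"
    and [measurable]: "V \<in> borel_measurable M" "\<And>j. (\<lambda>x. s x j) \<in> borel_measurable M"
    and V: "AE x in M. V x = (SUP n. \<Sum>j<n. s x j)"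
    and E: "\<And>n a. 0 \<le> a \<Longrightarrow> (\<integral>\<^sup>+x. ennreal (exp (- a * mx (s x) n)) \<partial>M) = ennreal (F q n a)"
  obtains \<kappa> where "((\<lambda>b. b / rate b) \<longlongrightarrow> \<kappa>) (at_right 0)"
    "\<And>a. 0 \<le> a \<Longrightarrow> expectation (\<lambda>x. exp (- a * V x)) =
      quot_lim (\<lambda>a. a - 0) (\<lambda>a. 0 - phi a) a * (\<kappa> * (rate q / q)) *
      quot_lim (\<lambda>a. q - phi a) (\<lambda>a. a - rate q) a"
proof -
  define bd where "bd x \<longleftrightarrow> (\<exists>B::nat. \<forall>n. mx (s x) n \<le> real B)" for x
  have [measurable]: "Measurable.pred M bd" unfolding bd_def[abs_def] by measurable
  have conv: "convergent (\<lambda>n. exp (- a * mx (s x) n))" if a: "0 \<le> a" for a x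
  proof (rule Bseq_monoseq_convergent)
    show "Bseq (\<lambda>n. exp (- a * mx (s x) n))"
      using a mx_nonneg by (intro BseqI'[of _ 1]) simp
    show "monoseq (\<lambda>n. exp (- a * mx (s x) n))"
      using a by (intro monoI2) (auto intro!: mult_left_mono mx_mono)
  qed
  \<comment> \<open>This limit exists everywhere and, for \<open>a > 0\<close>, vanishes where the
    walk is unbounded. It is the transform of the supremum with the value infinity allowed, before
    finiteness is known.\<close>
  define D where "D a x = lim (\<lambda>n. exp (- a * mx (s x) n))" for a x
  have Dlim: "(\<lambda>n. exp (- a * mx (s x) n)) \<longlonglongrightarrow> D a x" if "0 \<le> a" for a x
    unfolding D_def using conv[OF that] by (simp only: convergent_LIMSEQ_iff)
  have [measurable]: "D a \<in> borel_measurable M" for a unfolding D_def[abs_def] by measurable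
  have EF: "expectation (\<lambda>x. exp (- a * mx (s x) n)) = F q n a" if "0 \<le> a" for a n
    using E[OF that, of n] F_bounds(1)[OF q that, of n]
    by (subst integral_eq_nn_integral) (auto simp del: mult_minus_left)
  define G where "G a = expectation (D a)" for a
  have Glim: "(\<lambda>n. F q n a) \<longlonglongrightarrow> G a" if a: "0 \<le> a" for a
    unfolding EF[OF a, symmetric] G_def
    by (rule integral_dominated_convergence[where w="\<lambda>_. 1"])
       (use Dlim[OF a] a mx_nonneg in auto)
  have D01: "0 \<le> D a x" "D a x \<le> 1" if a: "0 \<le> a" for a x
    by (rule LIMSEQ_le_const[OF Dlim[OF a]], simp, rule LIMSEQ_le_const2[OF Dlim[OF a]])
       (use a mx_nonneg in auto)
  obtain \<kappa> where \<kappa>: "0 < \<kappa>" "((\<lambda>b. b / rate b) \<longlongrightarrow> \<kappa>) (at_right 0)"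
    and form: "\<And>a. 0 < a \<Longrightarrow> a \<noteq> rate q \<Longrightarrow> G a = a / (0 - phi a) * \<kappa> * ((q - phi a) / (a - rate q)) * (rate q / q)"
    and one: "(\<lambda>n. G (rate (1 / real (Suc n)))) \<longlonglongrightarrow> 1"
    by (rule unkilled_limit[OF q m Glim[OF less_imp_le]]) blast+
  have Dbd: "D a x = 0" if a: "0 < a" and x: "\<not> bd x" for a x
  proof -
    have "filterlim (mx (s x)) at_top sequentially"
      unfolding filterlim_at_top_gt[of _ _ 0]
    proof (intro allI impI)
      fix Z :: real
      obtain B :: nat where "Z \<le> real B" using real_arch_simple by blast
      moreover obtain n where "real B < mx (s x) n" using x by (auto simp: bd_def not_le)
      ultimately have "Z \<le> mx (s x) k" if "n \<le> k" for k
        using mx_mono[OF that, of "s x"] by linarith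
      then show "\<forall>\<^sub>F n in sequentially. Z \<le> mx (s x) n" by (auto simp: eventually_sequentially)
    qed
    then have "filterlim (\<lambda>n. - a * mx (s x) n) at_bot sequentially"
      using a by (intro filterlim_tendsto_neg_mult_at_bot[OF tendsto_const]) auto
    then have "(\<lambda>n. exp (- a * mx (s x) n)) \<longlonglongrightarrow> 0" by (rule filterlim_compose[OF exp_at_bot])
    with Dlim[of a x] a show ?thesis by (intro LIMSEQ_unique) auto
  qed
  have Pbd: "G a \<le> prob {x\<in>space M. bd x}" if a: "0 < a" for a
  proof -
    have "G a \<le> expectation (indicator {x\<in>space M. bd x})"
      unfolding G_def
    proof (rule integral_mono)
      show "integrable M (D a)"
        by (rule integrable_const_bound[where B=1]) (use D01[of a] a in auto)
      show "D a x \<le> indicator {x\<in>space M. bd x} x" if "x \<in> space M" for x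
        using D01[of a x] Dbd[OF a, of x] a that by (auto simp: indicator_def)
      show "integrable M (indicator {x\<in>space M. bd x} :: 'a \<Rightarrow> real)"
        by (rule integrable_real_indicator) (simp_all add: emeasure_eq_measure)
    qed
    then show ?thesis by simp
  qed
  have "1 \<le> prob {x\<in>space M. bd x}"
    by (rule LIMSEQ_le_const2[OF one]) (use Pbd tail_eq(1) in auto)
  then have "prob {x\<in>space M. bd x} = 1" using prob_le_1 antisym by blast
  then have bd: "AE x in M. bd x" by (subst (asm) prob_eq_1) auto
  have Vlim: "AE x in M. (\<lambda>n. mx (s x) n) \<longlonglongrightarrow> V x"
    using bd V
  proof eventually_elim
    case (elim x)
    obtain B where B: "\<And>n. mx (s x) n \<le> B" using elim(1) by (auto simp: bd_def)
    have bdd: "bdd_above (range (\<lambda>n. \<Sum>j<n. s x j))"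
      using order_trans[OF mx_upper[OF order_refl] B] by (auto simp: bdd_above_def)
    have bddm: "bdd_above (range (mx (s x)))" using B by (auto simp: bdd_above_def)
    have "(SUP n. mx (s x) n) = (SUP n. \<Sum>j<n. s x j)"
    proof (rule antisym)
      show "(SUP n. mx (s x) n) \<le> (SUP n. \<Sum>j<n. s x j)"
      proof (rule cSUP_least)
        fix n
        show "mx (s x) n \<le> (SUP n. \<Sum>j<n. s x j)"
          unfolding mx_eq_Max by (rule Max.boundedI) (auto intro: cSUP_upper[OF _ bdd])
      qed simp
      show "(SUP n. \<Sum>j<n. s x j) \<le> (SUP n. mx (s x) n)"
        by (rule cSUP_least) (auto intro: cSUP_upper2[OF bddm _ mx_upper[OF order_refl]])
    qed
    moreover have "(\<lambda>n. mx (s x) n) \<longlonglongrightarrow> (SUP n. mx (s x) n)"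
      by (rule LIMSEQ_incseq_SUP[OF bddm]) (simp add: incseq_def mx_mono)
    ultimately show ?case using elim(2) by simp
  qed
  have V0: "AE x in M. 0 \<le> V x"
    using Vlim by eventually_elim (rule LIMSEQ_le_const, auto simp: mx_nonneg)
  have VG: "expectation (\<lambda>x. exp (- a * V x)) = G a" if a: "0 \<le> a" for a
    unfolding G_def
  proof (rule integral_cong_AE)
    show "AE x in M. exp (- a * V x) = D a x"
      using Vlim
    proof eventually_elim
      case (elim x)
      have "(\<lambda>n. exp (- a * mx (s x) n)) \<longlonglongrightarrow> exp (- a * V x)" by (intro tendsto_intros elim)
      then show ?case using Dlim[OF a] by (rule LIMSEQ_unique)
    qed
  qed auto
  have pos: "0 < phi a" if "0 < a" for a
    using phi_ge_mean[OF m(1), of a] mult_pos_neg[OF that m(2)] that by simp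
  have "expectation (\<lambda>x. exp (- a * V x)) =
      quot_lim (\<lambda>a. a - 0) (\<lambda>a. 0 - phi a) a * (\<kappa> * (rate q / q)) *
      quot_lim (\<lambda>a. q - phi a) (\<lambda>a. a - rate q) a" if a: "0 \<le> a" for a
  proof (rule extend_to_quot_lim[OF continuous_on_laplace_nonneg[OF _ V0] continuous_on_phi])
    fix x :: real assume x: "0 \<le> x" "x \<noteq> 0" "x \<noteq> rate q"
    show "expectation (\<lambda>y. exp (- x * V y)) =
        (x - 0) / (0 - phi x) * (\<kappa> * (rate q / q)) * ((q - phi x) / (x - rate q))"
      unfolding VG[OF x(1)] using form[of x] x by (simp add: mult_ac)
  next
    fix x :: real assume "0 \<le> x"
    then show "phi x = 0 \<longleftrightarrow> x = 0" using pos[of x] by (cases "x = 0") auto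
  qed (use \<kappa> a q tail_eq(1)[OF q] phi_eq_iff[OF q] in auto)
  then show ?thesis using that \<kappa>(2) by blast
qed

section \<open>The random walk description\<close>

lemma trajectory_measurable:
  assumes "0 \<le> t"
  shows "Y t \<in> borel_measurable (vimage_algebra (space M) (trajectory Y) trajectory_space)"
proof -
  have "trajectory Y \<in> space M \<rightarrow> space trajectory_space"
    by (auto simp: trajectory_def space_PiM PiE_iff)
  then have "trajectory Y \<in> measurable (vimage_algebra (space M) (trajectory Y) trajectory_space) trajectory_space"
    by (rule measurable_vimage_algebra1)
  from measurable_compose[OF this measurable_component_singleton[of t]]
  show ?thesis using assms by (simp add: trajectory_def)
qed

text \<open>Independence concerns the sigma-algebra generated by the trajectory only, so freezing
  times requires measurability with respect to it and not merely to \<open>M\<close>.\<close>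

lemma X_trajectory_measurable [measurable (raw)]:
  assumes f: "f \<in> borel_measurable N"
    and g: "g \<in> measurable N (vimage_algebra (space M) (trajectory Y) trajectory_space)"
  shows "(\<lambda>z. X (f z) (g z)) \<in> borel_measurable N"
proof -
  let ?F = "vimage_algebra (space M) (trajectory Y) trajectory_space"
  have "(\<lambda>(t, x). Y (max 0 t) x) \<in> borel_measurable (borel \<Otimes>\<^sub>M ?F)"
    by (rule cadlag_jointly_measurable) (auto intro: trajectory_measurable Y_cadlag)
  from measurable_compose[OF measurable_Pair[OF f g] this]
  have [measurable]: "(\<lambda>z. Y (max 0 (f z)) (g z)) \<in> borel_measurable N" by simp
  have [measurable]: "(\<lambda>z. Y 0 (g z)) \<in> borel_measurable N"
    by (rule measurable_compose[OF g trajectory_measurable]) simp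
  show ?thesis unfolding X_def by measurable
qed


lemma right_inverse_phi_0:
  assumes m: "integrable M (Y 1)" "expectation (Y 1) < 0"
  shows "right_inverse phi 0 = 0"
proof -
  have "0 < phi a" if "0 < a" for a
    using phi_ge_mean[OF m(1), of a] mult_pos_neg[OF that m(2)] that by simp
  then have "{a. 0 \<le> a \<and> phi a = 0} = {0}" by (force simp: order_le_less)
  then show ?thesis by (simp add: right_inverse_def)
qed

definition target :: "real \<Rightarrow> real \<Rightarrow> real \<Rightarrow> real" where
  "target \<beta> \<omega> \<alpha> = quot_lim (\<lambda>a. a - right_inverse phi \<beta>) (\<lambda>a. \<beta> - phi a) \<alpha>
    * quot_lim (\<lambda>b. b) (right_inverse phi) \<beta>
    * quot_lim (\<lambda>a. \<beta> + \<omega> - phi a) (\<lambda>a. a - right_inverse phi (\<beta> + \<omega>)) \<alpha>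
    * (right_inverse phi (\<beta> + \<omega>) / (\<beta> + \<omega>))"

lemma killed_target:
  fixes V :: "'a \<Rightarrow> real" and s :: "'a \<Rightarrow> nat \<Rightarrow> real" and A :: "nat \<Rightarrow> 'a set"
  assumes b: "0 < \<beta>" "0 < \<omega>" and \<alpha>: "0 \<le> \<alpha>"
    and [measurable]: "V \<in> borel_measurable M" "\<And>j. (\<lambda>x. s x j) \<in> borel_measurable M" "\<And>n. A n \<in> sets M"
    and disj: "disjoint_family A"
    and V: "AE x in M. \<forall>n. x \<in> A n \<longrightarrow> V x = mx (s x) n"
    and E: "\<And>n a. 0 \<le> a \<Longrightarrow> (\<integral>\<^sup>+x. indicator (A n) x * ennreal (exp (- a * mx (s x) n)) \<partial>M) =
      ennreal (\<beta> / (\<beta> + \<omega>) * (1 - \<beta> / (\<beta> + \<omega>)) ^ n * F (\<beta> + \<omega>) n a)"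
  shows "expectation (\<lambda>x. exp (- \<alpha> * V x)) = target \<beta> \<omega> \<alpha>"
proof -
  have lt: "\<beta> < \<beta> + \<omega>" using b by simp
  have q: "0 < \<beta> + \<omega>" using b by simp
  note k = killed_expectation[OF b(1) lt, of V "\<lambda>n x. mx (s x) n" A, OF _ _ _ disj V E]
  have ae: "AE x in M. \<exists>n. x \<in> A n" by (rule k(1)) simp_all
  have V0: "AE x in M. 0 \<le> V x"
    using ae V by eventually_elim (metis mx_nonneg)
  have "expectation (\<lambda>x. exp (- \<alpha> * V x)) =
    quot_lim (\<lambda>a. a - rate \<beta>) (\<lambda>a. \<beta> - phi a) \<alpha> * (\<beta> / rate \<beta> * (rate (\<beta> + \<omega>) / (\<beta> + \<omega>))) *
    quot_lim (\<lambda>a. \<beta> + \<omega> - phi a) (\<lambda>a. a - rate (\<beta> + \<omega>)) \<alpha>"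
    by (rule killed_formula[OF b(1) lt _ V0 _ \<alpha>]) (use k(2) in simp_all)
  also have "\<dots> = target \<beta> \<omega> \<alpha>"
  proof -
    have "quot_lim (\<lambda>b. b) (right_inverse phi) \<beta> = \<beta> / rate \<beta>"
      using b by (subst quot_lim_regular) (auto simp: right_inverse_phi)
    then show ?thesis by (simp add: target_def right_inverse_phi[OF b(1)] right_inverse_phi[OF q] mult_ac)
  qed
  finally show ?thesis .
qed

lemma unkilled_target:
  fixes V :: "'a \<Rightarrow> real" and s :: "'a \<Rightarrow> nat \<Rightarrow> real"
  assumes q: "0 < \<omega>" and \<alpha>: "0 \<le> \<alpha>"
    and m: "integrable M (Y 1)" "expectation (Y 1) < 0"
    and V[measurable]: "V \<in> borel_measurable M" "\<And>j. (\<lambda>x. s x j) \<in> borel_measurable M"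
    and "AE x in M. V x = (SUP n. \<Sum>j<n. s x j)"
    and "\<And>n a. 0 \<le> a \<Longrightarrow> (\<integral>\<^sup>+x. ennreal (exp (- a * mx (s x) n)) \<partial>M) = ennreal (F \<omega> n a)"
  shows "expectation (\<lambda>x. exp (- \<alpha> * V x)) = target 0 \<omega> \<alpha>"
proof -
  obtain \<kappa> where lim: "((\<lambda>b. b / rate b) \<longlongrightarrow> \<kappa>) (at_right 0)"
    and f: "\<And>a. 0 \<le> a \<Longrightarrow> expectation (\<lambda>x. exp (- a * V x)) =
      quot_lim (\<lambda>a. a - 0) (\<lambda>a. 0 - phi a) a * (\<kappa> * (rate \<omega> / \<omega>)) *
      quot_lim (\<lambda>a. \<omega> - phi a) (\<lambda>a. a - rate \<omega>) a"
    by (rule unkilled_formula[OF q m V assms(7,8)]) blast+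
  have r0: "right_inverse phi 0 = 0" by (rule right_inverse_phi_0[OF m])
  have "quot_lim (\<lambda>b. b) (right_inverse phi) 0 = \<kappa>"
  proof (rule quot_lim_eqI[where h="\<lambda>b. b / rate b"])
    show "((\<lambda>b. b / rate b) \<longlongrightarrow> \<kappa>) (at 0 within {0..})"
      using lim by (simp add: at_within_Ici_at_right)
    show "\<forall>\<^sub>F u in at 0 within {0..}. u / right_inverse phi u = u / rate u"
      unfolding at_within_Ici_at_right
      using eventually_at_right_less[of 0] by eventually_elim (simp add: right_inverse_phi)
  qed (simp_all add: r0)
  then show ?thesis
    using f[OF \<alpha>] by (simp add: target_def r0 right_inverse_phi[OF q] mult_ac)
qed

lemma walk_target:
  assumes b: "0 \<le> \<beta>" "0 < \<omega>" and \<alpha>: "0 \<le> \<alpha>"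
    and m: "\<beta> = 0 \<Longrightarrow> integrable M (Y 1) \<and> expectation (Y 1) < 0"
    and walk: "inspection_walk M Y \<beta> \<omega> \<tau> Z N"
  shows "expectation (\<lambda>x. exp (- \<alpha> * walk_max Z N x)) = target \<beta> \<omega> \<alpha>"
proof -
  define q where "q = \<beta> + \<omega>"
  have q: "0 < q" using b by (simp add: q_def)
  have \<tau>0: "0 \<le> \<tau> x" if "x \<in> space M" for x using walk that by (simp add: inspection_walk_def)
  have \<tau>d: "distributed M lborel \<tau> (exponential_density q)"
    and \<tau>i: "indep_elements M borel \<tau> trajectory_space (trajectory Y)"
    and Zi: "indep_vars (\<lambda>_. borel) Z {1..}"
    and Zd: "\<And>m. 1 \<le> m \<Longrightarrow> distr M borel (Z m) = distr M borel (\<lambda>x. Y (\<tau> x) x)"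
    and Nm: "N \<in> measurable M (count_space UNIV)"
    and Np: "\<And>n. prob {x\<in>space M. N x = enat n} = (\<omega> / q) ^ n * (\<beta> / q)"
    and Ni: "indep_elements M (count_space UNIV) N (PiM {1..} (\<lambda>_. borel)) (\<lambda>x. \<lambda>m\<in>{1..}. Z m x)"
    using walk by (auto simp: inspection_walk_def q_def)
  have \<tau>m[measurable]: "\<tau> \<in> borel_measurable M" using \<tau>i by (simp add: indep_elements_def)
  have Zm[measurable]: "Z m \<in> borel_measurable M" if "1 \<le> m" for m
    using Zi that by (auto simp: indep_vars_def)
  have Y\<tau>: "Y (\<tau> x) x = X (\<tau> x) x + Y 0 x" if "x \<in> space M" for x
    using \<tau>0[OF that] by (simp add: X_def)
  have Y0[measurable]: "Y 0 \<in> borel_measurable M" by (rule Y_measurable) simp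
  have Y\<tau>m[measurable]: "(\<lambda>x. Y (\<tau> x) x) \<in> borel_measurable M"
    by (subst measurable_cong[OF Y\<tau>]) simp_all
  \<comment> \<open>Freezing \<open>\<tau>\<close> by independence separates the exponential time
    from the path, which is how \<open>mu q\<close> is built.\<close>
  have step: "(\<integral>\<^sup>+x. h (Z k x) \<partial>M) = (\<integral>\<^sup>+y. h y \<partial>mu q)"
    if k: "1 \<le> k" and h[measurable]: "h \<in> borel_measurable borel" for k and h :: "real \<Rightarrow> ennreal"
  proof -
    have "(\<integral>\<^sup>+x. h (Z k x) \<partial>M) = (\<integral>\<^sup>+y. h y \<partial>distr M borel (Z k))"
      using k by (simp add: nn_integral_distr)
    also have "\<dots> = (\<integral>\<^sup>+x. h (Y (\<tau> x) x) \<partial>M)"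
      unfolding Zd[OF k] by (simp add: nn_integral_distr)
    also have "\<dots> = (\<integral>\<^sup>+x. h (X (\<tau> x) x) \<partial>M)"
    proof (rule nn_integral_cong_AE)
      show "AE x in M. h (Y (\<tau> x) x) = h (X (\<tau> x) x)"
        using AE_X_eq AE_space by eventually_elim (use \<tau>0 in auto)
    qed
    also have "\<dots> = (\<integral>\<^sup>+x. (\<integral>\<^sup>+y. h (X (\<tau> x) y) \<partial>M) \<partial>M)"
      by (rule indep_elements_nn_integral[OF \<tau>i, of "\<lambda>t y. h (X t y)"]) measurable
    also have "\<dots> = (\<integral>\<^sup>+t. (\<integral>\<^sup>+y. h (X t y) \<partial>M) \<partial>expo q)"
      using distributed_nn_integral[OF \<tau>d, of "\<lambda>t. \<integral>\<^sup>+y. h (X t y) \<partial>M"]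
      by (simp add: nn_integral_expo)
    also have "\<dots> = (\<integral>\<^sup>+y. h y \<partial>mu q)" by (rule nn_integral_mu[symmetric]) simp
    finally show ?thesis .
  qed
  \<comment> \<open>The walk numbers its steps from 1, \<open>mx\<close> from 0.\<close>
  define s where "s x j = Z (1 + j) x" for x j
  have sm[measurable]: "(\<lambda>x. s x j) \<in> borel_measurable M" for j unfolding s_def by simp
  have E: "(\<integral>\<^sup>+x. ennreal (exp (- a * mx (s x) n)) \<partial>M) = ennreal (F q n a)" if a: "0 \<le> a" for n a
  proof -
    \<comment> \<open>The steps \<open>Z\<close> are already conditioned on survival, so all weights
      are 1 and killing enters through \<open>N\<close> alone.\<close>
    have "(\<integral>\<^sup>+x. (\<Prod>j<n + 0. 1) * ennreal (exp (- a * mx (\<lambda>j. Z (1 + j) x) n)) \<partial>M) =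
        1 ^ (n + 0) * (\<integral>\<^sup>+y. ennreal (exp (- a * y)) \<partial>lam q n)"
      by (rule weighted_lindley[OF Zi, where w="\<lambda>_. 1" and z="\<lambda>z. z"])
         (use step prob_space_mu[OF q] in auto)
    then show ?thesis by (simp add: s_def[abs_def] nn_integral_F[OF q a, simplified])
  qed
  have sumZ: "(\<Sum>m=1..n. Z m x) = (\<Sum>j<n. s x j)" for n x
    by (simp add: s_def sum.atLeast1_atMost_eq)
  have predN: "Measurable.pred M (\<lambda>x. enat n \<le> N x)" for n
    by (rule measurable_compose[OF Nm]) simp
  have Vm: "walk_max Z N \<in> borel_measurable M"
    unfolding walk_max_def[abs_def]
    by (rule borel_measurable_SUP_real) (auto simp: sumZ predN)
  show ?thesis
  proof (cases "\<beta> = 0")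
    case False
    then have b0: "0 < \<beta>" using b by simp
    define A where "A n = {x\<in>space M. N x = enat n}" for n
    have Am[measurable]: "A n \<in> sets M" for n
      using measurable_sets[OF Nm, of "{enat n}"] by (simp add: A_def vimage_def Int_def conj_commute)
    have Ap: "emeasure M (A n) = ennreal (\<beta> / q * (1 - \<beta> / q) ^ n)" for n
    proof -
      have "\<omega> / q = 1 - \<beta> / q" using q by (simp add: q_def field_simps)
      then show ?thesis using Np[of n] by (simp add: A_def emeasure_eq_measure mult.commute)
    qed
    show ?thesis
    proof (rule killed_target[OF b0 b(2) \<alpha> Vm sm Am])
      show "disjoint_family A" by (auto simp: disjoint_family_on_def A_def)
      show "AE x in M. \<forall>n. x \<in> A n \<longrightarrow> walk_max Z N x = mx (s x) n"
      proof (intro AE_I2 allI impI)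
        fix x n assume "x \<in> A n"
        then have "{k. enat k \<le> N x} = {..n}" by (auto simp: A_def)
        then show "walk_max Z N x = mx (s x) n"
          unfolding walk_max_def sumZ mx_eq_Max by (simp add: cSup_eq_Max)
      qed
      fix n and a :: real assume a: "0 \<le> a"
      let ?F = "vimage_algebra (space M) (\<lambda>x. \<lambda>m\<in>{1..}. Z m x) (PiM {1..} (\<lambda>_. borel))"
      have "(\<lambda>x. \<lambda>m\<in>{1..}. Z m x) \<in> space M \<rightarrow> space (PiM {1..} (\<lambda>_. borel))"
        by (auto simp: space_PiM PiE_iff)
      then have "(\<lambda>x. \<lambda>m\<in>{1..}. Z m x) \<in> measurable ?F (PiM {1..} (\<lambda>_. borel))"
        by (rule measurable_vimage_algebra1)
      from measurable_compose[OF this measurable_component_singleton]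
      have ZF: "Z (Suc j) \<in> borel_measurable ?F" for j by fastforce
      have [measurable]: "(\<lambda>y. s y j) \<in> borel_measurable ?F" for j
        using ZF[of j] by (simp add: s_def)
      have H: "(\<lambda>p. indicator {enat n} (fst p) * ennreal (exp (- a * mx (s (snd p)) n)))
          \<in> borel_measurable (count_space UNIV \<Otimes>\<^sub>M ?F)"
      proof (rule borel_measurable_times_ennreal)
        show "(\<lambda>p. indicator {enat n} (fst p) :: ennreal) \<in> borel_measurable (count_space UNIV \<Otimes>\<^sub>M ?F)"
          by (rule measurable_compose[OF measurable_fst]) simp
        have "(\<lambda>y. ennreal (exp (- a * mx (s y) n))) \<in> borel_measurable ?F" by measurable
        then show "(\<lambda>p. ennreal (exp (- a * mx (s (snd p)) n))) \<in> borel_measurable (count_space UNIV \<Otimes>\<^sub>M ?F)"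
          by (rule measurable_compose[OF measurable_snd])
      qed
      have "(\<integral>\<^sup>+x. indicator (A n) x * ennreal (exp (- a * mx (s x) n)) \<partial>M) =
          (\<integral>\<^sup>+x. (\<lambda>k y. indicator {enat n} k * ennreal (exp (- a * mx (s y) n))) (N x) x \<partial>M)"
        by (intro nn_integral_cong) (auto simp: A_def indicator_def)
      also have "\<dots> = (\<integral>\<^sup>+x. (\<integral>\<^sup>+y. indicator {enat n} (N x) * ennreal (exp (- a * mx (s y) n)) \<partial>M) \<partial>M)"
        by (rule indep_elements_nn_integral[OF Ni]) (use H in \<open>simp only: case_prod_unfold\<close>)
      also have "\<dots> = (\<integral>\<^sup>+x. ennreal (F q n a) * indicator (A n) x \<partial>M)"
      proof (rule nn_integral_cong)
        fix x assume "x \<in> space M"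
        then show "(\<integral>\<^sup>+y. indicator {enat n} (N x) * ennreal (exp (- a * mx (s y) n)) \<partial>M) = ennreal (F q n a) * indicator (A n) x"
          by (subst nn_integral_cmult) (auto simp: E[OF a, simplified] A_def indicator_def)
      qed
      also have "\<dots> = ennreal (F q n a) * emeasure M (A n)"
        by (rule nn_integral_cmult_indicator) simp
      also have "\<dots> = ennreal (\<beta> / q * (1 - \<beta> / q) ^ n * F q n a)"
        using F_bounds[OF q a, of n] b q unfolding Ap
        by (subst ennreal_mult[symmetric]) (auto simp: q_def mult_ac)
      finally show "(\<integral>\<^sup>+x. indicator (A n) x * ennreal (exp (- a * mx (s x) n)) \<partial>M) =
          ennreal (\<beta> / (\<beta> + \<omega>) * (1 - \<beta> / (\<beta> + \<omega>)) ^ n * F (\<beta> + \<omega>) n a)"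
        by (simp add: q_def)
    qed
  next
    case True
    have q\<omega>: "q = \<omega>" using True by (simp add: q_def)
    have "AE x in M. \<forall>n. N x \<noteq> enat n"
      unfolding AE_all_countable
    proof
      fix n
      have [measurable]: "{x\<in>space M. N x = enat n} \<in> sets M"
        using measurable_sets[OF Nm, of "{enat n}"] by (simp add: vimage_def Int_def conj_commute)
      have "emeasure M {x\<in>space M. N x = enat n} = 0" using Np[of n] True by (simp add: emeasure_eq_measure)
      then show "AE x in M. N x \<noteq> enat n"
        by (subst AE_iff_measurable[where N="{x\<in>space M. N x = enat n}"]) auto
    qed
    then have "AE x in M. walk_max Z N x = (SUP n. \<Sum>j<n. s x j)"
    proof eventually_elim
      case (elim x)
      then have "N x = \<infinity>" by (cases "N x") auto
      then show ?case unfolding walk_max_def sumZ by simp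
    qed
    from unkilled_target[OF b(2) \<alpha> conjunct1[OF m[OF True]] conjunct2[OF m[OF True]] Vm sm this E[unfolded q\<omega>]]
    show ?thesis unfolding True .
  qed
qed

end

section \<open>The Poisson inspection scheme\<close>

lemma (in prob_space) indep_elements_commute:
  assumes "indep_elements M S X S' X'"
  shows "indep_elements M S' X' S X"
proof -
  have "\<forall>a\<in>sets (vimage_algebra (space M) X' S'). \<forall>b\<in>sets (vimage_algebra (space M) X S).
      prob (a \<inter> b) = prob a * prob b"
    using assms unfolding indep_elements_def indep_sets2_eq by (metis Int_commute mult.commute)
  then show ?thesis using assms unfolding indep_elements_def indep_sets2_eq by simp
qed

context spectrally_positive_levy
begin

text \<open>Conditioning on the epochs and the killing time: \<open>x\<close> supplies the times and
  an independent copy \<open>y\<close> supplies the path.\<close>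

lemma freeze_times:
  fixes I :: "nat \<Rightarrow> 'a \<Rightarrow> real" and T :: "'a \<Rightarrow> ereal"
  assumes ind: "indep_elements M trajectory_space (trajectory Y) (PiM UNIV (\<lambda>_. borel) \<Otimes>\<^sub>M borel) (\<lambda>x. (\<lambda>n. I n x, T x))"
    and H: "(\<lambda>((\<iota>, t), y). H \<iota> t y) \<in> borel_measurable ((PiM UNIV (\<lambda>_. borel) \<Otimes>\<^sub>M borel) \<Otimes>\<^sub>M
      vimage_algebra (space M) (trajectory Y) trajectory_space)"
  shows "(\<integral>\<^sup>+x. H (\<lambda>n. I n x) (T x) x \<partial>M) = (\<integral>\<^sup>+x. (\<integral>\<^sup>+y. H (\<lambda>n. I n x) (T x) y \<partial>M) \<partial>M)"
  using indep_elements_nn_integral[OF indep_elements_commute[OF ind], of "\<lambda>p y. H (fst p) (snd p) y"] H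
  by (simp add: case_prod_unfold)

text \<open>With frozen epochs the increments are taken at deterministic times, hence independent,
  each with a law that depends only on its interarrival time. Independence of the interarrival times
  then factors the outer integral. The interarrival time stays an argument of \<open>g\<close>
  because the killing weights depend on it.\<close>

lemma prod_increments_at_times:
  fixes I :: "nat \<Rightarrow> 'a \<Rightarrow> real" and T :: "'a \<Rightarrow> ereal"
  assumes ind: "indep_elements M trajectory_space (trajectory Y) (PiM UNIV (\<lambda>_. borel) \<Otimes>\<^sub>M borel) (\<lambda>x. (\<lambda>n. I n x, T x))"
    and I: "\<And>x. x \<in> space M \<Longrightarrow> I 0 x = 0 \<and> strict_mono (\<lambda>n. I n x)"
    and D: "indep_vars (\<lambda>_. borel) (\<lambda>n x. I (Suc n) x - I n x) UNIV"
    and J: "finite J" and g[measurable]: "\<And>j. g j \<in> borel_measurable (borel \<Otimes>\<^sub>M borel)"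
  shows "(\<integral>\<^sup>+x. (\<Prod>j\<in>J. g j (I (Suc j) x - I j x, X (I (Suc j) x) x - X (I j x) x)) \<partial>M) =
    (\<Prod>j\<in>J. \<integral>\<^sup>+x. (\<integral>\<^sup>+y. g j (I (Suc j) x - I j x, X (I (Suc j) x - I j x) y) \<partial>M) \<partial>M)"
proof -
  let ?F = "vimage_algebra (space M) (trajectory Y) trajectory_space"
  define v where "v j d = (\<integral>\<^sup>+y. g j (d, X d y) \<partial>M)" for j d
  have [measurable]: "v j \<in> borel_measurable borel" for j unfolding v_def by measurable
  obtain n where n: "J \<subseteq> {..<n}" using finite_nat_iff_bounded J by blast
  have "(\<integral>\<^sup>+x. (\<Prod>j\<in>J. g j (I (Suc j) x - I j x, X (I (Suc j) x) x - X (I j x) x)) \<partial>M) =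
      (\<integral>\<^sup>+x. (\<integral>\<^sup>+y. (\<Prod>j\<in>J. g j (I (Suc j) x - I j x, X (I (Suc j) x) y - X (I j x) y)) \<partial>M) \<partial>M)"
  proof (rule freeze_times[OF ind, of "\<lambda>\<iota> t y. \<Prod>j\<in>J. g j (\<iota> (Suc j) - \<iota> j, X (\<iota> (Suc j)) y - X (\<iota> j) y)"])
    have [measurable]: "(\<lambda>p. fst (fst p) j) \<in> borel_measurable ((PiM UNIV (\<lambda>_. borel) \<Otimes>\<^sub>M borel) \<Otimes>\<^sub>M ?F)" for j
      by (rule measurable_compose[OF measurable_compose[OF measurable_fst measurable_fst] measurable_component_singleton]) simp
    show "(\<lambda>((\<iota>, t), y). \<Prod>j\<in>J. g j (\<iota> (Suc j) - \<iota> j, X (\<iota> (Suc j)) y - X (\<iota> j) y)) \<in>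
        borel_measurable ((PiM UNIV (\<lambda>_. borel) \<Otimes>\<^sub>M borel) \<Otimes>\<^sub>M ?F)"
      unfolding case_prod_unfold by measurable
  qed
  also have "\<dots> = (\<integral>\<^sup>+x. (\<Prod>j\<in>J. v j (I (Suc j) x - I j x)) \<partial>M)"
  proof (rule nn_integral_cong)
    fix x assume x: "x \<in> space M"
    have st: "I j x \<le> I (Suc j) x" for j using I[OF x] by (auto dest: strict_monoD[of _ j "Suc j"] intro: less_imp_le)
    have nonneg: "0 \<le> I j x" for j
      using lift_Suc_mono_le[of "\<lambda>n. I n x" 0 j] st I[OF x] by simp
    have "indep_vars (\<lambda>_. borel) (\<lambda>j y. X (I (Suc j) x) y - X (I j x) y) {..<n}"
      by (rule X_increments_indep) (use nonneg st in auto)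
    then have "indep_vars (\<lambda>_. borel) (\<lambda>j y. X (I (Suc j) x) y - X (I j x) y) J"
      by (rule indep_vars_subset) fact
    then have "indep_vars (\<lambda>_. borel) (\<lambda>j y. g j (I (Suc j) x - I j x, X (I (Suc j) x) y - X (I j x) y)) J"
      by (rule indep_vars_compose2) measurable
    then have "(\<integral>\<^sup>+y. (\<Prod>j\<in>J. g j (I (Suc j) x - I j x, X (I (Suc j) x) y - X (I j x) y)) \<partial>M) =
        (\<Prod>j\<in>J. \<integral>\<^sup>+y. g j (I (Suc j) x - I j x, X (I (Suc j) x) y - X (I j x) y) \<partial>M)"
      by (intro indep_vars_nn_integral J) auto
    also have "\<dots> = (\<Prod>j\<in>J. v j (I (Suc j) x - I j x))"
    proof (rule prod.cong)
      fix j assume "j \<in> J"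
      show "(\<integral>\<^sup>+y. g j (I (Suc j) x - I j x, X (I (Suc j) x) y - X (I j x) y) \<partial>M) = v j (I (Suc j) x - I j x)"
        using nn_integral_X_increment[of "I j x" "I (Suc j) x - I j x" "\<lambda>z. g j (I (Suc j) x - I j x, z)"] nonneg st
        by (simp add: v_def)
    qed simp
    finally show "(\<integral>\<^sup>+y. (\<Prod>j\<in>J. g j (I (Suc j) x - I j x, X (I (Suc j) x) y - X (I j x) y)) \<partial>M) =
        (\<Prod>j\<in>J. v j (I (Suc j) x - I j x))" .
  qed
  also have "\<dots> = (\<Prod>j\<in>J. \<integral>\<^sup>+x. v j (I (Suc j) x - I j x) \<partial>M)"
  proof (rule indep_vars_nn_integral[OF J])
    have "indep_vars (\<lambda>_. borel) (\<lambda>n x. I (Suc n) x - I n x) J"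
      by (rule indep_vars_subset[OF D]) simp
    then show "indep_vars (\<lambda>_. borel) (\<lambda>j x. v j (I (Suc j) x - I j x)) J"
      by (rule indep_vars_compose2) measurable
  qed simp
  finally show ?thesis by (simp add: v_def)
qed

text \<open>Indicators in place of \<open>g\<close> turn the product formula into independence; the
  same formula on singletons identifies the factors as the marginal probabilities.\<close>

lemma indep_increments_at_times:
  fixes I :: "nat \<Rightarrow> 'a \<Rightarrow> real" and T :: "'a \<Rightarrow> ereal"
  assumes ind: "indep_elements M trajectory_space (trajectory Y) (PiM UNIV (\<lambda>_. borel) \<Otimes>\<^sub>M borel) (\<lambda>x. (\<lambda>n. I n x, T x))"
    and I: "\<And>x. x \<in> space M \<Longrightarrow> I 0 x = 0 \<and> strict_mono (\<lambda>n. I n x)"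
    and D: "indep_vars (\<lambda>_. borel) (\<lambda>n x. I (Suc n) x - I n x) UNIV"
    and [measurable]: "\<And>n. I n \<in> borel_measurable M"
  shows "indep_vars (\<lambda>_. borel \<Otimes>\<^sub>M borel) (\<lambda>j x. (I (Suc j) x - I j x, X (I (Suc j) x) x - X (I j x) x)) UNIV"
    (is "indep_vars _ ?U _")
  unfolding indep_vars_def2
proof (intro conjI ballI indep_setsI)
  have U[measurable]: "?U j \<in> measurable M (borel \<Otimes>\<^sub>M borel)" for j by measurable
  then show "?U j \<in> measurable M (borel \<Otimes>\<^sub>M borel)" for j .
  show "{?U j -` A \<inter> space M |A. A \<in> sets (borel \<Otimes>\<^sub>M borel)} \<subseteq> events" for j
    using measurable_sets[OF U[of j]] by auto
  fix A and J :: "nat set" assume J: "finite J" and A: "\<forall>j\<in>J. A j \<in> {?U j -` A \<inter> space M |A. A \<in> sets (borel \<Otimes>\<^sub>M borel)}"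
    and ne: "J \<noteq> {}"
  have "\<forall>j\<in>J. \<exists>B. B \<in> sets (borel \<Otimes>\<^sub>M borel) \<and> A j = ?U j -` B \<inter> space M"
    using A by blast
  then obtain B' where B': "\<forall>j\<in>J. B' j \<in> sets (borel \<Otimes>\<^sub>M borel) \<and> A j = ?U j -` B' j \<inter> space M"
    by (rule bchoice[THEN exE])
  \<comment> \<open>The product formula wants measurable functions at every index, so the sets are
    completed by the empty set outside \<open>J\<close>.\<close>
  define B where "B j = (if j \<in> J then B' j else {})" for j
  have B[measurable]: "B j \<in> sets (borel \<Otimes>\<^sub>M borel)" for j using B' by (simp add: B_def)
  have AB: "A j = ?U j -` B j \<inter> space M" if "j \<in> J" for j using B' that by (simp add: B_def)
  note pr = prod_increments_at_times[OF ind I D, of _ "\<lambda>j. indicator (B j)"]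
  have one: "emeasure M (A j) = (\<integral>\<^sup>+x. (\<integral>\<^sup>+y. indicator (B j) (I (Suc j) x - I j x, X (I (Suc j) x - I j x) y) \<partial>M) \<partial>M)"
    if j: "j \<in> J" for j
  proof -
    have "emeasure M (A j) = (\<integral>\<^sup>+x. indicator (A j) x \<partial>M)"
      using AB[OF j] by (intro nn_integral_indicator[symmetric]) simp
    also have "\<dots> = (\<integral>\<^sup>+x. (\<Prod>j\<in>{j}. indicator (B j) (?U j x)) \<partial>M)"
      by (intro nn_integral_cong) (auto simp: AB[OF j] indicator_def)
    finally show ?thesis using pr[of "{j}"] by simp
  qed
  have "emeasure M (\<Inter>j\<in>J. A j) = (\<integral>\<^sup>+x. indicator (\<Inter>j\<in>J. A j) x \<partial>M)"
    using AB J ne by (intro nn_integral_indicator[symmetric] sets.finite_INT) auto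
  also have "\<dots> = (\<integral>\<^sup>+x. (\<Prod>j\<in>J. indicator (B j) (?U j x)) \<partial>M)"
  proof (rule nn_integral_cong)
    fix x assume x: "x \<in> space M"
    show "indicator (\<Inter>j\<in>J. A j) x = (\<Prod>j\<in>J. indicator (B j) (?U j x) :: ennreal)"
    proof (cases "\<forall>j\<in>J. ?U j x \<in> B j")
      case True
      then show ?thesis using AB x by (auto simp: indicator_def)
    next
      case False
      then obtain j where j: "j \<in> J" "?U j x \<notin> B j" by auto
      then have "(\<Prod>j\<in>J. indicator (B j) (?U j x) :: ennreal) = 0"
        by (intro prod_zero[OF J] bexI[OF _ j(1)]) simp
      moreover have "x \<notin> (\<Inter>j\<in>J. A j)" using j AB by auto
      ultimately show ?thesis by simp
    qed
  qed
  also have "\<dots> = (\<Prod>j\<in>J. emeasure M (A j))"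
    using pr[OF _ J] one by (simp cong: prod.cong)
  finally show "prob (\<Inter>j\<in>J. A j) = (\<Prod>j\<in>J. prob (A j))"
    by (simp add: emeasure_eq_measure prod_ennreal prod_nonneg)
qed

lemma scheme_target:
  assumes b: "0 \<le> \<beta>" "0 < \<omega>" and \<alpha>: "0 \<le> \<alpha>"
    and m: "\<beta> = 0 \<Longrightarrow> integrable M (Y 1) \<and> expectation (Y 1) < 0"
    and scheme: "inspection_scheme M Y \<beta> \<omega> I T"
  shows "expectation (\<lambda>x. exp (- \<alpha> * inspected_max Y I T x)) = target \<beta> \<omega> \<alpha>"
proof -
  define q where "q = \<beta> + \<omega>"
  have q: "0 < q" using b by (simp add: q_def)
  have I: "\<And>x. x \<in> space M \<Longrightarrow> I 0 x = 0 \<and> strict_mono (\<lambda>n. I n x)"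
    and D: "indep_vars (\<lambda>_. borel) (\<lambda>n x. I (Suc n) x - I n x) UNIV"
    and Dd: "\<And>n. distributed M lborel (\<lambda>x. I (Suc n) x - I n x) (exponential_density \<omega>)"
    and kill: "killing_time M \<beta> T"
    and IT: "indep_elements M (PiM UNIV (\<lambda>_. borel)) (\<lambda>x n. I n x) borel T"
    and ind: "indep_elements M trajectory_space (trajectory Y) (PiM UNIV (\<lambda>_. borel) \<Otimes>\<^sub>M borel) (\<lambda>x. (\<lambda>n. I n x, T x))"
    using scheme by (auto simp: inspection_scheme_def poisson_epochs_def)
  have IM: "(\<lambda>x n. I n x) \<in> measurable M (PiM UNIV (\<lambda>_. borel))" and Tm[measurable]: "T \<in> borel_measurable M"
    using IT by (auto simp: indep_elements_def)
  have Im[measurable]: "I n \<in> borel_measurable M" for n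
    using measurable_compose[OF IM measurable_component_singleton[of n]] by simp
  have st: "I j x < I (Suc j) x" if "x \<in> space M" for j x
    using I[OF that] by (auto dest: strict_monoD[of _ j "Suc j"])
  have Imono: "I j x \<le> I k x" if "x \<in> space M" "j \<le> k" for j k x
    using I[OF that(1)] that(2) by (auto dest: strict_mono_leD)
  have I0: "0 \<le> I j x" if "x \<in> space M" for j x
    using Imono[OF that, of 0 j] I[OF that] by simp
  define s where "s x j = X (I (Suc j) x) x - X (I j x) x" for x j
  have sm[measurable]: "(\<lambda>x. s x j) \<in> borel_measurable M" for j unfolding s_def by measurable
  have sum_s: "(\<Sum>j<k. s x j) = X (I k x) x" if "x \<in> space M" for k x
    using I[OF that] sum_lessThan_telescope[of "\<lambda>j. X (I j x) x" k] by (simp add: s_def)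
  let ?U = "\<lambda>j x. (I (Suc j) x - I j x, X (I (Suc j) x) x - X (I j x) x)"
  have U: "indep_vars (\<lambda>_. borel \<Otimes>\<^sub>M borel) ?U {0..}"
    using indep_increments_at_times[OF ind I D Im] by (simp add: atLeast_0)
  \<comment> \<open>Weighting an interarrival time by its survival probability raises its rate from
    \<open>\<omega>\<close> to \<open>q\<close> and leaves the factor
    \<open>\<omega> / q\<close>.\<close>
  have step: "(\<integral>\<^sup>+x. ennreal (exp (- \<beta> * fst (?U k x))) * h (snd (?U k x)) \<partial>M) = ennreal (\<omega> / q) * (\<integral>\<^sup>+y. h y \<partial>mu q)"
    if h[measurable]: "h \<in> borel_measurable borel" for k and h :: "real \<Rightarrow> ennreal"
  proof -
    define g where "g t = (\<integral>\<^sup>+y. h (X t y) \<partial>M)" for t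
    have [measurable]: "g \<in> borel_measurable borel" unfolding g_def by measurable
    have "(\<integral>\<^sup>+x. (\<Prod>j\<in>{k}. (\<lambda>p. ennreal (exp (- \<beta> * fst p)) * h (snd p)) (?U j x)) \<partial>M) =
      (\<Prod>j\<in>{k}. \<integral>\<^sup>+x. (\<integral>\<^sup>+y. (\<lambda>p. ennreal (exp (- \<beta> * fst p)) * h (snd p)) (I (Suc j) x - I j x, X (I (Suc j) x - I j x) y) \<partial>M) \<partial>M)"
      by (rule prod_increments_at_times[OF ind I D, where g="\<lambda>_ p. ennreal (exp (- \<beta> * fst p)) * h (snd p)"]) auto
    then have "(\<integral>\<^sup>+x. ennreal (exp (- \<beta> * fst (?U k x))) * h (snd (?U k x)) \<partial>M) =
        (\<integral>\<^sup>+x. (\<integral>\<^sup>+y. ennreal (exp (- \<beta> * (I (Suc k) x - I k x))) * h (X (I (Suc k) x - I k x) y) \<partial>M) \<partial>M)"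
      by simp
    also have "\<dots> = (\<integral>\<^sup>+x. ennreal (exp (- \<beta> * (I (Suc k) x - I k x))) * g (I (Suc k) x - I k x) \<partial>M)"
      unfolding g_def by (intro nn_integral_cong nn_integral_cmult) simp
    also have "\<dots> = (\<integral>\<^sup>+t. ennreal (exp (- \<beta> * t)) * g t \<partial>expo \<omega>)"
      using distributed_nn_integral[OF Dd, of "\<lambda>t. ennreal (exp (- \<beta> * t)) * g t" k]
      by (subst nn_integral_expo) simp_all
    also have "\<dots> = ennreal (\<omega> / (\<omega> - - \<beta>)) * (\<integral>\<^sup>+t. g t \<partial>expo (\<omega> - - \<beta>))"
      by (rule nn_integral_expo_tilt) (use b in auto)
    also have "\<omega> - - \<beta> = q" by (simp add: q_def)
    also have "(\<integral>\<^sup>+t. g t \<partial>expo q) = (\<integral>\<^sup>+y. h y \<partial>mu q)"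
      unfolding g_def by (rule nn_integral_mu[symmetric]) simp
    finally show ?thesis .
  qed
  \<comment> \<open>\<open>r = 0\<close> stands for survival up to epoch \<open>n\<close> and
    \<open>r = 1\<close> up to epoch \<open>n + 1\<close>, with the maximum over the first
    \<open>n\<close> steps in both cases.\<close>
  have E: "(\<integral>\<^sup>+x. ennreal (exp (- \<beta> * I (n + r) x)) * ennreal (exp (- a * mx (s x) n)) \<partial>M) =
      ennreal ((\<omega> / q) ^ (n + r) * F q n a)" if a: "0 \<le> a" and r: "r \<le> 1" for n a r
  proof -
    have "(\<integral>\<^sup>+x. (\<Prod>j<n + r. ennreal (exp (- \<beta> * fst (?U (0 + j) x)))) * ennreal (exp (- a * mx (\<lambda>j. snd (?U (0 + j) x)) n)) \<partial>M) =
        ennreal (\<omega> / q) ^ (n + r) * (\<integral>\<^sup>+y. ennreal (exp (- a * y)) \<partial>lam q n)"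
      by (rule weighted_lindley[OF U, where w="\<lambda>p. ennreal (exp (- \<beta> * fst p))" and z=snd])
         (use step prob_space_mu[OF q] r in auto)
    also have "\<dots> = ennreal ((\<omega> / q) ^ (n + r) * F q n a)"
      using b q F_bounds(1)[OF q a] by (simp only: nn_integral_F[OF q a] ennreal_power ennreal_mult
          divide_nonneg_nonneg less_imp_le zero_le_power)
    also have "(\<integral>\<^sup>+x. (\<Prod>j<n + r. ennreal (exp (- \<beta> * fst (?U (0 + j) x)))) * ennreal (exp (- a * mx (\<lambda>j. snd (?U (0 + j) x)) n)) \<partial>M) =
        (\<integral>\<^sup>+x. ennreal (exp (- \<beta> * I (n + r) x)) * ennreal (exp (- a * mx (s x) n)) \<partial>M)"
    proof (rule nn_integral_cong)
      fix x assume x: "x \<in> space M"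
      have "(\<Prod>j<n + r. ennreal (exp (- \<beta> * fst (?U (0 + j) x)))) = ennreal (exp (\<Sum>j<n + r. - \<beta> * (I (Suc j) x - I j x)))"
        by (simp add: prod_ennreal exp_sum)
      also have "(\<Sum>j<n + r. - \<beta> * (I (Suc j) x - I j x)) = - \<beta> * I (n + r) x"
        unfolding sum_distrib_left[symmetric]
        using I[OF x] sum_lessThan_telescope[of "\<lambda>j. I j x" "n + r"] by simp
      finally show "(\<Prod>j<n + r. ennreal (exp (- \<beta> * fst (?U (0 + j) x)))) * ennreal (exp (- a * mx (\<lambda>j. snd (?U (0 + j) x)) n)) =
        ennreal (exp (- \<beta> * I (n + r) x)) * ennreal (exp (- a * mx (s x) n))"
        by (simp add: s_def[abs_def])
    qed
    finally show ?thesis .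
  qed
  have YI: "AE x in M. \<forall>n. Y (I n x) x = X (I n x) x"
    using AE_X_eq AE_space by eventually_elim (use I0 in auto)
  have Vm: "inspected_max Y I T \<in> borel_measurable M"
    unfolding inspected_max_def[abs_def]
  proof (rule borel_measurable_SUP_real)
    fix n
    have Y0[measurable]: "Y 0 \<in> borel_measurable M" by (rule Y_measurable) simp
    have "Y (I n x) x = X (I n x) x + Y 0 x" if "x \<in> space M" for x
      using I0[OF that, of n] by (simp add: X_def)
    then show "(\<lambda>x. Y (I n x) x) \<in> borel_measurable M"
      by (subst measurable_cong[of M _ "\<lambda>x. X (I n x) x + Y 0 x"]) simp_all
    show "Measurable.pred M (\<lambda>x. n \<in> {n. ereal (I n x) \<le> T x})" by simp
  qed
  show ?thesis
  proof (cases "\<beta> = 0")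
    case True
    have q\<omega>: "q = \<omega>" using True by (simp add: q_def)
    have "AE x in M. inspected_max Y I T x = (SUP n. \<Sum>j<n. s x j)"
      using YI AE_space
    proof eventually_elim
      case (elim x)
      have "T x = \<infinity>" using kill elim True by (simp add: killing_time_def)
      then show ?case using elim sum_s[OF elim(2)] by (simp add: inspected_max_def)
    qed
    note V = this
    have E0: "(\<integral>\<^sup>+x. ennreal (exp (- a * mx (s x) n)) \<partial>M) = ennreal (F \<omega> n a)" if "0 \<le> a" for n a
      using E[OF that, of 0 n] True b q\<omega> by simp
    from unkilled_target[OF b(2) \<alpha> conjunct1[OF m[OF True]] conjunct2[OF m[OF True]] Vm sm V E0]
    show ?thesis unfolding True .
  next
    case False
    then have b0: "0 < \<beta>" using b by simp
    obtain K where Kd: "distributed M lborel K (exponential_density \<beta>)" and TK: "\<And>x. x \<in> space M \<Longrightarrow> T x = ereal (K x)"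
      using kill b0 by (auto simp: killing_time_def)
    have surv: "(\<integral>\<^sup>+y. indicator {ereal t..} (T y) \<partial>M) = ennreal (exp (- \<beta> * t))" if t: "0 \<le> t" for t
    proof -
      have "(\<integral>\<^sup>+y. indicator {ereal t..} (T y) \<partial>M) = (\<integral>\<^sup>+y. indicator {t..} (K y) \<partial>M)"
        by (intro nn_integral_cong) (simp add: TK indicator_def)
      also have "\<dots> = (\<integral>\<^sup>+u. indicator {t..} u * 1 \<partial>expo \<beta>)"
        using distributed_nn_integral[OF Kd, of "indicator {t..}"] by (subst nn_integral_expo) simp_all
      also have "\<dots> = ennreal (exp (- \<beta> * t)) * (\<integral>\<^sup>+u. 1 \<partial>expo \<beta>)"
        by (rule nn_integral_expo_shift[OF b0 t]) simp
      finally show ?thesis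
        using prob_space.emeasure_space_1[OF prob_space_expo[OF b0]] by simp
    qed
    \<comment> \<open>The path is frozen out first; the survival indicator is then averaged over
      \<open>T\<close> with the epochs fixed; finally the path is put back. Independence is only
      given for these nested pairs.\<close>
    have tail_part: "(\<integral>\<^sup>+x. indicator {ereal (I k x)..} (T x) * ennreal (exp (- a * mx (s x) n)) \<partial>M) =
        (\<integral>\<^sup>+x. ennreal (exp (- \<beta> * I k x)) * ennreal (exp (- a * mx (s x) n)) \<partial>M)" for k n a
    proof -
      let ?F = "vimage_algebra (space M) (trajectory Y) trajectory_space"
      let ?S = "(PiM UNIV (\<lambda>_. borel) \<Otimes>\<^sub>M borel) \<Otimes>\<^sub>M ?F"
      let ?m = "\<lambda>\<iota> y. ennreal (exp (- a * mx (\<lambda>j. X (\<iota> (Suc j)) y - X (\<iota> j) y) n))"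
      define \<Phi> where "\<Phi> \<iota> = (\<integral>\<^sup>+y. ?m \<iota> y \<partial>M)" for \<iota>
      have c1[measurable]: "(\<lambda>p. fst (fst p) j) \<in> borel_measurable ?S" for j
        by (rule measurable_compose[OF measurable_compose[OF measurable_fst measurable_fst] measurable_component_singleton]) simp
      have c2[measurable]: "(\<lambda>p. fst p j) \<in> borel_measurable (PiM UNIV (\<lambda>_. borel) \<Otimes>\<^sub>M N)" for j :: nat and N :: "'a measure"
        by (rule measurable_compose[OF measurable_fst measurable_component_singleton]) simp
      have "(\<lambda>p. ?m (fst p) (snd p)) \<in> borel_measurable (PiM UNIV (\<lambda>_. borel) \<Otimes>\<^sub>M M)" by measurable
      then have \<Phi>m: "\<Phi> \<in> borel_measurable (PiM UNIV (\<lambda>_. borel))"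
        unfolding \<Phi>_def[abs_def] by (intro borel_measurable_nn_integral) (simp add: case_prod_unfold)
      have H1: "(\<lambda>((\<iota>, t), y). indicator {ereal (\<iota> k)..} t * ?m \<iota> y) \<in> borel_measurable ?S"
      proof -
        have "(\<lambda>p. (if ereal (fst (fst p) k) \<le> snd (fst p) then 1 else 0) * ?m (fst (fst p)) (snd p)) \<in> borel_measurable ?S"
          by measurable
        then show ?thesis by (simp add: case_prod_unfold indicator_def of_bool_def)
      qed
      have H2: "(\<lambda>((\<iota>, t), y). ennreal (exp (- \<beta> * \<iota> k)) * ?m \<iota> y) \<in> borel_measurable ?S"
        unfolding case_prod_unfold by measurable
      have ms: "mx (s x) n = mx (\<lambda>j. X (I (Suc j) x) x - X (I j x) x) n" for x by (simp add: s_def[abs_def])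
      have mm: "(\<lambda>y. ?m (\<lambda>n. I n x) y) \<in> borel_measurable M" for x by measurable
      have "(\<integral>\<^sup>+x. indicator {ereal (I k x)..} (T x) * ennreal (exp (- a * mx (s x) n)) \<partial>M) =
          (\<integral>\<^sup>+x. (\<integral>\<^sup>+y. indicator {ereal (I k x)..} (T x) * ?m (\<lambda>n. I n x) y \<partial>M) \<partial>M)"
        unfolding ms by (rule freeze_times[OF ind H1])
      also have "\<dots> = (\<integral>\<^sup>+x. indicator {ereal (I k x)..} (T x) * \<Phi> (\<lambda>n. I n x) \<partial>M)"
        unfolding \<Phi>_def by (intro nn_integral_cong nn_integral_cmult mm)
      also have "\<dots> = (\<integral>\<^sup>+x. (\<integral>\<^sup>+y. indicator {ereal (I k x)..} (T y) * \<Phi> (\<lambda>n. I n x) \<partial>M) \<partial>M)"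
      proof (rule indep_elements_nn_integral[OF IT, of "\<lambda>\<iota> y. indicator {ereal (\<iota> k)..} (T y) * \<Phi> \<iota>"])
        let ?G = "vimage_algebra (space M) T borel"
        have [measurable]: "T \<in> borel_measurable ?G" by (rule measurable_vimage_algebra1) simp
        have [measurable]: "(\<lambda>p. \<Phi> (fst p)) \<in> borel_measurable (PiM UNIV (\<lambda>_. borel) \<Otimes>\<^sub>M ?G)"
          by (rule measurable_compose[OF measurable_fst \<Phi>m])
        have "(\<lambda>p. (if ereal (fst p k) \<le> T (snd p) then 1 else 0) * \<Phi> (fst p)) \<in> borel_measurable (PiM UNIV (\<lambda>_. borel) \<Otimes>\<^sub>M ?G)"
          by measurable
        then show "(\<lambda>(\<iota>, y). indicator {ereal (\<iota> k)..} (T y) * \<Phi> \<iota>) \<in> borel_measurable (PiM UNIV (\<lambda>_. borel) \<Otimes>\<^sub>M ?G)"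
          by (simp add: case_prod_unfold indicator_def of_bool_def)
      qed
      also have "\<dots> = (\<integral>\<^sup>+x. ennreal (exp (- \<beta> * I k x)) * \<Phi> (\<lambda>n. I n x) \<partial>M)"
      proof (rule nn_integral_cong)
        fix x assume x: "x \<in> space M"
        have "(\<integral>\<^sup>+y. indicator {ereal (I k x)..} (T y) * \<Phi> (\<lambda>n. I n x) \<partial>M) =
            (\<integral>\<^sup>+y. indicator {ereal (I k x)..} (T y) \<partial>M) * \<Phi> (\<lambda>n. I n x)"
          by (rule nn_integral_multc) simp
        then show "(\<integral>\<^sup>+y. indicator {ereal (I k x)..} (T y) * \<Phi> (\<lambda>n. I n x) \<partial>M) =
            ennreal (exp (- \<beta> * I k x)) * \<Phi> (\<lambda>n. I n x)"
          by (simp only: surv[OF I0[OF x]])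
      qed
      also have "\<dots> = (\<integral>\<^sup>+x. (\<integral>\<^sup>+y. ennreal (exp (- \<beta> * I k x)) * ?m (\<lambda>n. I n x) y \<partial>M) \<partial>M)"
        unfolding \<Phi>_def by (intro nn_integral_cong nn_integral_cmult[symmetric] mm)
      also have "\<dots> = (\<integral>\<^sup>+x. ennreal (exp (- \<beta> * I k x)) * ennreal (exp (- a * mx (s x) n)) \<partial>M)"
        unfolding ms by (rule freeze_times[OF ind H2, symmetric])
      finally show ?thesis .
    qed
    \<comment> \<open>Exactly the inspections with indices 0 to \<open>n\<close> take place; an
      inspection at the very moment of killing is counted.\<close>
    define A where "A n = {x\<in>space M. ereal (I n x) \<le> T x \<and> T x < ereal (I (Suc n) x)}" for n
    have Am[measurable]: "A n \<in> sets M" for n unfolding A_def by measurable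
    have inA: "{k. ereal (I k x) \<le> T x} = {..n}" if "x \<in> A n" for x n
    proof -
      have x: "x \<in> space M" and l: "ereal (I n x) \<le> T x" and u: "T x < ereal (I (Suc n) x)"
        using that by (auto simp: A_def)
      have "ereal (I k x) \<le> T x" if "k \<le> n" for k
        using Imono[OF x that] l order_trans ereal_less_eq(3) by blast
      moreover have "\<not> ereal (I k x) \<le> T x" if "Suc n \<le> k" for k
        using Imono[OF x that] u by (meson ereal_less_eq(3) not_less order_trans)
      ultimately show ?thesis using not_less_eq_eq by auto
    qed
    show ?thesis
    proof (rule killed_target[OF b0 b(2) \<alpha> Vm sm Am])
      show "disjoint_family A"
        unfolding disjoint_family_on_def
      proof (intro ballI impI, rule ccontr)
        fix i j :: nat assume "i \<noteq> j" "A i \<inter> A j \<noteq> {}"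
        then obtain x where "x \<in> A i" "x \<in> A j" by auto
        then have "{..i} = {..j}" using inA[of x i] inA[of x j] by simp
        then show False using \<open>i \<noteq> j\<close> by simp
      qed
      show "AE x in M. \<forall>n. x \<in> A n \<longrightarrow> inspected_max Y I T x = mx (s x) n"
        using YI AE_space
      proof (eventually_elim, intro allI impI)
        fix x n assume y: "\<forall>n. Y (I n x) x = X (I n x) x" and x: "x \<in> space M" "x \<in> A n"
        show "inspected_max Y I T x = mx (s x) n"
          unfolding inspected_max_def inA[OF x(2)] mx_eq_Max
          using y sum_s[OF x(1)] by (simp add: cSup_eq_Max)
      qed
      fix n and a :: real assume a: "0 \<le> a"
      let ?B = "\<lambda>k x. indicator {ereal (I k x)..} (T x) * ennreal (exp (- a * mx (s x) n))"
      let ?A = "\<lambda>x. indicator (A n) x * ennreal (exp (- a * mx (s x) n))"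
      have Bm: "?B k \<in> borel_measurable M" for k
      proof -
        have "(\<lambda>x. (if ereal (I k x) \<le> T x then 1 else 0) * ennreal (exp (- a * mx (s x) n))) \<in> borel_measurable M" by measurable
        then show ?thesis by (simp add: indicator_def of_bool_def)
      qed
      have B: "(\<integral>\<^sup>+x. ?B (n + r) x \<partial>M) = ennreal ((\<omega> / q) ^ (n + r) * F q n a)" if "r \<le> 1" for r
        unfolding tail_part by (rule E[OF a that])
      \<comment> \<open>Survival up to epoch \<open>n\<close> splits into killing before epoch
        \<open>n + 1\<close> and survival up to it. The term of \<open>A n\<close> is found by
        cancelling the known finite second part.\<close>
      have "(\<integral>\<^sup>+x. ?A x \<partial>M) + (\<integral>\<^sup>+x. ?B (n + 1) x \<partial>M) = (\<integral>\<^sup>+x. ?A x + ?B (n + 1) x \<partial>M)"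
        by (rule nn_integral_add[symmetric]) (use Bm in auto)
      also have "\<dots> = (\<integral>\<^sup>+x. ?B (n + 0) x \<partial>M)"
      proof (rule nn_integral_cong)
        fix x assume x: "x \<in> space M"
        have "ereal (I n x) \<le> T x" if "ereal (I (Suc n) x) \<le> T x"
          using st[OF x, of n] that by (meson ereal_less_eq(3) less_imp_le order_trans)
        then show "?A x + ?B (n + 1) x = ?B (n + 0) x"
          using x by (auto simp: A_def indicator_def not_le)
      qed
      finally have sum: "(\<integral>\<^sup>+x. ?A x \<partial>M) + ennreal ((\<omega> / q) ^ (n + 1) * F q n a) = ennreal ((\<omega> / q) ^ n * F q n a)"
        using B[of 1] B[of 0] by simp
      have p: "0 \<le> \<omega> / q" "\<omega> / q = 1 - \<beta> / q" using b q by (auto simp: q_def field_simps)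
      note Fn = F_bounds(1)[OF q a, of n]
      have "ennreal ((\<omega> / q) ^ n * F q n a) = ennreal (\<beta> / q * (\<omega> / q) ^ n * F q n a) + ennreal ((\<omega> / q) ^ (n + 1) * F q n a)"
      proof (subst ennreal_plus[symmetric])
        have "\<beta> / q * (\<omega> / q) ^ n * F q n a + (\<omega> / q) ^ (n + 1) * F q n a = (\<beta> / q + \<omega> / q) * ((\<omega> / q) ^ n * F q n a)"
          by (simp add: algebra_simps)
        also have "\<beta> / q + \<omega> / q = 1" using p by simp
        finally show "ennreal ((\<omega> / q) ^ n * F q n a) = ennreal (\<beta> / q * (\<omega> / q) ^ n * F q n a + (\<omega> / q) ^ (n + 1) * F q n a)"
          by simp
      qed (use b q Fn p(1) in \<open>auto intro!: mult_nonneg_nonneg\<close>)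
      then have "ennreal ((\<omega> / q) ^ (n + 1) * F q n a) + (\<integral>\<^sup>+x. ?A x \<partial>M) =
          ennreal ((\<omega> / q) ^ (n + 1) * F q n a) + ennreal (\<beta> / q * (\<omega> / q) ^ n * F q n a)"
        unfolding add.commute[of "ennreal ((\<omega> / q) ^ (n + 1) * F q n a)"] sum .
      then have "(\<integral>\<^sup>+x. ?A x \<partial>M) = ennreal (\<beta> / q * (\<omega> / q) ^ n * F q n a)"
        unfolding ennreal_add_left_cancel by simp
      then show "(\<integral>\<^sup>+x. ?A x \<partial>M) = ennreal (\<beta> / (\<beta> + \<omega>) * (1 - \<beta> / (\<beta> + \<omega>)) ^ n * F (\<beta> + \<omega>) n a)"
        unfolding p(2) by (simp only: q_def)
    qed
  qed
qed

end

theorem proposition1: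
  fixes M :: "'a measure" and Y :: "real \<Rightarrow> 'a \<Rightarrow> real" and \<alpha> \<beta> \<omega> :: real
  assumes "levy_process M Y"
    and "spectrally_positive M Y"
    and "\<not> (AE x in M. mono_on {0..} (\<lambda>t. Y t x))"
    and "\<omega> > 0" and "\<beta> \<ge> 0"
    and "\<beta> = 0 \<Longrightarrow> integrable M (Y 1) \<and> (\<integral>x. Y 1 x \<partial>M) < 0"
    and "\<alpha> \<ge> 0"
  shows "let \<phi> = laplace_exponent M Y;
             \<psi> = right_inverse \<phi>;
             rhs = quot_lim (\<lambda>a. a - \<psi> \<beta>) (\<lambda>a. \<beta> - \<phi> a) \<alpha>
                 * quot_lim (\<lambda>b. b) \<psi> \<beta>
                 * quot_lim (\<lambda>a. \<beta> + \<omega> - \<phi> a) (\<lambda>a. a - \<psi> (\<beta> + \<omega>)) \<alpha>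
                 * (\<psi> (\<beta> + \<omega>) / (\<beta> + \<omega>))
         in (\<forall>\<tau> Z N. inspection_walk M Y \<beta> \<omega> \<tau> Z N \<longrightarrow>
               (\<integral>x. exp (- \<alpha> * walk_max Z N x) \<partial>M) = rhs) \<and>
            (\<forall>I T. inspection_scheme M Y \<beta> \<omega> I T \<longrightarrow>
               (\<integral>x. exp (- \<alpha> * inspected_max Y I T x) \<partial>M) = rhs)"
proof -
  interpret prob_space M using assms(1) by (simp add: levy_process_def)
  interpret spectrally_positive_levy M Y by unfold_locales fact+
  show ?thesis
    unfolding Let_def
    using walk_target[OF assms(5,4,7,6)] scheme_target[OF assms(5,4,7,6)]
    unfolding target_def phi_def by blast
qed

end
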